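(* Let $d\in\{1,2,3\}$ and let $\Omega$ be the $d$-dimensional torus identified with the unit cell $(0,1)^d$ with periodic boundary conditions; let $X=H^1(\Omega)$ (periodic $H^1$) with inner product $(u,v)_X=\int_\Omega uv+\int_\Omega\nabla u\cdot\nabla v$, and let $V\in H^{r_v}(\Omega)$ for some $r_v\ge2$ with $V\ge V_{\min}>0$. Let $$\mathcal{E}_{\rm eig}(u)=\frac12\int_\Omega|\nabla u|^2+\frac12\int_\Omega V|u|^2+\frac14\int_\Omega|u|^4,$$ and let $u^*_{\rm eig}\in X$ be the unique positive minimiser of $\mathcal{E}_{\rm eig}$ over $\{u\in X:\|u\|_{L^2(\Omega)}=1\}$. For $N\in\mathbb{N}$ let $X_N=\mathrm{span}\{e_{\mathbf G}:\mathbf G\in2\pi\mathbb{Z}^d,\ |\mathbf G|\le2\pi N\}$ where $e_{\mathbf G}(\mathbf x)=|\Omega|^{-1/2}e^{i\mathbf G\cdot\mathbf x}$, let $u^*_{N,\rm eig}\in X_N$ be minimisers of $\mathcal{E}_{\rm eig}$ over $\{u\in X_N:\|u\|_{L^2(\Omega)}=1\}$ satisfying $(u^*_{N,\rm eig},u^*_{\rm eig})_{L^2(\Omega)}\ge0$, and let $\Pi_N:X\to X_N$ be the $(\cdot,\cdot)_X$-orthogonal projection. Then $$\|\Pi_Nu^*_{\rm eig}-u^*_{N,\rm eig}\|_{L^2(\Omega)}+N^{-1}\|\Pi_Nu^*_{\rm eig}-u^*_{N,\rm eig}\|_{H^1(\Omega)}\lesssim N^{-3}\|\Pi_Nu^*_{\rm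 eig}-u^*_{\rm eig}\|_{H^1(\Omega)}.$$
   Context: The notation $\lesssim$ means the inequality holds up to a constant independent of $N$ (for all $N$ sufficiently large). *)

theory Defs
  imports "HOL-Analysis.Analysis"
begin

text \<open>The torus (0,1)^d with periodic boundary conditions. Functions on the torus are
represented by real-valued functions on real^'n restricted to the unit cell; periodic
Sobolev spaces are defined through Fourier coefficients with respect to the plane-wave
basis e_G(x) = exp(i G.x), G = 2 pi k, k in Z^d (|Omega| = 1).\<close>

definition Omega :: "(real^'n) set" where
  "Omega = cbox 0 One"

definition Zd :: "(real^'n) set" where
  "Zd = {k. \<forall>i. k $ i \<in> \<int>}"

definition L2 :: "(real^'n \<Rightarrow> real) \<Rightarrow> bool" where
  "L2 u \<longleftrightarrow> set_borel_measurable lborel Omega u \<and>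
              set_integrable lborel Omega (\<lambda>x. (u x)^2)"

definition fcoef :: "(real^'n \<Rightarrow> real) \<Rightarrow> real^'n \<Rightarrow> complex" where
  "fcoef u k = (LINT x:Omega|lborel. complex_of_real (u x) * cis (- (2 * pi * (k \<bullet> x))))"

definition Hs_weight :: "real \<Rightarrow> real^'n \<Rightarrow> real" where
  "Hs_weight s k = (1 + (2 * pi * norm k)^2) powr s"

definition in_Hs :: "real \<Rightarrow> (real^'n \<Rightarrow> real) \<Rightarrow> bool" where
  "in_Hs s u \<longleftrightarrow> L2 u \<and> (\<lambda>k. Hs_weight s k * (cmod (fcoef u k))^2) summable_on Zd"

definition Xsp :: "(real^'n \<Rightarrow> real) set" where
  "Xsp = {u. in_Hs 1 u}"

text \<open>(u,v)_X = int u v + int grad u . grad v, written in Fourier variables.\<close>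
definition inner_X :: "(real^'n \<Rightarrow> real) \<Rightarrow> (real^'n \<Rightarrow> real) \<Rightarrow> real" where
  "inner_X u v = infsum (\<lambda>k. Hs_weight 1 k * Re (fcoef u k * cnj (fcoef v k))) Zd"

definition H1_norm :: "(real^'n \<Rightarrow> real) \<Rightarrow> real" where
  "H1_norm u = sqrt (infsum (\<lambda>k. Hs_weight 1 k * (cmod (fcoef u k))^2) Zd)"

definition L2_inner :: "(real^'n \<Rightarrow> real) \<Rightarrow> (real^'n \<Rightarrow> real) \<Rightarrow> real" where
  "L2_inner u v = (LINT x:Omega|lborel. u x * v x)"

definition L2_norm :: "(real^'n \<Rightarrow> real) \<Rightarrow> real" where
  "L2_norm u = sqrt (LINT x:Omega|lborel. (u x)^2)"

text \<open>int |grad u|^2 = sum_G |G|^2 |u_G|^2 (Parseval).\<close>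
definition grad_sq :: "(real^'n \<Rightarrow> real) \<Rightarrow> real" where
  "grad_sq u = infsum (\<lambda>k. (2 * pi * norm k)^2 * (cmod (fcoef u k))^2) Zd"

definition E_eig :: "(real^'n \<Rightarrow> real) \<Rightarrow> (real^'n \<Rightarrow> real) \<Rightarrow> real" where
  "E_eig V u = grad_sq u / 2 + (LINT x:Omega|lborel. V x * (u x)^2) / 2
               + (LINT x:Omega|lborel. (u x)^4) / 4"

text \<open>Frequencies G = 2 pi k with |G| \<le> 2 pi N.\<close>
definition KN :: "nat \<Rightarrow> (real^'n) set" where
  "KN N = {k \<in> Zd. norm k \<le> real N}"

text \<open>X_N: real-valued elements of the span of the plane waves e_G, |G| \<le> 2 pi N.\<close>
definition XN :: "nat \<Rightarrow> (real^'n \<Rightarrow> real) set" where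
  "XN N = {u. \<exists>c. \<forall>x. complex_of_real (u x) =
                     (\<Sum>k\<in>KN N. c k * cis (2 * pi * (k \<bullet> x)))}"

definition PiN :: "nat \<Rightarrow> (real^'n \<Rightarrow> real) \<Rightarrow> (real^'n \<Rightarrow> real)" where
  "PiN N u = (THE p. p \<in> XN N \<and> (\<forall>v\<in>XN N. inner_X (\<lambda>x. u x - p x) v = 0))"

definition is_minimiser_on :: "(real^'n \<Rightarrow> real) \<Rightarrow> (real^'n \<Rightarrow> real) set \<Rightarrow> (real^'n \<Rightarrow> real) \<Rightarrow> bool" where
  "is_minimiser_on V S u \<longleftrightarrow> u \<in> S \<and> L2_norm u = 1 \<and>
      (\<forall>w\<in>S. L2_norm w = 1 \<longrightarrow> E_eig V u \<le> E_eig V w)"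

end

theory Submission
  imports Defs
begin

text \<open>
Write \<open>u\<close> for the ground state, \<open>lam\<close> for its Lagrange multiplier, \<open>w\<close> for the discrete minimiser,
\<open>p\<close> for the projection of \<open>u\<close>, \<open>\<eta> = u - p\<close>, \<open>e = p - w\<close> and \<open>d = w - u\<close>.

All Sobolev norms are weighted \<open>l\<^sup>2\<close> norms of Fourier coefficients; in dimension at most three
\<open>H\<^sup>1 \<subseteq> L\<^sup>4\<close>, and \<open>H\<^sup>2\<close> is an algebra contained in \<open>L\<^sup>\<infinity>\<close>. First-order pointwise arguments
(modulus, negative part, weak maximum principle, Picone's identity) are carried out with the nonnegative
trigonometric kernels \<open>\<Prod>\<^sub>i cos\<^sup>2\<^sup>n(\<pi> x\<^sub>i)\<close>, whose Fourier multipliers \<open>\<rho>\<^sub>n(k)\<close> satisfy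
\<open>n (1 - \<rho>\<^sub>n(k)) \<longrightarrow> |k|\<^sup>2\<close>. Testing the Euler-Lagrange equation with the positive part of \<open>u - sqrt lam\<close>
shows that \<open>u\<close> is bounded, whence \<open>u \<in> H\<^sup>4\<close>; iterating \<open>u \<ge> (c - \<Delta>)\<^sup>-\<^sup>1 u\<close> shows that \<open>u\<close> is bounded
below. Picone's identity then gives a spectral gap for \<open>-\<Delta> + V + u\<^sup>2 - lam\<close>, and the energy identity
\<open>E(w) - E(u) = Q(d)/2 + \<integral>(w\<^sup>2 - u\<^sup>2)\<^sup>2/4\<close>, where \<open>Q\<close> is the quadratic form of that operator, yields
\<open>\<parallel>d\<parallel> \<lesssim> \<parallel>\<eta>\<parallel>\<close> in \<open>H\<^sup>1\<close>.

Finally \<open>e\<close> is estimated by duality with a discrete solution \<open>\<psi>\<close>, orthogonal to \<open>w\<close>, of the linearised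
equation; orthogonality removes the difference of the multipliers. What remains is
\<open>\<integral>(V + 3u\<^sup>2) \<eta> \<psi>\<close>, which gains \<open>N\<^sup>-\<^sup>3\<close> because \<open>\<eta>\<close> has only high frequencies and \<open>\<psi>\<close> is bounded
in \<open>H\<^sup>2\<close>, and terms quadratic in \<open>d\<close>, which gain \<open>N\<^sup>-\<^sup>3\<close> because \<open>u \<in> H\<^sup>4\<close>.
\<close>

text \<open>Sobolev regularity is given only through Fourier coefficients, so no pointwise gradient
  is at hand for chain-rule arguments. The kernels replace it: up to the factor (2 pi)^2, the
  Dirichlet form is the limit of n times the difference between ip f g and a double integral of f(x)
  g(y) against a nonnegative kernel. Any two-point inequality between sums of products f(x) g(y)
  therefore passes to Dirichlet forms, even for functions not yet known to lie in H^1. The dual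
  problem is posed in X_N itself, where its equations hold mode by mode; an H^2 bound uniform in N
  is then immediate. Its solution is not orthogonal to w by itself. A multiple of a second dual
  solution, with right-hand side w, corrects this. The correction is harmless because it is paired
  with e only through ip w e = - nsq d / 2, which is again quadratic in d.\<close>

section \<open>Lebesgue measure on the unit cell\<close>

definition torus :: "(real^'n) measure" where
  "torus = restrict_space lborel Omega"

lemma sets_Omega [measurable, simp]: "Omega \<in> sets borel"
  by (simp add: Omega_def)

lemma space_torus [simp]: "space torus = Omega"
  by (simp add: torus_def space_restrict_space)

lemma set_integral_Omega:
  fixes f :: "real^'n \<Rightarrow> 'b::{banach, second_countable_topology}"
  shows "(LINT x:Omega|lborel. f x) = integral\<^sup>L torus f"
  unfolding torus_def set_lebesgue_integral_def
  by (subst integral_restrict_space) auto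

lemma set_integrable_Omega:
  fixes f :: "real^'n \<Rightarrow> 'b::{banach, second_countable_topology}"
  shows "set_integrable lborel Omega f \<longleftrightarrow> integrable torus f"
  unfolding torus_def set_integrable_def
  by (subst integrable_restrict_space) auto

lemma set_borel_measurable_Omega:
  fixes f :: "real^'n \<Rightarrow> 'b::real_normed_vector"
  shows "set_borel_measurable lborel Omega f \<longleftrightarrow> f \<in> borel_measurable torus"
  unfolding torus_def set_borel_measurable_def
  by (subst borel_measurable_restrict_space_iff) auto

lemma AE_torus: "(AE x in torus. P x) \<longleftrightarrow> (AE x in lborel. x \<in> Omega \<longrightarrow> P x)"
  unfolding torus_def by (subst AE_restrict_space_iff) auto

lemma measurable_torus: "f \<in> measurable borel N \<Longrightarrow> f \<in> measurable torus N"
  unfolding torus_def by (intro measurable_restrict_space1) simp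

lemma emeasure_torus: "emeasure (torus :: (real^'n) measure) Omega = 1"
proof -
  have "emeasure (torus :: (real^'n) measure) Omega = emeasure lborel (cbox 0 One :: (real^'n) set)"
    by (simp add: torus_def emeasure_restrict_space Omega_def)
  also have "\<dots> = 1" by (subst emeasure_lborel_cbox) (auto simp: inner_sum_left inner_Basis)
  finally show ?thesis .
qed

interpretation torus: finite_measure "torus :: (real^'n) measure"
  by standard (simp add: emeasure_torus)

lemma integral_torus_const [simp]: "integral\<^sup>L (torus :: (real^'n) measure) (\<lambda>x. c) = (c::'b::{banach, second_countable_topology})"
  by (simp add: measure_def emeasure_torus)

lemma integrable_torus_bounded:
  fixes f :: "real^'n \<Rightarrow> 'b::{banach, second_countable_topology}"
  assumes "f \<in> borel_measurable torus" "AE x in torus. norm (f x) \<le> B"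
  shows "integrable torus f"
  using assms torus.integrable_const_bound by blast

lemma continuous_measurable_torus:
  fixes f :: "real^'n \<Rightarrow> 'b::real_normed_vector"
  shows "continuous_on UNIV f \<Longrightarrow> f \<in> borel_measurable torus"
  by (intro measurable_torus borel_measurable_continuous_onI)

lemma integrable_torus_continuous:
  fixes f :: "real^'n \<Rightarrow> 'b::{banach, second_countable_topology}"
  assumes "continuous_on UNIV f"
  shows "integrable torus f"
proof -
  have "compact (f ` Omega)"
    unfolding Omega_def by (intro compact_continuous_image continuous_on_subset[OF assms]) auto
  then obtain B where B: "\<And>x. x \<in> Omega \<Longrightarrow> norm (f x) \<le> B"
    using compact_imp_bounded[of "f ` Omega"] unfolding bounded_iff by blast
  show ?thesis
    by (rule integrable_torus_bounded[where B=B]) (use assms B in \<open>auto intro: continuous_measurable_torus\<close>)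
qed

subsection \<open>Square-integrable functions\<close>

lemma L2_alt: "L2 u \<longleftrightarrow> u \<in> borel_measurable torus \<and> integrable torus (\<lambda>x. (u x)\<^sup>2)"
  by (simp add: L2_def set_borel_measurable_Omega set_integrable_Omega)

lemma L2_meas: "L2 u \<Longrightarrow> u \<in> borel_measurable torus"
  by (simp add: L2_alt)

lemma L2_sq: "L2 u \<Longrightarrow> integrable torus (\<lambda>x. (u x)\<^sup>2)"
  by (simp add: L2_alt)

lemma L2_mult_integrable:
  assumes "L2 u" "L2 v"
  shows "integrable torus (\<lambda>x. u x * v x)"
proof (rule Bochner_Integration.integrable_bound)
  show "integrable torus (\<lambda>x. (u x)\<^sup>2 + (v x)\<^sup>2)"
    using assms by (auto simp: L2_alt)
  show "(\<lambda>x. u x * v x) \<in> borel_measurable torus"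
    using assms by (auto simp: L2_alt)
  show "AE x in torus. norm (u x * v x) \<le> norm ((u x)\<^sup>2 + (v x)\<^sup>2)"
  proof (intro always_eventually allI)
    fix x
    have "2 * \<bar>u x * v x\<bar> \<le> (u x)\<^sup>2 + (v x)\<^sup>2"
      using sum_squares_bound[of "\<bar>u x\<bar>" "\<bar>v x\<bar>"] by (simp add: abs_mult mult.assoc)
    then show "norm (u x * v x) \<le> norm ((u x)\<^sup>2 + (v x)\<^sup>2)"
      by simp
  qed
qed

lemma L2_add: "L2 u \<Longrightarrow> L2 v \<Longrightarrow> L2 (\<lambda>x. u x + v x)"
  using L2_mult_integrable[of u v] by (auto simp: L2_alt power2_sum mult.assoc)

lemma L2_cmult: "L2 u \<Longrightarrow> L2 (\<lambda>x. c * u x)"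
  by (auto simp: L2_alt power_mult_distrib)

lemma L2_diff: "L2 u \<Longrightarrow> L2 v \<Longrightarrow> L2 (\<lambda>x. u x - v x)"
  using L2_add[of u "\<lambda>x. -1 * v x"] L2_cmult[of v "-1"] by simp

lemma L2_continuous: "continuous_on UNIV u \<Longrightarrow> L2 u"
  by (auto simp: L2_alt intro!: continuous_measurable_torus integrable_torus_continuous continuous_intros)

lemma L2_const: "L2 (\<lambda>x. c)"
  by (intro L2_continuous continuous_intros)

lemma L2_bounded:
  assumes "u \<in> borel_measurable torus" "AE x in torus. \<bar>u x\<bar> \<le> B"
  shows "L2 u"
proof -
  have "integrable torus (\<lambda>x. (u x)\<^sup>2)"
  proof (rule integrable_torus_bounded[where B="B\<^sup>2"])
    show "AE x in torus. norm ((u x)\<^sup>2) \<le> B\<^sup>2"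
      using assms(2)
    proof eventually_elim
      case (elim x)
      then show ?case using power_mono[of "\<bar>u x\<bar>" B 2] by simp
    qed
  qed (use assms in measurable)
  then show ?thesis using assms by (simp add: L2_alt)
qed

lemma L2_integrable: "L2 u \<Longrightarrow> integrable torus u"
  using L2_mult_integrable[OF _ L2_const[of 1], of u] by simp

lemma L2_abs: "L2 u \<Longrightarrow> L2 (\<lambda>x. \<bar>u x\<bar>)"
  by (auto simp: L2_alt)

lemma L2_mult_bounded:
  assumes "L2 u" "b \<in> borel_measurable torus" "AE x in torus. \<bar>b x\<bar> \<le> B"
  shows "L2 (\<lambda>x. b x * u x)"
  unfolding L2_alt
proof (intro conjI)
  have [measurable]: "u \<in> borel_measurable torus" "b \<in> borel_measurable torus"
    using assms L2_meas by auto
  show "(\<lambda>x. b x * u x) \<in> borel_measurable torus"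
    by measurable
  show "integrable torus (\<lambda>x. (b x * u x)\<^sup>2)"
  proof (rule Bochner_Integration.integrable_bound)
    show "integrable torus (\<lambda>x. B\<^sup>2 * (u x)\<^sup>2)" using L2_sq[OF assms(1)] by simp
    show "(\<lambda>x. (b x * u x)\<^sup>2) \<in> borel_measurable torus"
      by measurable
    show "AE x in torus. norm ((b x * u x)\<^sup>2) \<le> norm (B\<^sup>2 * (u x)\<^sup>2)"
      using assms(3)
    proof eventually_elim
      case (elim x)
      then show ?case using power_mono[of "\<bar>b x\<bar>" B 2]
        by (simp add: power_mult_distrib mult_right_mono)
    qed
  qed
qed

lemma integral_mult_bounded:
  assumes "integrable torus u" "b \<in> borel_measurable torus" "AE x in torus. \<bar>b x\<bar> \<le> B"
  shows "integrable torus (\<lambda>x. b x * u x :: real)"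
proof (rule Bochner_Integration.integrable_bound)
  show "integrable torus (\<lambda>x. B * u x)" using assms(1) by simp
  show "(\<lambda>x. b x * u x) \<in> borel_measurable torus"
    using assms by auto
  show "AE x in torus. norm (b x * u x) \<le> norm (B * u x)"
    using assms(3)
    by eventually_elim (auto simp: abs_mult intro!: mult_right_mono)
qed

abbreviation ip :: "(real^'n \<Rightarrow> real) \<Rightarrow> (real^'n \<Rightarrow> real) \<Rightarrow> real" where
  "ip u v \<equiv> integral\<^sup>L torus (\<lambda>x. u x * v x)"

abbreviation nsq :: "(real^'n \<Rightarrow> real) \<Rightarrow> real" where
  "nsq u \<equiv> integral\<^sup>L torus (\<lambda>x. (u x)\<^sup>2)"

lemma nsq_nonneg [simp]: "0 \<le> nsq u"
  by (intro integral_nonneg_AE) auto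

lemma nsq_add_scale:
  assumes "L2 u" "L2 v"
  shows "nsq (\<lambda>x. u x + t * v x) = nsq u + 2 * t * ip u v + t\<^sup>2 * nsq v"
proof -
  have "nsq (\<lambda>x. u x + t * v x) = integral\<^sup>L torus (\<lambda>x. (u x)\<^sup>2 + 2 * t * (u x * v x) + t\<^sup>2 * (v x)\<^sup>2)"
    by (intro Bochner_Integration.integral_cong) (auto simp: power2_eq_square algebra_simps)
  also have "\<dots> = nsq u + 2 * t * ip u v + t\<^sup>2 * nsq v"
    using assms L2_mult_integrable[OF assms] by (simp add: L2_sq)
  finally show ?thesis .
qed

text \<open>The minimum over t, attained at \<open>- b / c\<close>, is nonnegative; when
  \<open>c = 0\<close> the expression is affine in t and \<open>b\<close> must vanish. It serves the
  L^2 product here and the form \<open>BL\<close> later.\<close>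

lemma quadratic_nonneg_discriminant:
  fixes a b c :: real
  assumes "\<And>t. a + 2 * t * b + t\<^sup>2 * c \<ge> 0" "c \<ge> 0"
  shows "b\<^sup>2 \<le> a * c"
proof (cases "c = 0")
  case True
  have "b = 0"
  proof (rule ccontr)
    assume "b \<noteq> 0"
    \<comment> \<open>This t makes the affine expression equal to -1.\<close>
    then show False using assms(1)[of "-(a+1)/(2*b)"] True by (simp add: field_simps)
  qed
  then show ?thesis using True by simp
next
  case False
  then have c: "c > 0" using assms by simp
  have "a + 2 * (-b/c) * b + (-b/c)\<^sup>2 * c = a - b\<^sup>2/c"
    using c by (simp add: field_simps power2_eq_square)
  with assms(1)[of "-b/c"] have "b\<^sup>2 / c \<le> a" by simp
  then show ?thesis using c by (simp add: field_simps)
qed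

lemma ip_Cauchy_Schwarz:
  assumes "L2 u" "L2 v"
  shows "(ip u v)\<^sup>2 \<le> nsq u * nsq v"
proof (rule quadratic_nonneg_discriminant)
  fix t :: real
  show "0 \<le> nsq u + 2 * t * ip u v + t\<^sup>2 * nsq v"
    using nsq_add_scale[OF assms, of t] nsq_nonneg by metis
qed simp

lemma abs_ip_le:
  assumes "L2 u" "L2 v"
  shows "\<bar>ip u v\<bar> \<le> sqrt (nsq u) * sqrt (nsq v)"
  using ip_Cauchy_Schwarz[OF assms] by (metis real_sqrt_abs real_sqrt_le_mono real_sqrt_mult)

lemma nsq_add_le:
  assumes "L2 u" "L2 v"
  shows "nsq (\<lambda>x. u x + v x) \<le> 2 * nsq u + 2 * nsq v"
proof -
  have "nsq (\<lambda>x. u x + v x) \<le> integral\<^sup>L torus (\<lambda>x. 2 * (u x)\<^sup>2 + 2 * (v x)\<^sup>2)"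
  proof (rule integral_mono_AE)
    show "AE x in torus. (u x + v x)\<^sup>2 \<le> 2 * (u x)\<^sup>2 + 2 * (v x)\<^sup>2"
    proof (intro always_eventually allI)
      fix x show "(u x + v x)\<^sup>2 \<le> 2 * (u x)\<^sup>2 + 2 * (v x)\<^sup>2"
        using zero_le_power2[of "u x - v x"] by (simp add: power2_eq_square algebra_simps)
    qed
  qed (use assms L2_add[OF assms] in \<open>auto simp: L2_sq\<close>)
  also have "\<dots> = 2 * nsq u + 2 * nsq v" using assms by (simp add: L2_sq)
  finally show ?thesis .
qed

lemma nsq_mult_bounded_le:
  assumes "L2 u" "b \<in> borel_measurable torus" "AE x in torus. \<bar>b x\<bar> \<le> B"
  shows "nsq (\<lambda>x. b x * u x) \<le> B\<^sup>2 * nsq u"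
proof -
  have "nsq (\<lambda>x. b x * u x) \<le> integral\<^sup>L torus (\<lambda>x. B\<^sup>2 * (u x)\<^sup>2)"
  proof (rule integral_mono_AE)
    show "AE x in torus. (b x * u x)\<^sup>2 \<le> B\<^sup>2 * (u x)\<^sup>2"
      using assms(3)
    proof eventually_elim
      case (elim x)
      then show ?case using power_mono[of "\<bar>b x\<bar>" B 2]
        by (simp add: power_mult_distrib mult_right_mono)
    qed
  qed (use assms L2_mult_bounded[OF assms] in \<open>auto simp: L2_sq\<close>)
  then show ?thesis by simp
qed

lemma nsq_zero_AE:
  assumes "L2 u" "nsq u = 0"
  shows "AE x in torus. u x = 0"
  using integral_nonneg_eq_0_iff_AE[of torus "\<lambda>x. (u x)\<^sup>2"] assms by (simp add: L2_sq)

subsection \<open>Plane waves\<close>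

lemma Zd_0 [simp]: "0 \<in> Zd" by (simp add: Zd_def)
lemma Zd_add: "k \<in> Zd \<Longrightarrow> l \<in> Zd \<Longrightarrow> k + l \<in> Zd" by (simp add: Zd_def)
lemma Zd_diff: "k \<in> Zd \<Longrightarrow> l \<in> Zd \<Longrightarrow> k - l \<in> Zd" by (simp add: Zd_def)
lemma Zd_minus [simp]: "- k \<in> Zd \<longleftrightarrow> k \<in> Zd" by (simp add: Zd_def)

lemma cis_2pi_int_integral:
  assumes "m \<in> \<int>"
  shows "(LINT t|lborel. indicat_real {0..1} t *\<^sub>R cis (2 * pi * (m * t))) = (if m = 0 then 1 else 0)"
proof (cases "m = 0")
  case False
  define F where "F = (\<lambda>t::real. cis (2 * pi * (m * t)) / (2 * pi * m * \<i>))"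
  have "(LINT t|lborel. indicat_real {0..1} t *\<^sub>R cis (2 * pi * (m * t))) = F 1 - F 0"
  proof (rule integral_FTC_atLeastAtMost)
    fix t :: real
    have "((\<lambda>z. exp (2 * pi * m * \<i> * z) / (2 * pi * m * \<i>)) has_field_derivative
            exp (2 * pi * m * \<i> * complex_of_real t)) (at (complex_of_real t))"
      using False by (auto intro!: derivative_eq_intros)
    from has_vector_derivative_real_field[OF this, of "{0..1}"]
    show "(F has_vector_derivative cis (2 * pi * (m * t))) (at t within {0..1})"
      by (simp add: F_def cis_conv_exp mult_ac)
  qed (auto intro!: continuous_intros)
  also have "F 1 = F 0"
  proof -
    obtain j where "m = of_int j" using assms by (auto elim: Ints_cases)
    then have "cis (2 * pi * m) = 1" by (intro cis_multiple_2pi) auto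
    then show ?thesis by (simp add: F_def)
  qed
  finally show ?thesis using False by simp
qed simp

lemma cis_sum: "cis (sum f A) = (\<Prod>a\<in>A. cis (f a))"
  by (induction A rule: infinite_finite_induct) (auto simp: cis_mult[symmetric])

lemma indicator_Omega_prod:
  fixes f :: "real^'n \<Rightarrow> real"
  shows "indicat_real (Omega :: (real^'n) set) (\<Sum>b\<in>Basis. f b *\<^sub>R b) = (\<Prod>b\<in>Basis. indicat_real {0..1} (f b))"
proof -
  have "(\<Sum>b\<in>Basis. f b *\<^sub>R b) \<in> (Omega :: (real^'n) set) \<longleftrightarrow> (\<forall>b\<in>Basis. f b \<in> {0..1})"
    by (simp add: Omega_def mem_box inner_sum_left_Basis)
  moreover have "(\<Prod>b\<in>(Basis::(real^'n) set). indicat_real {0..1} (f b)) = (if \<forall>b\<in>Basis. f b \<in> {0..1} then 1 else 0)"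
    by (auto simp: indicator_def prod_eq_1_iff)
  ultimately show ?thesis by (simp add: indicator_def)
qed

text \<open>Orthonormality of the plane waves. Lebesgue measure is the image of the product measure
  under the coordinate map, so the integral factors, and a nonzero frequency has a nonzero
  coordinate whose factor vanishes.\<close>

lemma integral_plane_wave:
  fixes k :: "real^'n"
  assumes "k \<in> Zd"
  shows "integral\<^sup>L torus (\<lambda>x. cis (2 * pi * (k \<bullet> x))) = (if k = 0 then 1 else 0)"
proof -
  interpret product_sigma_finite "\<lambda>_::real^'n. lborel :: real measure" by standard
  let ?h = "\<lambda>b t. indicat_real {0..1} t *\<^sub>R cis (2 * pi * ((k \<bullet> b) * t))"
  have int: "integrable lborel (?h b)" for b
    using borel_integrable_atLeastAtMost'[of 0 1 "\<lambda>t. cis (2 * pi * ((k \<bullet> b) * t))"]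
    by (simp add: set_integrable_def continuous_intros)
  have k: "k \<bullet> b \<in> \<int>" if "b \<in> Basis" for b :: "real^'n"
    using that assms by (auto simp: Basis_vec_def inner_axis Zd_def)
  have "integral\<^sup>L torus (\<lambda>x. cis (2 * pi * (k \<bullet> x)))
      = (LINT x|lborel. indicat_real Omega x *\<^sub>R cis (2 * pi * (k \<bullet> x)))"
    by (simp add: set_integral_Omega[symmetric] set_lebesgue_integral_def)
  also have "\<dots> = (LINT f|(\<Pi>\<^sub>M b\<in>(Basis::(real^'n) set). lborel). indicat_real Omega (\<Sum>b\<in>Basis. f b *\<^sub>R b :: real^'n) *\<^sub>R cis (2 * pi * (k \<bullet> (\<Sum>b\<in>Basis. f b *\<^sub>R b))))"
  proof (subst lborel_eq, rule integral_distr)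
    have "(\<lambda>x. cis (2 * pi * (k \<bullet> x))) \<in> borel_measurable borel"
      by (intro borel_measurable_continuous_onI continuous_intros)
    then show "(\<lambda>x. indicat_real Omega x *\<^sub>R cis (2 * pi * (k \<bullet> x))) \<in> borel_measurable borel"
      by measurable
  qed measurable
  also have "\<dots> = (LINT f|(\<Pi>\<^sub>M b\<in>(Basis::(real^'n) set). lborel). (\<Prod>b\<in>Basis. ?h b (f b)))"
  proof (rule Bochner_Integration.integral_cong)
    fix f :: "real^'n \<Rightarrow> real"
    have "2 * pi * (k \<bullet> (\<Sum>b\<in>Basis. f b *\<^sub>R b)) = (\<Sum>b\<in>Basis. 2 * pi * ((k \<bullet> b) * f b))"
      by (simp add: inner_sum_right sum_distrib_left mult_ac)
    then show "indicat_real Omega (\<Sum>b\<in>Basis. f b *\<^sub>R b) *\<^sub>R cis (2 * pi * (k \<bullet> (\<Sum>b\<in>Basis. f b *\<^sub>R b)))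
        = (\<Prod>b\<in>Basis. ?h b (f b))"
      by (simp only: indicator_Omega_prod cis_sum scaleR_conv_of_real[where 'a=complex] prod.distrib of_real_prod)
  qed simp
  also have "\<dots> = (\<Prod>b\<in>Basis. integral\<^sup>L lborel (?h b))"
    by (rule product_integral_prod) (auto intro: int)
  also have "\<dots> = (\<Prod>b\<in>(Basis::(real^'n) set). if k \<bullet> b = 0 then 1 else 0)"
    by (intro prod.cong refl cis_2pi_int_integral k)
  also have "\<dots> = (if k = 0 then 1 else 0)"
  proof (cases "k = 0")
    case False
    then obtain b where "b \<in> Basis" "k \<bullet> b \<noteq> 0" by (metis euclidean_all_zero_iff)
    then show ?thesis using False by (auto intro!: prod_zero)
  qed simp
  finally show ?thesis .
qed

lemma cis_inner_add: "cis (2 * pi * (k \<bullet> x)) * cis (2 * pi * (l \<bullet> x)) = cis (2 * pi * ((k + l) \<bullet> x))"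
  by (simp add: cis_mult algebra_simps)

lemma integrable_mult_plane_wave:
  assumes "integrable torus f" and that: "continuous_on UNIV g"
  shows "integrable torus (\<lambda>x. complex_of_real (f x) * cis (g x))"
proof (rule Bochner_Integration.integrable_bound[OF assms(1)])
  have "(\<lambda>x. cis (g x)) \<in> borel_measurable torus"
    using that by (intro continuous_measurable_torus continuous_intros)
  then show "(\<lambda>x. complex_of_real (f x) * cis (g x)) \<in> borel_measurable torus"
    using assms by measurable
qed (simp add: norm_mult)

subsection \<open>Fourier coefficients\<close>

lemma fcoef_torus: "fcoef u k = integral\<^sup>L torus (\<lambda>x. complex_of_real (u x) * cis (- (2 * pi * (k \<bullet> x))))"
  by (simp add: fcoef_def set_integral_Omega)

lemma fcoef_integrable:
  assumes "integrable torus u"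
  shows "integrable torus (\<lambda>x. complex_of_real (u x) * cis (- (2 * pi * (k \<bullet> x))))"
  by (intro integrable_mult_plane_wave assms continuous_intros)

lemma fcoef_add:
  assumes "integrable torus u" "integrable torus v"
  shows "fcoef (\<lambda>x. u x + v x) k = fcoef u k + fcoef v k"
  using fcoef_integrable[OF assms(1)] fcoef_integrable[OF assms(2)]
  by (simp add: fcoef_torus ring_distribs)

lemma fcoef_cmult: "fcoef (\<lambda>x. c * u x) k = c * fcoef u k"
  by (simp add: fcoef_torus mult.assoc)

lemma fcoef_diff:
  assumes "integrable torus u" "integrable torus v"
  shows "fcoef (\<lambda>x. u x - v x) k = fcoef u k - fcoef v k"
  using fcoef_integrable[OF assms(1)] fcoef_integrable[OF assms(2)]
  by (simp add: fcoef_torus ring_distribs)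

lemma fcoef_minus_freq: "fcoef u (- k) = cnj (fcoef u k)"
  unfolding fcoef_torus
  using Bochner_Integration.integral_cnj[of torus "\<lambda>x. complex_of_real (u x) * cis (- (2 * pi * (k \<bullet> x)))", symmetric]
  by (simp add: cis_cnj)

lemma norm_fcoef_le: "cmod (fcoef u k) \<le> integral\<^sup>L torus (\<lambda>x. \<bar>u x\<bar>)"
  unfolding fcoef_torus by (rule order_trans[OF integral_norm_bound]) (simp add: norm_mult)

lemma fcoef_0: "fcoef u 0 = of_real (integral\<^sup>L torus u)"
  unfolding fcoef_torus by simp

lemma fcoef_const:
  assumes "k \<in> Zd"
  shows "fcoef (\<lambda>x. c) k = (if k = 0 then of_real c else 0)"
  using integral_plane_wave[of "-k"] assms by (simp add: fcoef_torus)

subsection \<open>Trigonometric polynomials\<close>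

text \<open>Cubes of frequencies complement the balls \<open>KN\<close>: a sum of products over a
  cube factors over the coordinates, as the lattice sum and the kernel require.\<close>

definition lattice_box :: "nat \<Rightarrow> (real^'n) set" where
  "lattice_box n = {k \<in> Zd. \<forall>i. \<bar>k $ i\<bar> \<le> real n}"

lemma lattice_box_eq:
  "lattice_box n = (\<lambda>h. \<chi> i. real_of_int (h i)) ` (PiE UNIV (\<lambda>_. {- int n..int n}))"
proof (intro equalityI subsetI)
  fix k :: "real^'n" assume k: "k \<in> lattice_box n"
  then have fl: "real_of_int \<lfloor>k $ i\<rfloor> = k $ i" for i
    by (auto simp: lattice_box_def Zd_def)
  then have "k = (\<chi> i. real_of_int \<lfloor>k $ i\<rfloor>)"
    by (simp only: vec_eq_iff vec_lambda_beta fl simp_thms)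
  moreover have "\<lfloor>k $ i\<rfloor> \<in> {- int n..int n}" for i
  proof -
    have "\<bar>k $ i\<bar> \<le> real n" using k by (simp add: lattice_box_def)
    then have "\<bar>real_of_int \<lfloor>k $ i\<rfloor>\<bar> \<le> real n" by (simp only: fl)
    then show ?thesis by simp linarith
  qed
  ultimately show "k \<in> (\<lambda>h. \<chi> i. real_of_int (h i)) ` (PiE UNIV (\<lambda>_. {- int n..int n}))"
    by (intro image_eqI[where x="\<lambda>i. \<lfloor>k $ i\<rfloor>"]) auto
next
  fix k :: "real^'n" assume "k \<in> (\<lambda>h. \<chi> i. real_of_int (h i)) ` (PiE UNIV (\<lambda>_. {- int n..int n}))"
  then obtain h where h: "k = (\<chi> i. real_of_int (h i))" "\<And>i. h i \<in> {- int n..int n}"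
    by (auto simp: PiE_def Pi_def)
  have "\<bar>real_of_int (h i)\<bar> \<le> real n" for i using h(2)[of i] by simp linarith
  then show "k \<in> lattice_box n" using h by (simp add: lattice_box_def Zd_def)
qed

lemma finite_lattice_box: "finite (lattice_box n)"
  by (simp add: lattice_box_eq finite_PiE)

lemma sum_lattice_box_prod:
  fixes F :: "'n::finite \<Rightarrow> real \<Rightarrow> 'b::comm_semiring_1"
  shows "(\<Sum>k\<in>(lattice_box n :: (real^'n) set). \<Prod>i\<in>UNIV. F i (k $ i))
    = (\<Prod>i\<in>UNIV. \<Sum>m\<in>{- int n..int n}. F i (real_of_int m))"
proof -
  have inj: "inj_on (\<lambda>h::'n \<Rightarrow> int. \<chi> i. real_of_int (h i)) (PiE UNIV (\<lambda>_. {- int n..int n}))"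
    by (rule inj_onI) (auto simp: vec_eq_iff)
  show ?thesis
    unfolding lattice_box_eq by (subst sum.reindex[OF inj]) (simp add: prod_sum_PiE o_def)
qed

lemma KN_subset_lattice_box: "KN N \<subseteq> lattice_box N"
  by (auto simp: KN_def lattice_box_def intro: order_trans[OF component_le_norm_cart])

lemma finite_KN [simp]: "finite (KN N)"
  using KN_subset_lattice_box finite_lattice_box by (rule finite_subset)

lemma KN_subset_Zd: "KN N \<subseteq> Zd" by (auto simp: KN_def)

lemma KN_mono: "N \<le> M \<Longrightarrow> KN N \<subseteq> KN M" by (auto simp: KN_def)

lemma KN_minus [simp]: "- k \<in> KN N \<longleftrightarrow> k \<in> KN N" by (auto simp: KN_def)

lemma KN_0 [simp]: "0 \<in> KN N" by (auto simp: KN_def)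

lemma finite_subset_KN:
  assumes "finite F" "F \<subseteq> Zd"
  obtains N where "F \<subseteq> KN N"
proof -
  obtain B where "\<forall>k\<in>F. norm k \<le> B"
    using finite_imp_bounded[OF assms(1)] by (auto simp: bounded_iff)
  then have "\<exists>N::nat. \<forall>k\<in>F. norm k \<le> real N"
    by (meson order_trans real_arch_simple)
  then show ?thesis using assms that by (auto simp: KN_def)
qed

text \<open>Several indices may carry the same frequency; their coefficients are then added up.
  Products rely on this, since many pairs of frequencies have the same sum.\<close>

lemma XN_I:
  fixes p :: "real^'n \<Rightarrow> real"
  assumes "finite I" "\<And>i. i \<in> I \<Longrightarrow> \<kappa> i \<in> KN N"
    and "\<And>x. complex_of_real (p x) = (\<Sum>i\<in>I. c i * cis (2 * pi * (\<kappa> i \<bullet> x)))"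
  shows "p \<in> XN N"
proof -
  have "complex_of_real (p x) = (\<Sum>k\<in>KN N. (\<Sum>i\<in>{i\<in>I. \<kappa> i = k}. c i) * cis (2 * pi * (k \<bullet> x)))" for x
  proof -
    have "(\<Sum>k\<in>KN N. (\<Sum>i\<in>{i\<in>I. \<kappa> i = k}. c i) * cis (2 * pi * (k \<bullet> x)))
        = (\<Sum>k\<in>KN N. \<Sum>i\<in>{i\<in>I. \<kappa> i = k}. c i * cis (2 * pi * (\<kappa> i \<bullet> x)))"
      by (simp add: sum_distrib_right)
    also have "\<dots> = (\<Sum>i\<in>I. c i * cis (2 * pi * (\<kappa> i \<bullet> x)))"
      using assms(1,2) by (intro sum.group) auto
    finally show ?thesis using assms(3) by simp
  qed
  then show ?thesis unfolding XN_def by (intro CollectI exI allI)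
qed

lemma XN_continuous: "p \<in> XN N \<Longrightarrow> continuous_on A p"
proof -
  assume "p \<in> XN N"
  then obtain c where c: "\<And>x. complex_of_real (p x) = (\<Sum>k\<in>KN N. c k * cis (2 * pi * (k \<bullet> x)))"
    by (auto simp: XN_def)
  then have "p = (\<lambda>x. Re (\<Sum>k\<in>KN N. c k * cis (2 * pi * (k \<bullet> x))))"
    by (metis Re_complex_of_real)
  moreover have "continuous_on A (\<lambda>x. Re (\<Sum>k\<in>KN N. c k * cis (2 * pi * (k \<bullet> x))))"
    by (intro continuous_intros)
  ultimately show ?thesis by simp
qed

lemma XN_L2: "p \<in> XN N \<Longrightarrow> L2 p"
  by (intro L2_continuous XN_continuous)

lemma XN_integrable: "p \<in> XN N \<Longrightarrow> integrable torus p"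
  by (intro integrable_torus_continuous XN_continuous)

text \<open>The coefficients of a product form a convolution, here a finite sum because one factor
  is a trigonometric polynomial.\<close>

lemma fcoef_mult_trig:
  assumes f: "integrable torus f" and p: "\<And>x. complex_of_real (p x) = (\<Sum>j\<in>KN N. c j * cis (2 * pi * (j \<bullet> x)))"
  shows "fcoef (\<lambda>x. f x * p x) k = (\<Sum>j\<in>KN N. c j * fcoef f (k - j))"
proof -
  have "fcoef (\<lambda>x. f x * p x) k = integral\<^sup>L torus (\<lambda>x. \<Sum>j\<in>KN N. c j * (complex_of_real (f x) * cis (- (2 * pi * ((k - j) \<bullet> x)))))"
    unfolding fcoef_torus
  proof (rule Bochner_Integration.integral_cong[OF refl])
    fix x :: "real^'a"
    have *: "cis (2 * pi * (j \<bullet> x)) * cis (- (2 * pi * (k \<bullet> x))) = cis (- (2 * pi * ((k - j) \<bullet> x)))" for j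
      by (simp add: cis_mult algebra_simps)
    show "complex_of_real (f x * p x) * cis (- (2 * pi * (k \<bullet> x)))
        = (\<Sum>j\<in>KN N. c j * (complex_of_real (f x) * cis (- (2 * pi * ((k - j) \<bullet> x)))))"
      unfolding *[symmetric] of_real_mult p by (simp add: sum_distrib_left sum_distrib_right mult_ac)
  qed
  also have "\<dots> = (\<Sum>j\<in>KN N. c j * fcoef f (k - j))"
    by (subst Bochner_Integration.integral_sum) (auto intro!: fcoef_integrable[OF f] simp: fcoef_torus)
  finally show ?thesis .
qed

lemma fcoef_trig:
  assumes p: "\<And>x. complex_of_real (p x) = (\<Sum>j\<in>KN N. c j * cis (2 * pi * (j \<bullet> x)))" and k: "k \<in> Zd"
  shows "fcoef p k = (if k \<in> KN N then c k else 0)"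
proof -
  have "fcoef p k = fcoef (\<lambda>x. 1 * p x) k" by simp
  also have "\<dots> = (\<Sum>j\<in>KN N. c j * fcoef (\<lambda>x. 1) (k - j))"
    by (rule fcoef_mult_trig[OF _ p]) simp
  also have "\<dots> = (\<Sum>j\<in>KN N. if j = k then c k else 0)"
    using k by (intro sum.cong) (auto simp: fcoef_const Zd_diff KN_def)
  also have "\<dots> = (if k \<in> KN N then c k else 0)" by simp
  finally show ?thesis .
qed

lemma XN_expansion:
  assumes "p \<in> XN N"
  shows "complex_of_real (p x) = (\<Sum>j\<in>KN N. fcoef p j * cis (2 * pi * (j \<bullet> x)))"
proof -
  obtain c where c: "\<And>x. complex_of_real (p x) = (\<Sum>k\<in>KN N. c k * cis (2 * pi * (k \<bullet> x)))"
    using assms by (auto simp: XN_def)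
  have "fcoef p j = c j" if "j \<in> KN N" for j
    using fcoef_trig[OF c, of j] that KN_subset_Zd by auto
  then show ?thesis using c by simp
qed

lemma fcoef_XN_outside:
  assumes "p \<in> XN N" "k \<in> Zd" "k \<notin> KN N"
  shows "fcoef p k = 0"
proof -
  obtain c where c: "\<And>x. complex_of_real (p x) = (\<Sum>k\<in>KN N. c k * cis (2 * pi * (k \<bullet> x)))"
    using assms by (auto simp: XN_def)
  show ?thesis using fcoef_trig[OF c assms(2)] assms(3) by simp
qed

lemma XN_eqI:
  assumes "p \<in> XN N" "q \<in> XN N" "\<And>k. k \<in> KN N \<Longrightarrow> fcoef p k = fcoef q k"
  shows "p = q"
proof
  fix x
  have "complex_of_real (p x) = complex_of_real (q x)"
    using XN_expansion[OF assms(1)] XN_expansion[OF assms(2)] assms(3) by simp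
  then show "p x = q x" by simp
qed

lemma fcoef_mult_XN:
  assumes "integrable torus f" "p \<in> XN N"
  shows "fcoef (\<lambda>x. f x * p x) k = (\<Sum>j\<in>KN N. fcoef p j * fcoef f (k - j))"
  by (rule fcoef_mult_trig[OF assms(1) XN_expansion[OF assms(2)]])

lemma XN_mono: "N \<le> M \<Longrightarrow> XN N \<subseteq> XN M"
proof
  fix p :: "real^'n \<Rightarrow> real" assume "N \<le> M" "p \<in> XN N"
  then show "p \<in> XN M"
    using XN_I[of "KN N" "\<lambda>k. k" M p "fcoef p"] KN_mono[of N M] XN_expansion[of p N] by auto
qed

lemma XN_add:
  assumes "p \<in> XN N" "q \<in> XN N" shows "(\<lambda>x. p x + q x) \<in> XN N"
  by (rule XN_I[where I="KN N" and \<kappa>="\<lambda>k. k" and c="\<lambda>k. fcoef p k + fcoef q k"])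
     (auto simp: XN_expansion[OF assms(1)] XN_expansion[OF assms(2)] ring_distribs sum.distrib)

lemma XN_cmult:
  assumes "p \<in> XN N" shows "(\<lambda>x. a * p x) \<in> XN N"
  by (rule XN_I[where I="KN N" and \<kappa>="\<lambda>k. k" and c="\<lambda>k. a * fcoef p k"])
     (auto simp: XN_expansion[OF assms(1)] sum_distrib_left mult_ac)

lemma XN_diff:
  assumes "p \<in> XN N" "q \<in> XN N" shows "(\<lambda>x. p x - q x) \<in> XN N"
  using XN_add[OF assms(1) XN_cmult[OF assms(2), of "-1"]] by simp

lemma XN_const: "(\<lambda>x. a) \<in> XN N"
  by (rule XN_I[where I="{()}" and \<kappa>="\<lambda>k. 0" and c="\<lambda>k. a"]) auto

lemma XN_mult:
  assumes "p \<in> XN N" "q \<in> XN M" shows "(\<lambda>x. p x * q x) \<in> XN (N + M)"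
proof (rule XN_I[where I="KN N \<times> KN M" and \<kappa>="\<lambda>(j,l). j + l" and c="\<lambda>(j,l). fcoef p j * fcoef q l"])
  fix i :: "(real^'a) \<times> (real^'a)" assume "i \<in> KN N \<times> KN M"
  then show "(case i of (j, l) \<Rightarrow> j + l) \<in> KN (N + M)"
    by (auto simp: KN_def Zd_add intro!: order_trans[OF norm_triangle_ineq])
next
  fix x
  show "complex_of_real (p x * q x) = (\<Sum>i\<in>KN N \<times> KN M.
            (case i of (j, l) \<Rightarrow> fcoef p j * fcoef q l) *
            cis (2 * pi * ((case i of (j, l) \<Rightarrow> j + l) \<bullet> x)))"
    unfolding of_real_mult XN_expansion[OF assms(1)] XN_expansion[OF assms(2)] sum_product
    unfolding sum.cartesian_product
    by (intro sum.cong refl) (auto simp: cis_inner_add[symmetric])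
qed auto

text \<open>Taking the real part replaces c by its Hermitian part, whose frequencies remain in
  \<open>KN\<close> because the ball is symmetric.\<close>

lemma XN_Re: "(\<lambda>x. Re (\<Sum>k\<in>KN N. c k * cis (2 * pi * (k \<bullet> x)))) \<in> XN N"
proof (rule XN_I[where I="KN N" and \<kappa>="\<lambda>k. k" and c="\<lambda>k. (c k + cnj (c (- k))) / 2"])
  fix x :: "real^'a"
  have "(\<Sum>k\<in>KN N. cnj (c k * cis (2 * pi * (k \<bullet> x)))) = (\<Sum>k\<in>KN N. cnj (c (-k)) * cis (2 * pi * (k \<bullet> x)))"
    by (rule sum.reindex_bij_witness[where i=uminus and j=uminus]) (auto simp: cis_cnj)
  then have "(\<Sum>k\<in>KN N. c k * cis (2 * pi * (k \<bullet> x))) + cnj (\<Sum>k\<in>KN N. c k * cis (2 * pi * (k \<bullet> x)))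
     = 2 * (\<Sum>k\<in>KN N. (c k + cnj (c (- k))) / 2 * cis (2 * pi * (k \<bullet> x)))"
    by (simp add: sum_distrib_left ring_distribs sum.distrib add_divide_distrib)
  then show "complex_of_real (Re (\<Sum>k\<in>KN N. c k * cis (2 * pi * (k \<bullet> x))))
      = (\<Sum>k\<in>KN N. (c k + cnj (c (- k))) / 2 * cis (2 * pi * (k \<bullet> x)))"
    unfolding complex_add_cnj by simp
qed auto

text \<open>The real part makes every coefficient family admissible; on Hermitian families it
  changes nothing (\<open>trig_expansion\<close>).\<close>

definition trig :: "nat \<Rightarrow> (real^'n \<Rightarrow> complex) \<Rightarrow> real^'n \<Rightarrow> real" where
  "trig N c = (\<lambda>x. Re (\<Sum>k\<in>KN N. c k * cis (2 * pi * (k \<bullet> x))))"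

lemma trig_XN: "trig N c \<in> XN N"
  unfolding trig_def by (rule XN_Re)

lemma trig_expansion:
  assumes "\<And>k. k \<in> KN N \<Longrightarrow> c (- k) = cnj (c k)"
  shows "complex_of_real (trig N c x) = (\<Sum>k\<in>KN N. c k * cis (2 * pi * (k \<bullet> x)))"
proof -
  have "cnj (\<Sum>k\<in>KN N. c k * cis (2 * pi * (k \<bullet> x))) = (\<Sum>k\<in>KN N. c k * cis (2 * pi * (k \<bullet> x)))"
    unfolding cnj_sum
    by (rule sum.reindex_bij_witness[where i=uminus and j=uminus]) (use assms in \<open>auto simp: cis_cnj\<close>)
  then have "(\<Sum>k\<in>KN N. c k * cis (2 * pi * (k \<bullet> x))) \<in> \<real>"
    by (simp only: Reals_cnj_iff)
  then show ?thesis unfolding trig_def by (rule of_real_Re)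
qed

lemma fcoef_trig_poly:
  assumes "\<And>k. k \<in> KN N \<Longrightarrow> c (- k) = cnj (c k)" "k \<in> Zd"
  shows "fcoef (trig N c) k = (if k \<in> KN N then c k else 0)"
  by (rule fcoef_trig[OF trig_expansion]) (use assms in auto)

lemma single_wave_in_XN:
  assumes "k \<in> KN N"
  shows "(\<lambda>x. Re (a * cis (2 * pi * (k \<bullet> x)))) \<in> XN N"
proof -
  have "(\<Sum>j\<in>KN N. (if j = k then a else 0) * cis (2 * pi * (j \<bullet> x))) = a * cis (2 * pi * (k \<bullet> x))" for x
    using assms by (subst sum.mono_neutral_cong_right[where S="{k}"
        and h="\<lambda>j. a * cis (2 * pi * (j \<bullet> x))"]) auto
  then show ?thesis using XN_Re[of "\<lambda>j. if j = k then a else 0" N] by simp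
qed

lemma cos_in_XN: "k \<in> KN N \<Longrightarrow> (\<lambda>x. cos (2 * pi * (k \<bullet> x))) \<in> XN N"
  using single_wave_in_XN[of k N 1] by simp

lemma sin_in_XN: "k \<in> KN N \<Longrightarrow> (\<lambda>x. sin (2 * pi * (k \<bullet> x))) \<in> XN N"
  using single_wave_in_XN[of k N "-\<i>"] by simp

lemma ip_trig:
  assumes "integrable torus f" "p \<in> XN N"
  shows "ip f p = (\<Sum>k\<in>KN N. Re (fcoef f k * cnj (fcoef p k)))"
proof -
  have "complex_of_real (ip f p) = fcoef (\<lambda>x. f x * p x) 0" by (simp add: fcoef_0)
  also have "\<dots> = (\<Sum>j\<in>KN N. fcoef p j * fcoef f (0 - j))"
    by (rule fcoef_mult_XN[OF assms])
  finally have "Re (complex_of_real (ip f p)) = Re (\<Sum>j\<in>KN N. fcoef p j * cnj (fcoef f j))"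
    by (simp only: diff_0 fcoef_minus_freq)
  then have "ip f p = (\<Sum>j\<in>KN N. Re (fcoef p j * cnj (fcoef f j)))"
    by (simp only: Re_complex_of_real Re_sum)
  also have "\<dots> = (\<Sum>k\<in>KN N. Re (fcoef f k * cnj (fcoef p k)))"
    by (intro sum.cong refl) simp
  finally show ?thesis .
qed

lemma Re_mult_cnj_self: "Re (z * cnj z) = (cmod z)\<^sup>2"
  by (metis Re_complex_of_real complex_norm_square)

lemma nsq_trig:
  assumes "p \<in> XN N" shows "nsq p = (\<Sum>k\<in>KN N. (cmod (fcoef p k))\<^sup>2)"
  using ip_trig[OF XN_integrable[OF assms] assms] by (simp only: Re_mult_cnj_self power2_eq_square[of "p _"])

abbreviation proj :: "nat \<Rightarrow> (real^'n \<Rightarrow> real) \<Rightarrow> real^'n \<Rightarrow> real" where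
  "proj N f \<equiv> trig N (fcoef f)"

lemma fcoef_proj: "k \<in> Zd \<Longrightarrow> fcoef (proj N f) k = (if k \<in> KN N then fcoef f k else 0)"
  by (rule fcoef_trig_poly) (auto simp: fcoef_minus_freq)

text \<open>Pythagoras in X_N: the last sum is the excess over the best approximation. Taken at the
  Fourier projection it gives Bessel's inequality; taken at any good approximant it gives the
  converse half of Parseval's identity.\<close>

lemma nsq_diff_trig:
  assumes f: "L2 f" and p: "p \<in> XN N"
  shows "nsq (\<lambda>x. f x - p x) = nsq f - (\<Sum>k\<in>KN N. (cmod (fcoef f k))\<^sup>2) + (\<Sum>k\<in>KN N. (cmod (fcoef f k - fcoef p k))\<^sup>2)"
proof -
  have "nsq (\<lambda>x. f x - p x) = nsq f - 2 * ip f p + nsq p"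
    using nsq_add_scale[OF f XN_L2[OF p], of "-1"] by simp
  also have "\<dots> = nsq f + (\<Sum>k\<in>KN N. (cmod (fcoef p k))\<^sup>2 - 2 * Re (fcoef f k * cnj (fcoef p k)))"
    using ip_trig[OF L2_integrable[OF f] p] nsq_trig[OF p] by (simp add: sum_subtractf sum_distrib_left)
  also have "(\<Sum>k\<in>KN N. (cmod (fcoef p k))\<^sup>2 - 2 * Re (fcoef f k * cnj (fcoef p k)))
     = (\<Sum>k\<in>KN N. (cmod (fcoef f k - fcoef p k))\<^sup>2 - (cmod (fcoef f k))\<^sup>2)"
    by (intro sum.cong refl) (simp only: cmod_power2, simp add: power2_eq_square algebra_simps)
  finally show ?thesis by (simp add: sum_subtractf)
qed

lemma nsq_diff_proj:
  assumes "L2 f"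
  shows "nsq (\<lambda>x. f x - proj N f x) = nsq f - (\<Sum>k\<in>KN N. (cmod (fcoef f k))\<^sup>2)"
proof -
  have "(\<Sum>k\<in>KN N. (cmod (fcoef f k - fcoef (proj N f) k))\<^sup>2) = 0"
    by (intro sum.neutral ballI) (auto simp: fcoef_proj KN_def)
  then show ?thesis using nsq_diff_trig[OF assms trig_XN[of N "fcoef f"]] by simp
qed

section \<open>The L^2 closure of the trigonometric polynomials\<close>

definition trig_poly :: "(real^'n \<Rightarrow> real) \<Rightarrow> bool" where
  "trig_poly p \<longleftrightarrow> (\<exists>N. p \<in> XN N)"

lemma trig_poly_const: "trig_poly (\<lambda>x. a)"
  using XN_const by (auto simp: trig_poly_def)

lemma trig_poly_cmult: "trig_poly p \<Longrightarrow> trig_poly (\<lambda>x. a * p x)"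
  using XN_cmult by (auto simp: trig_poly_def)

lemma trig_poly_add: 
  assumes "trig_poly p" "trig_poly q" shows "trig_poly (\<lambda>x. p x + q x)"
proof -
  obtain N M where "p \<in> XN N" "q \<in> XN M" using assms by (auto simp: trig_poly_def)
  then have "p \<in> XN (max N M)" "q \<in> XN (max N M)"
    using XN_mono[of N "max N M"] XN_mono[of M "max N M"] by auto
  then show ?thesis using XN_add by (auto simp: trig_poly_def)
qed

lemma trig_poly_diff: "trig_poly p \<Longrightarrow> trig_poly q \<Longrightarrow> trig_poly (\<lambda>x. p x - q x)"
  using trig_poly_add[of p "\<lambda>x. -1 * q x"] trig_poly_cmult[of q "-1"] by simp

lemma trig_poly_mult: "trig_poly p \<Longrightarrow> trig_poly q \<Longrightarrow> trig_poly (\<lambda>x. p x * q x)"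
  unfolding trig_poly_def using XN_mult by blast

lemma trig_poly_power: "trig_poly p \<Longrightarrow> trig_poly (\<lambda>x. p x ^ n)"
  by (induction n) (auto intro: trig_poly_mult trig_poly_const)

lemma trig_poly_continuous: "trig_poly p \<Longrightarrow> continuous_on A p"
  using XN_continuous by (auto simp: trig_poly_def)

lemma trig_poly_L2: "trig_poly p \<Longrightarrow> L2 p"
  using XN_L2 by (auto simp: trig_poly_def)

lemma trig_poly_bounded:
  assumes "trig_poly p" obtains B where "\<And>x. x \<in> Omega \<Longrightarrow> \<bar>p x\<bar> \<le> B"
proof -
  have "compact (p ` Omega)"
    unfolding Omega_def by (intro compact_continuous_image trig_poly_continuous assms) auto
  then show ?thesis
    using that compact_imp_bounded[of "p ` Omega"] unfolding bounded_iff by auto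
qed

definition trig_approx :: "(real^'n \<Rightarrow> real) \<Rightarrow> bool" where
  "trig_approx f \<longleftrightarrow> L2 f \<and> (\<forall>\<epsilon>>0. \<exists>p. trig_poly p \<and> nsq (\<lambda>x. f x - p x) < \<epsilon>)"

lemma trig_approx_L2: "trig_approx f \<Longrightarrow> L2 f" by (simp add: trig_approx_def)

lemma trig_approx_trig_poly: "trig_poly p \<Longrightarrow> trig_approx p"
  by (auto simp: trig_approx_def trig_poly_L2 intro!: exI[of _ p])

lemma trig_approx_limit:
  assumes "L2 f" "\<And>n::nat. trig_approx (g n)" "(\<lambda>n. nsq (\<lambda>x. f x - g n x)) \<longlonglongrightarrow> 0"
  shows "trig_approx f"
  unfolding trig_approx_def
proof (intro conjI allI impI assms(1))
  fix \<epsilon> :: real assume "\<epsilon> > 0"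
  then have "\<forall>\<^sub>F n in sequentially. nsq (\<lambda>x. f x - g n x) < \<epsilon> / 4"
    using order_tendstoD(2)[OF assms(3), of "\<epsilon>/4"] by simp
  then obtain n where n: "nsq (\<lambda>x. f x - g n x) < \<epsilon> / 4"
    by (auto simp: eventually_sequentially)
  obtain p where p: "trig_poly p" "nsq (\<lambda>x. g n x - p x) < \<epsilon> / 4"
    using assms(2)[of n] \<open>\<epsilon> > 0\<close> unfolding trig_approx_def
    by (meson divide_pos_pos zero_less_numeral)
  have "nsq (\<lambda>x. (f x - g n x) + (g n x - p x)) \<le> 2 * nsq (\<lambda>x. f x - g n x) + 2 * nsq (\<lambda>x. g n x - p x)"
    by (intro nsq_add_le L2_diff assms trig_poly_L2 p trig_approx_L2)
  then show "\<exists>p. trig_poly p \<and> nsq (\<lambda>x. f x - p x) < \<epsilon>"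
    using n p by (intro exI[of _ p]) auto
qed

lemma trig_approx_add:
  assumes "trig_approx f" "trig_approx g"
  shows "trig_approx (\<lambda>x. f x + g x)"
  unfolding trig_approx_def
proof (intro conjI allI impI)
  show "L2 (\<lambda>x. f x + g x)" using assms by (intro L2_add trig_approx_L2)
  fix \<epsilon> :: real assume "\<epsilon> > 0"
  then have "\<epsilon> / 4 > 0" by simp
  then obtain p q where p: "trig_poly p" "nsq (\<lambda>x. f x - p x) < \<epsilon> / 4" "trig_poly q" "nsq (\<lambda>x. g x - q x) < \<epsilon> / 4"
    using assms unfolding trig_approx_def by meson
  have "nsq (\<lambda>x. (f x - p x) + (g x - q x)) \<le> 2 * nsq (\<lambda>x. f x - p x) + 2 * nsq (\<lambda>x. g x - q x)"
    by (intro nsq_add_le L2_diff assms trig_poly_L2 p trig_approx_L2)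
  also have "(\<lambda>x. (f x - p x) + (g x - q x)) = (\<lambda>x. (f x + g x) - (p x + q x))" by auto
  finally have "nsq (\<lambda>x. (f x + g x) - (p x + q x)) < \<epsilon>" using p by linarith
  then show "\<exists>p. trig_poly p \<and> nsq (\<lambda>x. f x + g x - p x) < \<epsilon>"
    using trig_poly_add[OF p(1,3)] by blast
qed

lemma trig_approx_mult_trig_poly:
  assumes g: "trig_approx g" and p: "trig_poly p"
  shows "trig_approx (\<lambda>x. p x * g x)"
  unfolding trig_approx_def
proof (intro conjI allI impI)
  obtain B where B: "\<And>x. x \<in> Omega \<Longrightarrow> \<bar>p x\<bar> \<le> B" using trig_poly_bounded[OF p] by blast
  then have B': "AE x in torus. \<bar>p x\<bar> \<le> B" by auto
  have pm: "p \<in> borel_measurable torus" using p trig_poly_L2 L2_meas by blast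
  show "L2 (\<lambda>x. p x * g x)"
    by (rule L2_mult_bounded[OF trig_approx_L2[OF g] pm B'])
  fix \<epsilon> :: real assume "\<epsilon> > 0"
  have B1: "B\<^sup>2 + 1 > 0" by (simp add: add_nonneg_pos)
  then have "\<epsilon> / (B\<^sup>2 + 1) > 0" using \<open>\<epsilon> > 0\<close> by simp
  then obtain q where q: "trig_poly q" "nsq (\<lambda>x. g x - q x) < \<epsilon> / (B\<^sup>2 + 1)"
    using g unfolding trig_approx_def by meson
  have "nsq (\<lambda>x. p x * (g x - q x)) \<le> B\<^sup>2 * nsq (\<lambda>x. g x - q x)"
    by (intro nsq_mult_bounded_le L2_diff trig_approx_L2 g trig_poly_L2 q pm B')
  also have "\<dots> \<le> (B\<^sup>2 + 1) * nsq (\<lambda>x. g x - q x)" by (intro mult_right_mono) auto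
  also have "\<dots> < \<epsilon>" using q(2) B1 by (simp add: field_simps)
  finally have "nsq (\<lambda>x. p x * g x - p x * q x) < \<epsilon>" by (simp add: right_diff_distrib)
  then show "\<exists>r. trig_poly r \<and> nsq (\<lambda>x. p x * g x - r x) < \<epsilon>"
    using trig_poly_mult[OF p q(1)] by blast
qed

lemma trig_approx_cmult: "trig_approx g \<Longrightarrow> trig_approx (\<lambda>x. c * g x)"
  by (rule trig_approx_mult_trig_poly[OF _ trig_poly_const])

lemma trig_approx_diff: "trig_approx f \<Longrightarrow> trig_approx g \<Longrightarrow> trig_approx (\<lambda>x. f x - g x)"
  using trig_approx_add[of f "\<lambda>x. -1 * g x"] trig_approx_cmult[of g "-1"] by simp

lemma trig_approx_sum: "(\<And>i. i \<in> I \<Longrightarrow> trig_approx (f i)) \<Longrightarrow> trig_approx (\<lambda>x. \<Sum>i\<in>I. f i x)"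
  by (induction I rule: infinite_finite_induct)
     (auto intro: trig_approx_add trig_approx_trig_poly trig_poly_const)

text \<open>The limit passage on which the density argument rests: from half-spaces to Borel sets
  and from simple functions to all of L^2.\<close>

lemma trig_approx_dominated:
  assumes g: "\<And>n::nat. trig_approx (g n)" and h: "L2 h"
    and lim: "AE x in torus. (\<lambda>n. g n x) \<longlonglongrightarrow> f x"
    and bd: "\<And>n. AE x in torus. \<bar>g n x\<bar> \<le> h x" and f [measurable]: "f \<in> borel_measurable torus"
  shows "trig_approx f"
proof (rule trig_approx_limit)
  have gm [measurable]: "g n \<in> borel_measurable torus" for n using g trig_approx_L2 L2_meas by blast
  have fh: "AE x in torus. \<bar>f x\<bar> \<le> h x"
  proof -
    have "AE x in torus. \<forall>n. \<bar>g n x\<bar> \<le> h x" using bd by (simp add: AE_all_countable)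
    with lim show ?thesis
    proof eventually_elim
      case (elim x)
      then have "(\<lambda>n. \<bar>g n x\<bar>) \<longlonglongrightarrow> \<bar>f x\<bar>" by (intro tendsto_intros)
      then show ?case by (rule LIMSEQ_le_const2) (use elim in auto)
    qed
  qed
  show L2f: "L2 f" unfolding L2_alt
  proof
    show "integrable torus (\<lambda>x. (f x)\<^sup>2)"
    proof (rule Bochner_Integration.integrable_bound[OF L2_sq[OF h]])
      show "AE x in torus. norm ((f x)\<^sup>2) \<le> norm ((h x)\<^sup>2)"
        using fh by eventually_elim (auto simp: abs_le_square_iff[symmetric])
    qed measurable
  qed measurable
  have hm [measurable]: "h \<in> borel_measurable torus" using h L2_meas by blast
  have "(\<lambda>n. integral\<^sup>L torus (\<lambda>x. (f x - g n x)\<^sup>2)) \<longlonglongrightarrow> integral\<^sup>L torus (\<lambda>x::real^'a. 0)"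
  proof (rule integral_dominated_convergence[where w="\<lambda>x. 4 * (h x)\<^sup>2"])
    show "integrable torus (\<lambda>x. 4 * (h x)\<^sup>2)" using L2_sq[OF h] by simp
    show "AE x in torus. (\<lambda>n. (f x - g n x)\<^sup>2) \<longlonglongrightarrow> 0"
      using lim
    proof eventually_elim
      case (elim x)
      then have "(\<lambda>n. (f x - g n x)\<^sup>2) \<longlonglongrightarrow> (f x - f x)\<^sup>2" by (intro tendsto_intros)
      then show ?case by simp
    qed
    fix n
    show "AE x in torus. norm ((f x - g n x)\<^sup>2) \<le> 4 * (h x)\<^sup>2"
      using fh bd[of n]
    proof eventually_elim
      case (elim x)
      then have "\<bar>f x - g n x\<bar> \<le> 2 * h x" by linarith
      then have "\<bar>f x - g n x\<bar>\<^sup>2 \<le> (2 * h x)\<^sup>2" by (intro power_mono) auto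
      then show ?case by (simp add: power_mult_distrib)
    qed
  qed measurable
  then show "(\<lambda>n. nsq (\<lambda>x. f x - g n x)) \<longlonglongrightarrow> 0" by simp
qed (rule g)

subsection \<open>Density of trigonometric polynomials\<close>

text \<open>These polynomials in y converge to a step at y = 1/M: Bernoulli's inequality gives the
  bound (M y)^n below the threshold, and 1 - s <= exp(-s) controls the power above it. They are the
  ones of the elementary proof of the Stone-Weierstrass theorem; composed with a trigonometric
  polynomial they remain trigonometric polynomials.\<close>

lemma step_poly_tendsto:
  fixes y :: real and M :: nat
  assumes y: "0 \<le> y" "y \<le> 1"
  shows "M * y < 1 \<Longrightarrow> (\<lambda>n. 1 - (1 - y ^ n) ^ (M ^ n)) \<longlonglongrightarrow> 0"
    and "M * y > 1 \<Longrightarrow> (\<lambda>n. 1 - (1 - y ^ n) ^ (M ^ n)) \<longlonglongrightarrow> 1"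
proof -
  have yn: "y ^ n \<le> 1" "y ^ n \<ge> 0" for n using y by (auto simp: power_le_one)
  have eq: "real (M ^ n) * y ^ n = (M * y) ^ n" for n by (simp add: power_mult_distrib)
  {
    assume less: "M * y < 1"
    have lim: "(\<lambda>n. (M * y) ^ n) \<longlonglongrightarrow> 0" using less y by (intro LIMSEQ_realpow_zero) auto
    show "(\<lambda>n. 1 - (1 - y ^ n) ^ (M ^ n)) \<longlonglongrightarrow> 0"
    proof (rule tendsto_sandwich[OF _ _ tendsto_const lim])
      show "\<forall>\<^sub>F n in sequentially. 1 - (1 - y ^ n) ^ (M ^ n) \<le> (M * y) ^ n"
      proof (intro always_eventually allI)
        fix n
        have "1 + real (M ^ n) * (- (y ^ n)) \<le> (1 + (- (y ^ n))) ^ (M ^ n)"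
          using yn[of n] by (intro Bernoulli_inequality) auto
        then show "1 - (1 - y ^ n) ^ (M ^ n) \<le> (M * y) ^ n" using eq[of n] by simp
      qed
      show "\<forall>\<^sub>F n in sequentially. 0 \<le> 1 - (1 - y ^ n) ^ (M ^ n)"
        using yn by (intro always_eventually allI) (auto simp: power_le_one)
    qed
  }
  {
    assume gr: "M * y > 1"
    have "filterlim (\<lambda>n. (M * y) ^ n) at_top sequentially"
      using gr by (intro filterlim_at_infinity_imp_filterlim_at_top filterlim_realpow_sequentially_gt1 always_eventually)
        (auto intro: zero_less_power)
    then have lim: "(\<lambda>n. exp (- ((M * y) ^ n))) \<longlonglongrightarrow> 0"
      by (intro filterlim_compose[OF exp_at_bot]) (simp add: filterlim_uminus_at_bot)
    have "(\<lambda>n. (1 - y ^ n) ^ (M ^ n)) \<longlonglongrightarrow> 0"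
    proof (rule tendsto_sandwich[OF _ _ tendsto_const lim])
      show "\<forall>\<^sub>F n in sequentially. (1 - y ^ n) ^ (M ^ n) \<le> exp (- ((M * y) ^ n))"
      proof (intro always_eventually allI)
        fix n
        have "(1 - y ^ n) ^ (M ^ n) \<le> exp (- (y ^ n)) ^ (M ^ n)"
          using yn[of n] exp_ge_add_one_self[of "- (y ^ n)"] by (intro power_mono) auto
        also have "\<dots> = exp (- ((M * y) ^ n))"
          by (subst eq[symmetric], subst exp_of_nat_mult[symmetric]) simp
        finally show "(1 - y ^ n) ^ (M ^ n) \<le> exp (- ((M * y) ^ n))" .
      qed
      show "\<forall>\<^sub>F n in sequentially. 0 \<le> (1 - y ^ n) ^ (M ^ n)"
        using yn by (intro always_eventually allI) auto
    qed
    from tendsto_diff[OF tendsto_const[of 1] this]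
    show "(\<lambda>n. 1 - (1 - y ^ n) ^ (M ^ n)) \<longlonglongrightarrow> 1" by simp
  }
qed

lemma AE_torus_component_neq: "AE x in (torus :: (real^'n) measure). x $ i \<noteq> a"
proof -
  have "{x::real^'n. x $ i = a} \<in> null_sets lebesgue"
    using negligible_standard_hyperplane[of "axis i 1 :: real^'n" a]
    by (simp add: negligible_iff_null_sets inner_axis axis_in_Basis_iff Basis_real_def)
  then have "{x::real^'n. x $ i = a} \<in> null_sets lborel"
    by (subst (asm) null_sets_completion_iff) (auto intro!: borel_closed closed_Collect_eq continuous_intros)
  then have "AE x in lborel. x \<notin> {x::real^'n. x $ i = a}" by (rule AE_not_in)
  then show ?thesis unfolding AE_torus by auto
qed

lemma Omega_component: "x \<in> Omega \<longleftrightarrow> (\<forall>i. 0 \<le> x $ i \<and> x $ i \<le> 1)"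
proof -
  have "(One :: real^'a) $ i = 1" for i
    by (simp add: cart_eq_inner_axis inner_sum_left inner_Basis axis_in_Basis_iff)
  then show ?thesis by (auto simp: Omega_def mem_box_cart)
qed

text \<open>On the circle the arc (0, a) is a superlevel set of the cosine centred at its midpoint,
  with level cos(pi a). A half-space of the cell thereby becomes a threshold condition on a
  trigonometric polynomial.\<close>

lemma cos_less_cos_arc:
  assumes "0 < a" "a < 1" "0 < t" "t < 1"
  shows "t < a \<Longrightarrow> cos (2 * pi * (t - a / 2)) > cos (pi * a)"
    and "t > a \<Longrightarrow> cos (2 * pi * (t - a / 2)) < cos (pi * a)"
proof -
  assume "t < a"
  then have "\<bar>t - a/2\<bar> < a/2" using assms by linarith
  then have "(2 * pi) * \<bar>t - a/2\<bar> < (2 * pi) * (a/2)" by (intro mult_strict_left_mono) auto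
  then have "2 * pi * \<bar>t - a/2\<bar> < pi * a" by simp
  moreover have "pi * a \<le> pi" using assms by (simp add: mult_le_cancel_left1)
  ultimately have "cos (pi * a) < cos (2 * pi * \<bar>t - a/2\<bar>)"
    by (intro cos_monotone_0_pi) auto
  moreover have "2 * pi * \<bar>t - a/2\<bar> = \<bar>2 * pi * (t - a / 2)\<bar>" by (simp add: abs_mult)
  ultimately show "cos (2 * pi * (t - a / 2)) > cos (pi * a)" by (simp only: cos_abs_real)
next
  assume "t > a"
  define s where "s = 2 * pi * (t - a / 2)"
  have "pi * (2 * a) < pi * (2 * t)" "pi * (2 * t) < pi * 2"
    using \<open>t > a\<close> assms by (intro mult_strict_left_mono; simp)+
  then have s: "pi * a < s" "s < 2 * pi - pi * a"
    by (auto simp: s_def algebra_simps)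
  have "pi * a \<ge> 0" using assms by simp
  show "cos (2 * pi * (t - a / 2)) < cos (pi * a)"
  proof (cases "s \<le> pi")
    case True
    then show ?thesis unfolding s_def[symmetric] using s \<open>pi * a \<ge> 0\<close> by (intro cos_monotone_0_pi) auto
  next
    case False
    have "cos (2 * pi - s) < cos (pi * a)" using s False \<open>pi * a \<ge> 0\<close> by (intro cos_monotone_0_pi) auto
    then show ?thesis unfolding s_def[symmetric] by (simp add: cos_diff)
  qed
qed

text \<open>Phrased as a multiplication property rather than as approximability of the indicator, so
  that intersections result from multiplying twice.\<close>

definition multiplier_set :: "(real^'n) set \<Rightarrow> bool" where
  "multiplier_set A \<longleftrightarrow> A \<in> sets borel \<and> (\<forall>g. trig_approx g \<longrightarrow> trig_approx (\<lambda>x. indicat_real A x * g x))"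

lemma trig_approx_cong_AE:
  assumes "trig_approx f" "AE x in torus. f x = g x" "g \<in> borel_measurable torus"
  shows "trig_approx g"
  by (rule trig_approx_dominated[where g="\<lambda>_. f" and h="\<lambda>x. \<bar>f x\<bar>"])
     (use assms trig_approx_L2 in \<open>auto intro: L2_abs elim: eventually_mono\<close>)

lemma indicator_mult_measurable:
  assumes "A \<in> sets borel" "trig_approx g"
  shows "(\<lambda>x. indicat_real A x * g x) \<in> borel_measurable torus"
proof -
  have [measurable]: "g \<in> borel_measurable torus" using assms trig_approx_L2 L2_meas by blast
  have [measurable]: "indicat_real A \<in> borel_measurable torus"
    using assms by (intro measurable_torus borel_measurable_indicator)
  show ?thesis by measurable
qed

lemma sets_component_less: "{x::real^'n. x $ i < a} \<in> sets borel"
  by (intro borel_open open_Collect_less continuous_intros)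

lemma multiplier_halfspace_inner:
  assumes a: "0 < a" "a < 1"
  shows "multiplier_set {x::real^'n. x $ i < a}"
  unfolding multiplier_set_def
proof (intro conjI allI impI sets_component_less)
  fix g :: "real^'n \<Rightarrow> real" assume g: "trig_approx g"
  define q where "q = (\<lambda>x::real^'n. (1 + cos (2 * pi * (x $ i - a / 2))) / 2)"
  have "trig_poly (\<lambda>x::real^'n. Re (cis (- (pi * a)) * cis (2 * pi * (axis i 1 \<bullet> x))))"
    unfolding trig_poly_def by (intro exI[of _ 1] single_wave_in_XN) (simp add: KN_def Zd_def norm_axis_1, simp add: axis_def)
  also have "(\<lambda>x::real^'n. Re (cis (- (pi * a)) * cis (2 * pi * (axis i 1 \<bullet> x)))) = (\<lambda>x. cos (2 * pi * (x $ i - a / 2)))"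
    by (rule ext) (simp add: cis_mult inner_axis' algebra_simps)
  finally have q: "trig_poly q" unfolding q_def
    using trig_poly_cmult[OF trig_poly_add[OF trig_poly_const[of 1]], of _ "1/2"] by (simp add: field_simps)
  have qb: "0 \<le> q x" "q x \<le> 1" for x
  proof -
    have *: "-1 \<le> c \<Longrightarrow> 0 \<le> (1 + c) / 2" "c \<le> 1 \<Longrightarrow> (1 + c) / 2 \<le> 1" for c :: real
      by auto
    show "0 \<le> q x" unfolding q_def by (rule *(1)[OF cos_ge_minus_one])
    show "q x \<le> 1" unfolding q_def by (rule *(2)[OF cos_le_one])
  qed
  define \<theta> where "\<theta> = (1 + cos (pi * a)) / 2"
  have "cos pi < cos (pi * a)" using a by (intro cos_monotone_0_pi) (auto simp: mult_less_cancel_left1)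
  then have \<theta>: "\<theta> > 0" by (simp add: \<theta>_def)
  define M where "M = nat \<lceil>1 / \<theta>\<rceil>"
  have M: "real M \<ge> 1 / \<theta>" unfolding M_def by (rule real_nat_ceiling_ge)
  then have M\<theta>: "real M * \<theta> \<ge> 1" using \<theta> by (simp add: field_simps)
  \<comment> \<open>Rescaled so that the level \<theta> of q becomes the threshold 1/M of the step
    polynomials; M \<theta> >= 1 keeps y at most 1.\<close>
  define y where "y = (\<lambda>x. q x * (1 / (M * \<theta>)))"
  have y: "0 \<le> y x" "y x \<le> 1" for x
    unfolding y_def using qb[of x] M\<theta> by (auto intro!: mult_le_one simp: field_simps)
  have "real M > 0" using M \<theta> by (meson less_le_trans zero_less_divide_1_iff)
  then have My: "M * y x = q x / \<theta>" for x by (auto simp: y_def)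
  define P where "P = (\<lambda>n x. 1 - (1 - y x ^ n) ^ (M ^ n))"
  have Pt: "trig_poly (P n)" for n unfolding P_def y_def
    by (intro trig_poly_diff trig_poly_power trig_poly_const trig_poly_mult q)
  have Pb: "\<bar>P n x\<bar> \<le> 1" for n x
  proof -
    have "0 \<le> 1 - y x ^ n" "1 - y x ^ n \<le> 1" using y[of x] by (auto simp: power_le_one)
    then have "0 \<le> (1 - y x ^ n) ^ (M ^ n)" "(1 - y x ^ n) ^ (M ^ n) \<le> 1" by (auto intro: power_le_one)
    then show ?thesis unfolding P_def by linarith
  qed
  show "trig_approx (\<lambda>x. indicat_real {x. x $ i < a} x * g x)"
  proof (rule trig_approx_dominated[where g="\<lambda>n x. P n x * g x" and h="\<lambda>x. \<bar>g x\<bar>"])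
    show "AE x in torus. (\<lambda>n. P n x * g x) \<longlonglongrightarrow> indicat_real {x. x $ i < a} x * g x"
      using AE_torus_component_neq[of i 0] AE_torus_component_neq[of i 1] AE_torus_component_neq[of i a] AE_space
    proof eventually_elim
      case (elim x)
      then have t: "0 < x $ i" "x $ i < 1" by (auto simp: Omega_component less_le)
      have "(\<lambda>n. P n x) \<longlonglongrightarrow> indicat_real {x. x $ i < a} x"
      proof (cases "x $ i < a")
        case True
        then have "q x > \<theta>" using cos_less_cos_arc(1)[OF a t] by (simp add: q_def \<theta>_def)
        then have "M * y x > 1" using \<theta> My by simp
        then show ?thesis using step_poly_tendsto(2)[OF y] True by (simp add: P_def)
      next
        case False
        then have "q x < \<theta>" using cos_less_cos_arc(2)[OF a t] elim by (simp add: q_def \<theta>_def)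
        then have "M * y x < 1" using \<theta> My by simp
        then show ?thesis using step_poly_tendsto(1)[OF y] False by (simp add: P_def)
      qed
      then show ?case by (intro tendsto_intros)
    qed
    show "AE x in torus. \<bar>P n x * g x\<bar> \<le> \<bar>g x\<bar>" for n
      using Pb[of n] by (auto simp: abs_mult intro!: mult_left_le_one_le)
    show "L2 (\<lambda>x. \<bar>g x\<bar>)" using g by (intro L2_abs trig_approx_L2)
    show "(\<lambda>x. indicat_real {x. x $ i < a} x * g x) \<in> borel_measurable torus"
      by (intro indicator_mult_measurable sets_component_less g)
  qed (intro trig_approx_mult_trig_poly g Pt)
qed

lemma multiplier_halfspace: "multiplier_set {x::real^'n. x $ i < a}"
proof -
  consider "a \<le> 0" | "0 < a \<and> a < 1" | "a \<ge> 1" by linarith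
  then show ?thesis
  proof cases
    case 1
    show ?thesis unfolding multiplier_set_def
    proof (intro conjI allI impI sets_component_less)
      fix g :: "real^'n \<Rightarrow> real" assume g: "trig_approx g"
      have "AE x in torus. 0 = indicat_real {x. x $ i < a} x * g x"
        using AE_space
      proof eventually_elim
        case (elim x)
        then have "0 \<le> x $ i" by (simp add: Omega_component)
        then have "\<not> x $ i < a" using 1 by linarith
        then show ?case by simp
      qed
      then show "trig_approx (\<lambda>x. indicat_real {x. x $ i < a} x * g x)"
        by (intro trig_approx_cong_AE[OF trig_approx_trig_poly[OF trig_poly_const[of 0]]]
            indicator_mult_measurable sets_component_less g)
    qed
  next
    case 2 then show ?thesis using multiplier_halfspace_inner by blast
  next
    case 3
    show ?thesis unfolding multiplier_set_def
    proof (intro conjI allI impI sets_component_less)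
      fix g :: "real^'n \<Rightarrow> real" assume g: "trig_approx g"
      have "AE x in torus. g x = indicat_real {x. x $ i < a} x * g x"
        using AE_torus_component_neq[of i 1] AE_space
      proof eventually_elim
        case (elim x)
        then have "x $ i \<le> 1" by (simp add: Omega_component)
        then have "x $ i < a" using 3 elim by linarith
        then show ?case by simp
      qed
      then show "trig_approx (\<lambda>x. indicat_real {x. x $ i < a} x * g x)"
        by (intro trig_approx_cong_AE[OF g] indicator_mult_measurable sets_component_less g)
    qed
  qed
qed

lemma multiplier_compl:
  assumes "multiplier_set A" shows "multiplier_set (UNIV - A)"
  unfolding multiplier_set_def
proof (intro conjI allI impI)
  show "UNIV - A \<in> sets borel" using assms by (auto simp: multiplier_set_def)
  fix g :: "real^'a \<Rightarrow> real" assume g: "trig_approx g"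
  have "trig_approx (\<lambda>x. g x - indicat_real A x * g x)"
    using assms g by (intro trig_approx_diff) (auto simp: multiplier_set_def)
  also have "(\<lambda>x. g x - indicat_real A x * g x) = (\<lambda>x. indicat_real (UNIV - A) x * g x)"
    by (auto simp: indicator_def)
  finally show "trig_approx (\<lambda>x. indicat_real (UNIV - A) x * g x)" .
qed

lemma multiplier_Int:
  assumes "multiplier_set A" "multiplier_set B" shows "multiplier_set (A \<inter> B)"
  using assms by (auto simp: multiplier_set_def indicator_inter_arith mult.assoc)

lemma multiplier_Un:
  assumes "multiplier_set A" "multiplier_set B" shows "multiplier_set (A \<union> B)"
proof -
  have "multiplier_set (UNIV - ((UNIV - A) \<inter> (UNIV - B)))"
    by (intro multiplier_compl multiplier_Int assms)
  moreover have "UNIV - ((UNIV - A) \<inter> (UNIV - B)) = A \<union> B" by auto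
  ultimately show ?thesis by simp
qed

text \<open>Half-spaces generate the Borel sets; complements and finite unions are algebraic, and a
  countable union is a dominated limit of its finite parts.\<close>

lemma multiplier_set_borel:
  fixes A :: "(real^'n) set"
  assumes "A \<in> sets borel" shows "multiplier_set A"
proof -
  have emp: "multiplier_set ({} :: (real^'n) set)"
    by (auto simp: multiplier_set_def trig_approx_trig_poly trig_poly_const)
  have "A \<in> sigma_sets UNIV ((\<lambda>(a, i). {x::real^'n. x \<bullet> i < a}) ` (UNIV \<times> Basis))"
    using assms by (subst (asm) borel_eq_halfspace_less) simp
  then show ?thesis
  proof induction
    case (Basic A)
    then obtain a j where "A = {x. x $ j < a}" by (auto simp: Basis_vec_def inner_axis)
    then show ?case using multiplier_halfspace by simp
  next
    case Empty then show ?case by (rule emp)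
  next
    case (Compl A) then show ?case by (intro multiplier_compl)
  next
    case (Union A)
    have fin: "multiplier_set (\<Union>i<n. A i)" for n :: nat
      by (induction n) (auto simp: lessThan_Suc emp intro: multiplier_Un Union)
    show ?case unfolding multiplier_set_def
    proof (intro conjI allI impI)
      show meas: "(\<Union>i. A i) \<in> sets borel" using Union by (auto simp: multiplier_set_def)
      fix g :: "real^'n \<Rightarrow> real" assume g: "trig_approx g"
      show "trig_approx (\<lambda>x. indicat_real (\<Union>i. A i) x * g x)"
      proof (rule trig_approx_dominated[where g="\<lambda>n x. indicat_real (\<Union>i<n. A i) x * g x" and h="\<lambda>x. \<bar>g x\<bar>"])
        show "AE x in torus. (\<lambda>n. indicat_real (\<Union>i<n. A i) x * g x) \<longlonglongrightarrow> indicat_real (\<Union>i. A i) x * g x"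
          by (intro always_eventually allI tendsto_intros LIMSEQ_indicator_UN)
        show "AE x in torus. \<bar>indicat_real (\<Union>i<n. A i) x * g x\<bar> \<le> \<bar>g x\<bar>" for n
          by (auto simp: indicator_def abs_mult)
      qed (use fin g meas in \<open>auto simp: multiplier_set_def intro: L2_abs trig_approx_L2 indicator_mult_measurable\<close>)
    qed
  qed
qed

text \<open>Simple functions dominated by 2 |f| converge to f, and the indicators of their level
  sets are multipliers applied to the constant 1.\<close>

lemma L2_trig_approx:
  fixes f :: "real^'n \<Rightarrow> real"
  assumes "L2 f" shows "trig_approx f"
proof -
  obtain F where F: "\<And>i. simple_function torus (F i)" "\<And>x. x \<in> Omega \<Longrightarrow> (\<lambda>i. F i x) \<longlonglongrightarrow> f x"
    "\<And>i x. x \<in> Omega \<Longrightarrow> \<bar>F i x\<bar> \<le> 2 * \<bar>f x\<bar>"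
    using borel_measurable_implies_sequence_metric[OF L2_meas[OF assms], of 0]
    unfolding space_torus dist_real_def diff_0_right by blast
  have "trig_approx (F i)" for i
  proof -
    have eq: "F i x = (\<Sum>y\<in>F i ` Omega. y * indicat_real (F i -` {y} \<inter> Omega) x)" if "x \<in> Omega" for x
    proof -
      have "F i x = (\<Sum>y\<in>F i ` space torus. indicat_real (F i -` {y} \<inter> space torus) x *\<^sub>R y)"
        by (rule simple_function_indicator_representation_banach[OF F(1)]) (use that in simp)
      also have "\<dots> = (\<Sum>y\<in>F i ` Omega. y * indicat_real (F i -` {y} \<inter> Omega) x)"
        by (intro sum.cong) auto
      finally show ?thesis .
    qed
    have A: "F i -` {y} \<inter> Omega \<in> sets borel" for y
    proof -
      have "F i -` {y} \<inter> space torus \<in> sets torus"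
        using F(1)[of i] by (rule simple_functionD)
      then show ?thesis by (auto simp: torus_def sets_restrict_space)
    qed
    have "trig_approx (\<lambda>x. \<Sum>y\<in>F i ` Omega. y * (indicat_real (F i -` {y} \<inter> Omega) x * 1))"
    proof (intro trig_approx_sum trig_approx_cmult)
      fix y
      show "trig_approx (\<lambda>x. indicat_real (F i -` {y} \<inter> Omega) x * 1)"
        using multiplier_set_borel[OF A[of y]] trig_approx_trig_poly[OF trig_poly_const[of 1]]
        unfolding multiplier_set_def by blast
    qed
    then show ?thesis
    proof (rule trig_approx_cong_AE)
      show "AE x in torus. (\<Sum>y\<in>F i ` Omega. y * (indicat_real (F i -` {y} \<inter> Omega) x * 1)) = F i x"
        using AE_space by eventually_elim (simp only: space_torus mult_1_right eq[symmetric])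
      show "F i \<in> borel_measurable torus" using F(1) borel_measurable_simple_function by blast
    qed
  qed
  then show ?thesis
    by (rule trig_approx_dominated[where h="\<lambda>x. 2 * \<bar>f x\<bar>" and g=F])
       (use F assms in \<open>auto intro: L2_cmult L2_abs L2_meas\<close>)
qed

subsection \<open>Parseval's identity\<close>

lemma Bessel:
  assumes "L2 f" "finite F" "F \<subseteq> Zd"
  shows "(\<Sum>k\<in>F. (cmod (fcoef f k))\<^sup>2) \<le> nsq f"
proof -
  obtain N where "F \<subseteq> KN N" using finite_subset_KN[OF assms(2,3)] by blast
  then have "(\<Sum>k\<in>F. (cmod (fcoef f k))\<^sup>2) \<le> (\<Sum>k\<in>KN N. (cmod (fcoef f k))\<^sup>2)"
    by (intro sum_mono2) auto
  also have "\<dots> \<le> nsq f"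
    using nsq_diff_proj[OF assms(1), of N] nsq_nonneg[of "\<lambda>x. f x - proj N f x"] by linarith
  finally show ?thesis .
qed

lemma Parseval:
  assumes f: "L2 f"
  shows "((\<lambda>k. (cmod (fcoef f k))\<^sup>2) has_sum nsq f) Zd"
proof -
  let ?h = "\<lambda>k. (cmod (fcoef f k))\<^sup>2"
  have sm: "?h summable_on Zd"
    using Bessel[OF f] by (intro nonneg_bdd_above_summable_on bdd_aboveI2) auto
  have "infsum ?h Zd \<le> nsq f"
    using Bessel[OF f] by (intro infsum_le_finite_sums sm) auto
  moreover have "nsq f \<le> infsum ?h Zd"
  proof (rule field_le_epsilon)
    fix \<epsilon> :: real assume "\<epsilon> > 0"
    then obtain p N where p: "p \<in> XN N" "nsq (\<lambda>x. f x - p x) < \<epsilon>"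
      using L2_trig_approx[OF f] unfolding trig_approx_def trig_poly_def by blast
    have "nsq f - (\<Sum>k\<in>KN N. ?h k) \<le> nsq (\<lambda>x. f x - p x)"
      unfolding nsq_diff_trig[OF f p(1)] by (simp add: sum_nonneg)
    moreover have "(\<Sum>k\<in>KN N. ?h k) \<le> infsum ?h Zd"
      by (intro finite_sum_le_infsum sm KN_subset_Zd) auto
    ultimately show "nsq f \<le> infsum ?h Zd + \<epsilon>" using p by linarith
  qed
  ultimately show ?thesis using sm by (metis has_sum_infsum order_antisym)
qed

text \<open>Polarisation of \<open>Parseval\<close>, from the sum and the difference of f and
  g.\<close>

lemma Parseval_ip:
  assumes f: "L2 f" and g: "L2 g"
  shows "((\<lambda>k. Re (fcoef f k * cnj (fcoef g k))) has_sum ip f g) Zd"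
proof -
  have 1: "((\<lambda>k. (cmod (fcoef (\<lambda>x. f x + g x) k))\<^sup>2) has_sum nsq (\<lambda>x. f x + g x)) Zd"
    by (intro Parseval L2_add f g)
  have 2: "((\<lambda>k. (cmod (fcoef (\<lambda>x. f x - g x) k))\<^sup>2) has_sum nsq (\<lambda>x. f x - g x)) Zd"
    by (intro Parseval L2_diff f g)
  have "((\<lambda>k. (1/4) * ((cmod (fcoef (\<lambda>x. f x + g x) k))\<^sup>2 + (-1) * (cmod (fcoef (\<lambda>x. f x - g x) k))\<^sup>2)) has_sum
     (1/4) * (nsq (\<lambda>x. f x + g x) + (-1) * nsq (\<lambda>x. f x - g x))) Zd"
    by (intro has_sum_cmult_right has_sum_add 1 2)
  moreover have "(1/4) * ((cmod (fcoef (\<lambda>x. f x + g x) k))\<^sup>2 + (-1) * (cmod (fcoef (\<lambda>x. f x - g x) k))\<^sup>2) = Re (fcoef f k * cnj (fcoef g k))" (is "?A k = ?B k") for k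
    unfolding fcoef_add[OF L2_integrable[OF f] L2_integrable[OF g]] fcoef_diff[OF L2_integrable[OF f] L2_integrable[OF g]] cmod_power2
    by (simp add: power2_eq_square algebra_simps)
  moreover have "(1/4) * (nsq (\<lambda>x. f x + g x) + (-1) * nsq (\<lambda>x. f x - g x)) = ip f g"
    using nsq_add_scale[OF f g, of 1] nsq_add_scale[OF f g, of "-1"] by simp
  ultimately show ?thesis by (simp only:)
qed

text \<open>The balls are cofinal among the finite subsets of the lattice, so unordered sums can be
  computed as limits along \<open>KN\<close>.\<close>

lemma filterlim_KN: "filterlim KN (finite_subsets_at_top Zd) sequentially"
  unfolding filterlim_finite_subsets_at_top
proof (intro allI impI)
  fix X :: "(real^'n) set" assume "finite X \<and> X \<subseteq> Zd"
  then obtain N where "X \<subseteq> KN N" using finite_subset_KN[of X] by blast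
  then have "\<forall>n\<ge>N. finite (KN n) \<and> X \<subseteq> KN n \<and> KN n \<subseteq> Zd"
    using KN_mono KN_subset_Zd finite_KN by (meson order_trans)
  then show "\<forall>\<^sub>F n in sequentially. finite (KN n) \<and> X \<subseteq> KN n \<and> KN n \<subseteq> Zd"
    unfolding eventually_sequentially by blast
qed

lemma has_sum_KN_tendsto: "(f has_sum s) Zd \<Longrightarrow> (\<lambda>N. sum f (KN N)) \<longlonglongrightarrow> s"
  unfolding has_sum_def by (rule filterlim_compose[OF _ filterlim_KN])

lemma proj_tendsto:
  assumes "L2 f"
  shows "(\<lambda>N. nsq (\<lambda>x. f x - proj N f x)) \<longlonglongrightarrow> 0"
  unfolding nsq_diff_proj[OF assms]
  using tendsto_diff[OF tendsto_const[of "nsq f"] has_sum_KN_tendsto[OF Parseval[OF assms]]] by simp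

subsection \<open>Sobolev weights\<close>

text \<open>The symbol of minus the Laplacian at frequency k; \<open>wt\<close> is that of the
  identity minus the Laplacian, so that \<open>sobolev m\<close> below is H^m.\<close>

definition kap :: "real^'n \<Rightarrow> real" where "kap k = (2 * pi * norm k)\<^sup>2"

definition wt :: "real^'n \<Rightarrow> real" where "wt k = 1 + kap k"

lemma kap_nonneg [simp]: "0 \<le> kap k" by (simp add: kap_def)
lemma kap_minus [simp]: "kap (- k) = kap k" by (simp add: kap_def)
lemma kap_0 [simp]: "kap 0 = 0" by (simp add: kap_def)
lemma wt_ge_1 [simp]: "1 \<le> wt k" by (simp add: wt_def)
lemma wt_pos [simp]: "0 < wt k" using wt_ge_1[of k] by linarith
lemma wt_nonneg [simp]: "0 \<le> wt k" using wt_ge_1[of k] by linarith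
lemma wt_neq_0 [simp]: "wt k \<noteq> 0" using wt_pos[of k] by linarith
lemma Hs_weight_1: "Hs_weight 1 k = wt k"
  using wt_pos[of k] by (simp add: Hs_weight_def wt_def kap_def)

lemma wt_add_le: "wt (j + l) \<le> 2 * (wt j + wt l)"
proof -
  have "(norm (j + l))\<^sup>2 \<le> (norm j + norm l)\<^sup>2"
    by (intro power_mono norm_triangle_ineq) simp
  also have "\<dots> \<le> 2 * (norm j)\<^sup>2 + 2 * (norm l)\<^sup>2"
    using zero_le_power2[of "norm j - norm l"] by (simp add: power2_eq_square algebra_simps)
  finally have "(2*pi)\<^sup>2 * (norm (j + l))\<^sup>2 \<le> (2*pi)\<^sup>2 * (2 * (norm j)\<^sup>2 + 2 * (norm l)\<^sup>2)"
    by (intro mult_left_mono) auto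
  then show ?thesis by (simp add: wt_def kap_def power_mult_distrib algebra_simps)
qed

lemma component_sq_le_wt: "1 + (k $ i)\<^sup>2 \<le> wt k"
proof -
  have "\<bar>k $ i\<bar> \<le> 2 * pi * norm k"
    using component_le_norm_cart[of k i] pi_gt3 mult_right_mono[of 1 "2 * pi" "norm k"] by simp
  then have "\<bar>k $ i\<bar>\<^sup>2 \<le> (2 * pi * norm k)\<^sup>2" by (intro power_mono) auto
  then show ?thesis by (simp add: wt_def kap_def)
qed

lemma summable_lattice_1d: "summable (\<lambda>j::nat. (1 + (real j)\<^sup>2) powr (-(2/3)))"
proof (rule summable_comparison_test_ev)
  have "summable (\<lambda>j::nat. real j powr (-(4/3)))" by (subst summable_real_powr_iff) simp
  then show "summable (\<lambda>j::nat. real j powr (-(4/3)))" .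
  show "\<forall>\<^sub>F j in sequentially. norm ((1 + (real j)\<^sup>2) powr (-(2/3))) \<le> real j powr (-(4/3))"
    using eventually_gt_at_top[of 0]
  proof eventually_elim
    case (elim j)
    have "(1 + (real j)\<^sup>2) powr (-(2/3)) \<le> ((real j)\<^sup>2) powr (-(2/3))"
      using elim by (intro powr_mono2') auto
    also have "(real j)\<^sup>2 = real j powr 2" using elim by simp
    also have "(real j powr 2) powr (-(2/3)) = real j powr (-(4/3))"
      by (simp only: powr_powr) simp
    finally show ?case by simp
  qed
qed

text \<open>The dimension enters here. The exponent 2 is shared out as 2/3 per coordinate, which
  amounts to at most 2 for three coordinates, while 2 * 2/3 > 1 keeps each one-dimensional sum
  finite.\<close>

lemma wt_powr_prod_le:
  fixes k :: "real^'n"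
  assumes "CARD('n) \<le> 3"
  shows "1 / (wt k)\<^sup>2 \<le> (\<Prod>i\<in>UNIV. (1 + (k $ i)\<^sup>2) powr (-(2/3)))"
proof -
  have "(\<Prod>i\<in>(UNIV::'n set). (1 + (k $ i)\<^sup>2) powr (2/3)) \<le> (\<Prod>i\<in>(UNIV::'n set). wt k powr (2/3))"
    by (intro prod_mono conjI powr_mono2 component_sq_le_wt) auto
  also have "\<dots> = wt k powr (2/3 * real CARD('n))"
    by (simp add: powr_power mult.commute)
  also have "\<dots> \<le> wt k powr 2" using assms by (intro powr_mono) auto
  also have "\<dots> = (wt k)\<^sup>2" by simp
  finally have "1 / (wt k)\<^sup>2 \<le> 1 / (\<Prod>i\<in>(UNIV::'n set). (1 + (k $ i)\<^sup>2) powr (2/3))"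
    by (intro divide_left_mono mult_pos_pos prod_pos) (auto simp: add_pos_nonneg less_imp_neq[symmetric])
  also have "\<dots> = (\<Prod>i\<in>UNIV. (1 + (k $ i)\<^sup>2) powr (-(2/3)))"
    by (simp add: powr_minus_divide prod_dividef)
  finally show ?thesis .
qed

lemma summable_wt:
  assumes "CARD('n) \<le> 3"
  shows "(\<lambda>k::real^'n. 1 / (wt k)\<^sup>2) summable_on Zd"
proof (rule nonneg_bdd_above_summable_on)
  let ?g = "\<lambda>t::real. (1 + t\<^sup>2) powr (-(2/3))"
  define T where "T = 2 * (\<Sum>j. ?g (real j))"
  have gT: "(\<Sum>m\<in>{- int n..int n}. ?g (real_of_int m)) \<le> T" for n :: nat
  proof -
    have "(\<Sum>m\<in>{- int n..int n}. ?g (real_of_int m)) \<le> (\<Sum>m\<in>int ` {..n} \<union> (\<lambda>j. - int j) ` {..n}. ?g (real_of_int m))"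
    proof (rule sum_mono2)
      show "{- int n..int n} \<subseteq> int ` {..n} \<union> (\<lambda>j. - int j) ` {..n}"
      proof
        fix m assume "m \<in> {- int n..int n}"
        then show "m \<in> int ` {..n} \<union> (\<lambda>j. - int j) ` {..n}"
          by (cases m rule: int_cases2) auto
      qed
    qed auto
    also have "\<dots> \<le> (\<Sum>m\<in>int ` {..n}. ?g (real_of_int m)) + (\<Sum>m\<in>(\<lambda>j. - int j) ` {..n}. ?g (real_of_int m))"
      by (subst sum_Un) (auto intro!: sum_nonneg)
    also have "\<dots> = 2 * (\<Sum>j\<le>n. ?g (real j))"
      by (subst (1 2) sum.reindex) (auto simp: inj_on_def)
    also have "\<dots> \<le> T"
      unfolding T_def by (intro mult_left_mono sum_le_suminf summable_lattice_1d) auto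
    finally show ?thesis .
  qed
  show "bdd_above (sum (\<lambda>k::real^'n. 1 / (wt k)\<^sup>2) ` {F. F \<subseteq> Zd \<and> finite F})"
  proof (rule bdd_aboveI2)
    fix F :: "(real^'n) set" assume "F \<in> {F. F \<subseteq> Zd \<and> finite F}"
    then obtain n where n: "F \<subseteq> KN n" using finite_subset_KN[of F] by blast
    have "(\<Sum>k\<in>F. 1 / (wt k)\<^sup>2) \<le> (\<Sum>k\<in>(lattice_box n :: (real^'n) set). 1 / (wt k)\<^sup>2)"
      using n KN_subset_lattice_box[of n] by (intro sum_mono2 finite_lattice_box) auto
    also have "\<dots> \<le> (\<Sum>k\<in>(lattice_box n :: (real^'n) set). \<Prod>i\<in>UNIV. ?g (k $ i))"
      by (intro sum_mono wt_powr_prod_le assms)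
    also have "\<dots> = (\<Prod>i\<in>(UNIV::'n set). \<Sum>m\<in>{- int n..int n}. ?g (real_of_int m))"
      by (rule sum_lattice_box_prod)
    also have "\<dots> \<le> (\<Prod>i\<in>(UNIV::'n set). T)"
      by (intro prod_mono conjI gT sum_nonneg) auto
    finally show "(\<Sum>k\<in>F. 1 / (wt k)\<^sup>2) \<le> (\<Prod>i\<in>(UNIV::'n set). T)" .
  qed
qed auto

definition lattice_sum :: "'n::finite itself \<Rightarrow> real" where
  "lattice_sum _ = infsum (\<lambda>k::real^'n. 1 / (wt k)\<^sup>2) Zd"

lemma lattice_sum_nonneg [simp]: "0 \<le> lattice_sum T"
  unfolding lattice_sum_def by (intro infsum_nonneg) auto

subsection \<open>Sobolev spaces of integer order\<close>

definition sobolev :: "nat \<Rightarrow> (real^'n \<Rightarrow> real) \<Rightarrow> bool" where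
  "sobolev m f \<longleftrightarrow> L2 f \<and> (\<lambda>k. wt k ^ m * (cmod (fcoef f k))\<^sup>2) summable_on Zd"

definition sobolev_sq :: "nat \<Rightarrow> (real^'n \<Rightarrow> real) \<Rightarrow> real" where
  "sobolev_sq m f = infsum (\<lambda>k. wt k ^ m * (cmod (fcoef f k))\<^sup>2) Zd"

lemma sobolev_L2: "sobolev m f \<Longrightarrow> L2 f" by (simp add: sobolev_def)
lemma sobolev_summable: "sobolev m f \<Longrightarrow> (\<lambda>k. wt k ^ m * (cmod (fcoef f k))\<^sup>2) summable_on Zd" by (simp add: sobolev_def)
lemma sobolev_sq_nonneg [simp]: "0 \<le> sobolev_sq m f" unfolding sobolev_sq_def by (intro infsum_nonneg) auto

lemma Xsp_sobolev: "f \<in> Xsp \<longleftrightarrow> sobolev 1 f"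
  by (simp add: Xsp_def in_Hs_def sobolev_def Hs_weight_1)

lemma H1_norm_sobolev_sq: "H1_norm f = sqrt (sobolev_sq 1 f)"
  by (simp add: H1_norm_def sobolev_sq_def Hs_weight_1)

lemma L2_norm_nsq: "L2_norm f = sqrt (nsq f)"
  by (simp add: L2_norm_def set_integral_Omega)

lemma L2_inner_ip: "L2_inner f g = ip f g"
  by (simp add: L2_inner_def set_integral_Omega)

lemma summable_on_comparison_real:
  fixes f g :: "'a \<Rightarrow> real"
  assumes "g summable_on A" "\<And>x. x \<in> A \<Longrightarrow> 0 \<le> f x" "\<And>x. x \<in> A \<Longrightarrow> f x \<le> g x"
  shows "f summable_on A"
proof (rule nonneg_bdd_above_summable_on[OF assms(2)])
  show "bdd_above (sum f ` {F. F \<subseteq> A \<and> finite F})"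
  proof (rule bdd_aboveI2)
    fix F assume F: "F \<in> {F. F \<subseteq> A \<and> finite F}"
    then have "sum f F \<le> sum g F" using assms(3) by (intro sum_mono) auto
    also have "\<dots> \<le> infsum g A"
      using F assms by (intro finite_sum_le_infsum) (auto intro: order_trans)
    finally show "sum f F \<le> infsum g A" .
  qed
qed

lemma sobolev_mono:
  assumes "sobolev m f" "l \<le> m" shows "sobolev l f"
  using assms unfolding sobolev_def
  by (auto intro!: summable_on_comparison_real[of "\<lambda>k. wt k ^ m * (cmod (fcoef f k))\<^sup>2"] mult_right_mono power_increasing)

lemma sobolev_sq_mono:
  assumes "sobolev m f" "l \<le> m" shows "sobolev_sq l f \<le> sobolev_sq m f"
  unfolding sobolev_sq_def
  using sobolev_summable[OF sobolev_mono[OF assms]] sobolev_summable[OF assms(1)] assms(2)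
  by (intro infsum_mono mult_right_mono power_increasing) auto

lemma in_Hs_sobolev:
  assumes "in_Hs s f" "real m \<le> s" shows "sobolev m f"
  unfolding sobolev_def
proof
  show "L2 f" using assms by (simp add: in_Hs_def)
  show "(\<lambda>k. wt k ^ m * (cmod (fcoef f k))\<^sup>2) summable_on Zd"
  proof (rule summable_on_comparison_real)
    show "(\<lambda>k. Hs_weight s k * (cmod (fcoef f k))\<^sup>2) summable_on Zd" using assms by (simp add: in_Hs_def)
    fix k :: "real^'a"
    have "wt k ^ m = wt k powr real m" by (simp add: powr_realpow)
    also have "\<dots> \<le> wt k powr s" using assms by (intro powr_mono) auto
    finally show "wt k ^ m * (cmod (fcoef f k))\<^sup>2 \<le> Hs_weight s k * (cmod (fcoef f k))\<^sup>2"
      by (intro mult_right_mono) (auto simp: Hs_weight_def wt_def kap_def)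
  qed auto
qed

lemma sobolev_sq_0: "L2 f \<Longrightarrow> sobolev_sq 0 f = nsq f"
  using infsumI[OF Parseval] by (simp add: sobolev_sq_def)

lemma nsq_le_sobolev_sq: "sobolev m f \<Longrightarrow> nsq f \<le> sobolev_sq m f"
  using sobolev_sq_mono[of m f 0] sobolev_sq_0[of f] sobolev_L2[of m f] by simp

lemma sum_le_sobolev_sq:
  assumes "sobolev m f" "finite F" "F \<subseteq> Zd"
  shows "(\<Sum>k\<in>F. wt k ^ m * (cmod (fcoef f k))\<^sup>2) \<le> sobolev_sq m f"
  unfolding sobolev_sq_def by (intro finite_sum_le_infsum sobolev_summable assms) auto

lemma hregI:
  assumes "L2 f" "\<And>F. finite F \<Longrightarrow> F \<subseteq> Zd \<Longrightarrow> (\<Sum>k\<in>F. wt k ^ m * (cmod (fcoef f k))\<^sup>2) \<le> B"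
  shows "sobolev m f" "sobolev_sq m f \<le> B"
proof -
  have sm: "(\<lambda>k. wt k ^ m * (cmod (fcoef f k))\<^sup>2) summable_on Zd"
    using assms(2) by (intro nonneg_bdd_above_summable_on bdd_aboveI2[where M=B]) auto
  then show "sobolev m f" using assms by (simp add: sobolev_def)
  show "sobolev_sq m f \<le> B" unfolding sobolev_sq_def using assms(2) by (intro infsum_le_finite_sums sm) auto
qed

lemma cmod_add_sq_le: "(cmod (a + b))\<^sup>2 \<le> 2 * (cmod a)\<^sup>2 + 2 * (cmod b)\<^sup>2"
proof -
  have "(cmod (a + b))\<^sup>2 \<le> (cmod a + cmod b)\<^sup>2" by (intro power_mono norm_triangle_ineq) simp
  also have "\<dots> \<le> 2 * (cmod a)\<^sup>2 + 2 * (cmod b)\<^sup>2"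
    using zero_le_power2[of "cmod a - cmod b"] by (simp add: power2_eq_square algebra_simps)
  finally show ?thesis .
qed

lemma
  assumes f: "sobolev m f" and g: "sobolev m g"
  shows sobolev_add: "sobolev m (\<lambda>x. f x + g x)"
    and sobolev_sq_add_le: "sobolev_sq m (\<lambda>x. f x + g x) \<le> 2 * sobolev_sq m f + 2 * sobolev_sq m g"
proof -
  have *: "(\<Sum>k\<in>F. wt k ^ m * (cmod (fcoef (\<lambda>x. f x + g x) k))\<^sup>2) \<le> 2 * sobolev_sq m f + 2 * sobolev_sq m g" if F: "finite F" "F \<subseteq> Zd" for F
  proof -
    have "(\<Sum>k\<in>F. wt k ^ m * (cmod (fcoef (\<lambda>x. f x + g x) k))\<^sup>2)
       \<le> (\<Sum>k\<in>F. wt k ^ m * (2 * (cmod (fcoef f k))\<^sup>2 + 2 * (cmod (fcoef g k))\<^sup>2))"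
      using f g by (intro sum_mono mult_left_mono) (auto simp: fcoef_add L2_integrable sobolev_L2 intro: cmod_add_sq_le)
    also have "\<dots> = 2 * (\<Sum>k\<in>F. wt k ^ m * (cmod (fcoef f k))\<^sup>2) + 2 * (\<Sum>k\<in>F. wt k ^ m * (cmod (fcoef g k))\<^sup>2)"
      by (simp add: ring_distribs sum.distrib sum_distrib_left mult_ac)
    also have "\<dots> \<le> 2 * sobolev_sq m f + 2 * sobolev_sq m g"
      using sum_le_sobolev_sq[OF f F] sum_le_sobolev_sq[OF g F] by linarith
    finally show ?thesis .
  qed
  show "sobolev m (\<lambda>x. f x + g x)" "sobolev_sq m (\<lambda>x. f x + g x) \<le> 2 * sobolev_sq m f + 2 * sobolev_sq m g"
    using hregI[OF L2_add[OF sobolev_L2[OF f] sobolev_L2[OF g]] *] by auto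
qed

lemma sobolev_sq_cmult: "sobolev_sq m (\<lambda>x. c * f x) = c\<^sup>2 * sobolev_sq m f"
proof -
  have "sobolev_sq m (\<lambda>x. c * f x) = infsum (\<lambda>k. c\<^sup>2 * (wt k ^ m * (cmod (fcoef f k))\<^sup>2)) Zd"
    unfolding sobolev_sq_def by (intro infsum_cong) (simp add: fcoef_cmult norm_mult power_mult_distrib)
  also have "\<dots> = c\<^sup>2 * sobolev_sq m f" unfolding sobolev_sq_def by (rule infsum_cmult_right')
  finally show ?thesis .
qed

lemma sobolev_cmult: "sobolev m f \<Longrightarrow> sobolev m (\<lambda>x. c * f x)"
  unfolding sobolev_def
proof safe
  assume "(\<lambda>k. wt k ^ m * (cmod (fcoef f k))\<^sup>2) summable_on Zd"
  then have "(\<lambda>k. c\<^sup>2 * (wt k ^ m * (cmod (fcoef f k))\<^sup>2)) summable_on Zd"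
    by (rule summable_on_cmult_right)
  then show "(\<lambda>k. wt k ^ m * (cmod (fcoef (\<lambda>x. c * f x) k))\<^sup>2) summable_on Zd"
    by (simp add: fcoef_cmult norm_mult power_mult_distrib mult_ac)
qed (rule L2_cmult)

lemma sobolev_diff: "sobolev m f \<Longrightarrow> sobolev m g \<Longrightarrow> sobolev m (\<lambda>x. f x - g x)"
  using sobolev_add[of m f "\<lambda>x. -1 * g x"] sobolev_cmult[of m g "-1"] by simp

lemma sobolev_sq_diff_le: "sobolev m f \<Longrightarrow> sobolev m g \<Longrightarrow> sobolev_sq m (\<lambda>x. f x - g x) \<le> 2 * sobolev_sq m f + 2 * sobolev_sq m g"
  using sobolev_sq_add_le[of m f "\<lambda>x. -1 * g x"] sobolev_cmult[of m g "-1"] sobolev_sq_cmult[of m "-1" g] by simp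

lemma
  assumes p: "p \<in> XN N"
  shows sobolev_XN: "sobolev m p" and sobolev_sq_XN: "sobolev_sq m p = (\<Sum>k\<in>KN N. wt k ^ m * (cmod (fcoef p k))\<^sup>2)"
proof -
  have "((\<lambda>k. wt k ^ m * (cmod (fcoef p k))\<^sup>2) has_sum (\<Sum>k\<in>KN N. wt k ^ m * (cmod (fcoef p k))\<^sup>2)) Zd"
    by (rule has_sum_finite_neutralI)
       (use KN_subset_Zd fcoef_XN_outside[OF p] in auto)
  then show "sobolev m p" "sobolev_sq m p = (\<Sum>k\<in>KN N. wt k ^ m * (cmod (fcoef p k))\<^sup>2)"
    using XN_L2[OF p] by (auto simp: sobolev_def sobolev_sq_def summable_on_def infsumI)
qed

lemma sobolev_sq_proj:
  "sobolev_sq m (proj N f) = (\<Sum>k\<in>KN N. wt k ^ m * (cmod (fcoef f k))\<^sup>2)"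
  unfolding sobolev_sq_XN[OF trig_XN] by (intro sum.cong refl) (simp add: fcoef_proj subsetD[OF KN_subset_Zd, of _ N])

lemma sobolev_sq_proj_le: "sobolev m f \<Longrightarrow> sobolev_sq m (proj N f) \<le> sobolev_sq m f"
  unfolding sobolev_sq_proj by (intro sum_le_sobolev_sq KN_subset_Zd) auto

lemma nsq_proj_le: "L2 f \<Longrightarrow> nsq (proj N f) \<le> nsq f"
  using sobolev_sq_proj_le[of 0 f N] sobolev_sq_0[of f] sobolev_sq_0[OF XN_L2[OF trig_XN], of N "fcoef f"] infsumI[OF Parseval]
  by (auto simp: sobolev_def summable_on_def dest: Parseval)

subsection \<open>Convolution estimates\<close>

lemma sum_shift_le:
  fixes h :: "real^'n \<Rightarrow> real"
  assumes "h summable_on Zd" "\<And>k. 0 \<le> h k" "finite F" "F \<subseteq> Zd" "j \<in> Zd"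
  shows "(\<Sum>k\<in>F. h (k - j)) \<le> infsum h Zd" "(\<Sum>k\<in>F. h (j - k)) \<le> infsum h Zd"
proof -
  have "(\<Sum>k\<in>F. h (k - j)) = sum h ((\<lambda>k. k - j) ` F)"
    by (subst sum.reindex) (auto simp: inj_on_def)
  also have "\<dots> \<le> infsum h Zd"
    using assms by (intro finite_sum_le_infsum) (auto simp: Zd_diff)
  finally show "(\<Sum>k\<in>F. h (k - j)) \<le> infsum h Zd" .
  have "(\<Sum>k\<in>F. h (j - k)) = sum h ((\<lambda>k. j - k) ` F)"
    by (subst sum.reindex) (auto simp: inj_on_def)
  also have "\<dots> \<le> infsum h Zd"
    using assms by (intro finite_sum_le_infsum) (auto simp: Zd_diff)
  finally show "(\<Sum>k\<in>F. h (j - k)) \<le> infsum h Zd" .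
qed

text \<open>Cauchy-Schwarz in j leaves only the row sums of the squared kernel, bounded by B. The
  sum over k then merely shifts y, and the sums of x and y separate.\<close>

lemma convolution_estimate:
  fixes x y :: "real^'n \<Rightarrow> real"
  assumes K: "\<And>k. k \<in> F \<Longrightarrow> (\<Sum>j\<in>J. (K k j)\<^sup>2) \<le> B" and "0 \<le> B"
    and x: "(\<lambda>k. (x k)\<^sup>2) summable_on Zd" and y: "(\<lambda>k. (y k)\<^sup>2) summable_on Zd"
    and F: "finite F" "F \<subseteq> Zd" and J: "finite J" "J \<subseteq> Zd"
  shows "(\<Sum>k\<in>F. (\<Sum>j\<in>J. K k j * (x j * y (k - j)))\<^sup>2) \<le> B * (infsum (\<lambda>k. (x k)\<^sup>2) Zd * infsum (\<lambda>k. (y k)\<^sup>2) Zd)"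
proof -
  have "(\<Sum>k\<in>F. (\<Sum>j\<in>J. K k j * (x j * y (k - j)))\<^sup>2)
     \<le> (\<Sum>k\<in>F. B * (\<Sum>j\<in>J. (x j)\<^sup>2 * (y (k - j))\<^sup>2))"
  proof (rule sum_mono)
    fix k assume "k \<in> F"
    have "(\<Sum>j\<in>J. K k j * (x j * y (k - j)))\<^sup>2 \<le> (\<Sum>j\<in>J. (K k j)\<^sup>2) * (\<Sum>j\<in>J. (x j * y (k - j))\<^sup>2)"
      by (rule Cauchy_Schwarz_ineq_sum)
    also have "\<dots> \<le> B * (\<Sum>j\<in>J. (x j * y (k - j))\<^sup>2)"
      using K[OF \<open>k \<in> F\<close>] by (intro mult_right_mono sum_nonneg) auto
    finally show "(\<Sum>j\<in>J. K k j * (x j * y (k - j)))\<^sup>2 \<le> B * (\<Sum>j\<in>J. (x j)\<^sup>2 * (y (k - j))\<^sup>2)"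
      by (simp add: power_mult_distrib)
  qed
  also have "\<dots> = B * (\<Sum>j\<in>J. (x j)\<^sup>2 * (\<Sum>k\<in>F. (y (k - j))\<^sup>2))"
    by (subst sum_distrib_left[symmetric], subst sum.swap) (simp add: sum_distrib_left)
  also have "\<dots> \<le> B * (\<Sum>j\<in>J. (x j)\<^sup>2 * infsum (\<lambda>k. (y k)\<^sup>2) Zd)"
    using J by (intro mult_left_mono sum_mono sum_shift_le(1)[OF y] F \<open>0 \<le> B\<close>) auto
  also have "\<dots> = B * ((\<Sum>j\<in>J. (x j)\<^sup>2) * infsum (\<lambda>k. (y k)\<^sup>2) Zd)"
    by (simp add: sum_distrib_right)
  also have "\<dots> \<le> B * (infsum (\<lambda>k. (x k)\<^sup>2) Zd * infsum (\<lambda>k. (y k)\<^sup>2) Zd)"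
    using J by (intro mult_left_mono mult_right_mono finite_sum_le_infsum x \<open>0 \<le> B\<close> infsum_nonneg) auto
  finally show ?thesis .
qed

lemma weight_kernel_sum:
  assumes S: "(\<lambda>k::real^'n. 1 / (wt k)\<^sup>2) summable_on Zd"
    and J: "finite J" "J \<subseteq> Zd" and k: "(k::real^'n) \<in> Zd"
  shows "(\<Sum>j\<in>J. 1 / (wt j)\<^sup>2 + 1 / (wt (k - j))\<^sup>2) \<le> 2 * lattice_sum TYPE('n)"
proof -
  have "(\<Sum>j\<in>J. 1 / (wt j)\<^sup>2) \<le> lattice_sum TYPE('n)"
    unfolding lattice_sum_def by (intro finite_sum_le_infsum S J) auto
  moreover have "(\<Sum>j\<in>J. 1 / (wt (k - j))\<^sup>2) \<le> lattice_sum TYPE('n)"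
    unfolding lattice_sum_def using sum_shift_le(2)[OF S _ J k] by simp
  ultimately show ?thesis by (simp add: sum.distrib)
qed

lemma norm_fcoef_mult_XN_le:
  assumes "integrable torus f" "p \<in> XN N"
  shows "cmod (fcoef (\<lambda>x. f x * p x) k) \<le> (\<Sum>j\<in>KN N. cmod (fcoef p j) * cmod (fcoef f (k - j)))"
  unfolding fcoef_mult_XN[OF assms] by (rule order_trans[OF norm_sum]) (simp add: norm_mult)

text \<open>The L^4 norm of p is governed by the L^2 norm of p^2, whose coefficients are
  convolutions. Moving the weights into both factors leaves a kernel with square 1 / (wt j * wt (k -
  j)), and a b <= a^2 + b^2 reduces its row sums to the convergent lattice sum.\<close>

lemma nsq_square_XN_le:
  fixes p :: "real^'n \<Rightarrow> real"
  assumes S: "(\<lambda>k::real^'n. 1 / (wt k)\<^sup>2) summable_on Zd" and p: "p \<in> XN N"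
  shows "nsq (\<lambda>x. p x * p x) \<le> 2 * lattice_sum TYPE('n) * (sobolev_sq 1 p)\<^sup>2"
proof -
  let ?x = "\<lambda>k. sqrt (wt k) * cmod (fcoef p k)"
  let ?K = "\<lambda>k j. sqrt (1 / (wt j * wt (k - j)))"
  have xsq: "(?x k)\<^sup>2 = wt k ^ 1 * (cmod (fcoef p k))\<^sup>2" for k by (simp add: power_mult_distrib)
  have xs: "(\<lambda>k. (?x k)\<^sup>2) summable_on Zd" unfolding xsq using sobolev_summable[OF sobolev_XN[OF p]] .
  have xi: "infsum (\<lambda>k. (?x k)\<^sup>2) Zd = sobolev_sq 1 p" unfolding xsq sobolev_sq_def ..
  have "nsq (\<lambda>x. p x * p x) = (\<Sum>k\<in>KN (N + N). (cmod (fcoef (\<lambda>x. p x * p x) k))\<^sup>2)"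
    by (rule nsq_trig[OF XN_mult[OF p p]])
  also have "\<dots> \<le> (\<Sum>k\<in>KN (N + N). (\<Sum>j\<in>KN N. ?K k j * (?x j * ?x (k - j)))\<^sup>2)"
  proof (intro sum_mono power_mono)
    fix k :: "real^'n"
    have "?K k j * (?x j * ?x (k - j)) = cmod (fcoef p j) * cmod (fcoef p (k - j))" for j
    proof -
      have "?K k j * (sqrt (wt j) * sqrt (wt (k - j))) = 1"
        by (simp add: real_sqrt_mult[symmetric])
      then have "?K k j * (sqrt (wt j) * sqrt (wt (k - j))) * (cmod (fcoef p j) * cmod (fcoef p (k - j))) = cmod (fcoef p j) * cmod (fcoef p (k - j))"
        by simp
      then show ?thesis by (simp only: mult_ac)
    qed
    then show "cmod (fcoef (\<lambda>x. p x * p x) k) \<le> (\<Sum>j\<in>KN N. ?K k j * (?x j * ?x (k - j)))"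
      using norm_fcoef_mult_XN_le[OF XN_integrable[OF p] p, of k] by (simp only:)
  qed auto
  also have "\<dots> \<le> (2 * lattice_sum TYPE('n)) * (sobolev_sq 1 p * sobolev_sq 1 p)"
    unfolding xi[symmetric]
  proof (rule convolution_estimate[OF _ _ xs xs])
    fix k :: "real^'n" assume k: "k \<in> KN (N + N)"
    have "(\<Sum>j\<in>KN N. (?K k j)\<^sup>2) \<le> (\<Sum>j\<in>KN N. 1 / (wt j)\<^sup>2 + 1 / (wt (k - j))\<^sup>2)"
    proof (rule sum_mono)
      fix j
      have "1 / wt j * (1 / wt (k - j)) \<le> (1 / wt j)\<^sup>2 + (1 / wt (k - j))\<^sup>2"
      proof -
        have *: "a * b \<le> a\<^sup>2 + b\<^sup>2" if "0 \<le> a" "0 \<le> b" for a b :: real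
          using sum_squares_bound[of a b] mult_nonneg_nonneg[OF that] by linarith
        show ?thesis by (rule *) auto
      qed
      then show "(?K k j)\<^sup>2 \<le> 1 / (wt j)\<^sup>2 + 1 / (wt (k - j))\<^sup>2"
        by (simp add: power_divide)
    qed
    also have "\<dots> \<le> 2 * lattice_sum TYPE('n)"
      using k KN_subset_Zd by (intro weight_kernel_sum S) auto
    finally show "(\<Sum>j\<in>KN N. (?K k j)\<^sup>2) \<le> 2 * lattice_sum TYPE('n)" .
  qed (auto simp: KN_subset_Zd)
  finally show ?thesis by (simp add: power2_eq_square)
qed

text \<open>Because \<open>wt (j + l) \<le> 2 * (wt j + wt l)\<close>, the weight of the product
  falls on one factor at a time and leaves the other with a spare 1 / wt, which is square summable.
  The 16 is 8 from squaring the kernel times 2 from its two lattice sums.\<close>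

lemma sobolev_sq_mult_XN_le:
  fixes p q :: "real^'n \<Rightarrow> real"
  assumes S: "(\<lambda>k::real^'n. 1 / (wt k)\<^sup>2) summable_on Zd" and p: "p \<in> XN N" and q: "q \<in> XN N"
  shows "sobolev_sq 2 (\<lambda>x. q x * p x) \<le> 16 * lattice_sum TYPE('n) * (sobolev_sq 2 p * sobolev_sq 2 q)"
proof -
  let ?x = "\<lambda>k. wt k * cmod (fcoef p k)" and ?y = "\<lambda>k. wt k * cmod (fcoef q k)"
  let ?K = "\<lambda>k j. 2 * (1 / wt j + 1 / wt (k - j))"
  have xs: "(\<lambda>k. (?x k)\<^sup>2) summable_on Zd" "(\<lambda>k. (?y k)\<^sup>2) summable_on Zd"
    unfolding power_mult_distrib using sobolev_summable[OF sobolev_XN[OF p]] sobolev_summable[OF sobolev_XN[OF q]] by blast+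
  have xi: "infsum (\<lambda>k. (?x k)\<^sup>2) Zd = sobolev_sq 2 p" "infsum (\<lambda>k. (?y k)\<^sup>2) Zd = sobolev_sq 2 q"
    unfolding power_mult_distrib sobolev_sq_def by auto
  have "sobolev_sq 2 (\<lambda>x. q x * p x) = (\<Sum>k\<in>KN (N + N). (wt k * cmod (fcoef (\<lambda>x. q x * p x) k))\<^sup>2)"
    unfolding sobolev_sq_XN[OF XN_mult[OF q p]] by (simp add: power_mult_distrib)
  also have "\<dots> \<le> (\<Sum>k\<in>KN (N + N). (\<Sum>j\<in>KN N. ?K k j * (?x j * ?y (k - j)))\<^sup>2)"
  proof (intro sum_mono power_mono)
    fix k :: "real^'n"
    have "wt k * cmod (fcoef (\<lambda>x. q x * p x) k) \<le> wt k * (\<Sum>j\<in>KN N. cmod (fcoef p j) * cmod (fcoef q (k - j)))"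
      by (intro mult_left_mono norm_fcoef_mult_XN_le XN_integrable[OF q] p) simp
    also have "\<dots> \<le> (\<Sum>j\<in>KN N. ?K k j * (?x j * ?y (k - j)))"
      unfolding sum_distrib_left
    proof (rule sum_mono)
      fix j
      have "wt k \<le> 2 * (wt j + wt (k - j))" using wt_add_le[of j "k - j"] by simp
      then have "wt k * (cmod (fcoef p j) * cmod (fcoef q (k - j))) \<le> 2 * (wt j + wt (k - j)) * (cmod (fcoef p j) * cmod (fcoef q (k - j)))"
        by (intro mult_right_mono) auto
      also have "\<dots> = ?K k j * (?x j * ?y (k - j))" by (simp add: field_simps)
      finally show "wt k * (cmod (fcoef p j) * cmod (fcoef q (k - j))) \<le> ?K k j * (?x j * ?y (k - j))" .
    qed
    finally show "wt k * cmod (fcoef (\<lambda>x. q x * p x) k) \<le> (\<Sum>j\<in>KN N. ?K k j * (?x j * ?y (k - j)))" .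
  qed auto
  also have "\<dots> \<le> (16 * lattice_sum TYPE('n)) * (sobolev_sq 2 p * sobolev_sq 2 q)"
    unfolding xi[symmetric]
  proof (rule convolution_estimate[OF _ _ xs])
    fix k :: "real^'n" assume k: "k \<in> KN (N + N)"
    have "(\<Sum>j\<in>KN N. (?K k j)\<^sup>2) \<le> (\<Sum>j\<in>KN N. 8 * (1 / (wt j)\<^sup>2 + 1 / (wt (k - j))\<^sup>2))"
    proof (rule sum_mono)
      fix j
      have "(1 / wt j + 1 / wt (k - j))\<^sup>2 \<le> 2 * (1 / wt j)\<^sup>2 + 2 * (1 / wt (k - j))\<^sup>2"
        using zero_le_power2[of "1 / wt j - 1 / wt (k - j)"] unfolding power2_sum power2_diff by linarith
      then show "(?K k j)\<^sup>2 \<le> 8 * (1 / (wt j)\<^sup>2 + 1 / (wt (k - j))\<^sup>2)"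
        unfolding power_mult_distrib by (simp add: power_divide)
    qed
    also have "\<dots> \<le> 8 * (2 * lattice_sum TYPE('n))"
      unfolding sum_distrib_left[symmetric]
      using k KN_subset_Zd by (intro mult_left_mono weight_kernel_sum S) auto
    finally show "(\<Sum>j\<in>KN N. (?K k j)\<^sup>2) \<le> 16 * lattice_sum TYPE('n)" by simp
  qed (auto simp: KN_subset_Zd)
  finally show ?thesis by simp
qed

text \<open>The l^1 norm of the coefficients dominates the values; splitting off 1 / wt by
  Cauchy-Schwarz costs the lattice sum.\<close>

lemma sup_XN_le:
  fixes p :: "real^'n \<Rightarrow> real"
  assumes S: "(\<lambda>k::real^'n. 1 / (wt k)\<^sup>2) summable_on Zd" and p: "p \<in> XN N"
  shows "(p x)\<^sup>2 \<le> lattice_sum TYPE('n) * sobolev_sq 2 p"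
proof -
  have "\<bar>p x\<bar> = cmod (complex_of_real (p x))" by simp
  also have "\<dots> \<le> (\<Sum>k\<in>KN N. cmod (fcoef p k))"
    unfolding XN_expansion[OF p] by (rule order_trans[OF norm_sum]) (simp add: norm_mult)
  finally have "(p x)\<^sup>2 \<le> (\<Sum>k\<in>KN N. (1 / wt k) * (wt k * cmod (fcoef p k)))\<^sup>2"
    using power_mono[of "\<bar>p x\<bar>" _ 2] by simp
  also have "\<dots> \<le> (\<Sum>k\<in>(KN N :: (real^'n) set). (1 / wt k)\<^sup>2) * (\<Sum>k\<in>KN N. (wt k * cmod (fcoef p k))\<^sup>2)"
    by (rule Cauchy_Schwarz_ineq_sum)
  also have "\<dots> \<le> lattice_sum TYPE('n) * (\<Sum>k\<in>KN N. (wt k * cmod (fcoef p k))\<^sup>2)"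
    unfolding lattice_sum_def power_divide power_one
    by (intro mult_right_mono sum_nonneg finite_sum_le_infsum S KN_subset_Zd) auto
  also have "\<dots> = lattice_sum TYPE('n) * sobolev_sq 2 p"
    unfolding sobolev_sq_XN[OF p] by (simp add: power_mult_distrib)
  finally show ?thesis .
qed

subsection \<open>Limits of Fourier projections\<close>

lemma proj_AE_subseq:
  assumes "L2 f"
  obtains r :: "nat \<Rightarrow> nat" where "strict_mono r" "AE x in torus. (\<lambda>n. proj (r n) f x) \<longlonglongrightarrow> f x"
proof -
  have "\<exists>r::nat\<Rightarrow>nat. strict_mono r \<and> (AE x in torus. (\<lambda>n. (f x - proj (r n) f x)\<^sup>2) \<longlonglongrightarrow> 0)"
  proof (rule tendsto_L1_AE_subseq)
    show "integrable torus (\<lambda>x. (f x - proj n f x)\<^sup>2)" for n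
      by (intro L2_sq L2_diff assms XN_L2[OF trig_XN])
    show "(\<lambda>n. \<integral>x. norm ((f x - proj n f x)\<^sup>2) \<partial>torus) \<longlonglongrightarrow> 0"
      using proj_tendsto[OF assms] by simp
  qed
  then obtain r :: "nat \<Rightarrow> nat" where r: "strict_mono r" "AE x in torus. (\<lambda>n. (f x - proj (r n) f x)\<^sup>2) \<longlonglongrightarrow> 0"
    by blast
  have "AE x in torus. (\<lambda>n. proj (r n) f x) \<longlonglongrightarrow> f x"
    using r(2)
  proof eventually_elim
    case (elim x)
    from tendsto_real_sqrt[OF this] have "(\<lambda>n. \<bar>f x - proj (r n) f x\<bar>) \<longlonglongrightarrow> 0" by simp
    then have "(\<lambda>n. f x - proj (r n) f x) \<longlonglongrightarrow> 0" by (rule tendsto_rabs_zero_cancel)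
    from tendsto_diff[OF tendsto_const[of "f x"] this] show ?case by simp
  qed
  with r(1) that show ?thesis by blast
qed

text \<open>Fatou's lemma along an almost everywhere convergent subsequence of projections carries
  the polynomial bound over and yields the integrability of f^4 at the same time.\<close>

lemma L4_embedding:
  fixes f :: "real^'n \<Rightarrow> real"
  assumes S: "(\<lambda>k::real^'n. 1 / (wt k)\<^sup>2) summable_on Zd" and f: "sobolev 1 f"
  shows "L2 (\<lambda>x. (f x)\<^sup>2)" "nsq (\<lambda>x. (f x)\<^sup>2) \<le> 2 * lattice_sum TYPE('n) * (sobolev_sq 1 f)\<^sup>2"
proof -
  let ?B = "2 * lattice_sum TYPE('n) * (sobolev_sq 1 f)\<^sup>2"
  have B0: "0 \<le> ?B" by simp
  have [measurable]: "f \<in> borel_measurable torus" using f by (intro L2_meas sobolev_L2)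
  obtain r :: "nat \<Rightarrow> nat" where r: "strict_mono r" "AE x in torus. (\<lambda>n. proj (r n) f x) \<longlonglongrightarrow> f x"
    using proj_AE_subseq[OF sobolev_L2[OF f]] by blast
  let ?p = "\<lambda>n. proj (r n) f"
  have pm [measurable]: "?p n \<in> borel_measurable torus" for n
    using trig_XN XN_L2 L2_meas by blast
  have pB: "(\<integral>\<^sup>+x. ennreal ((?p n x)^4) \<partial>torus) \<le> ennreal ?B" for n
  proof -
    have int: "integrable torus (\<lambda>x. (?p n x)^4)"
      by (intro integrable_torus_continuous continuous_intros XN_continuous[OF trig_XN])
    have "integral\<^sup>L torus (\<lambda>x. (?p n x)^4) = nsq (\<lambda>x. ?p n x * ?p n x)"
      by (intro Bochner_Integration.integral_cong) (auto simp: power2_eq_square power4_eq_xxxx)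
    also have "\<dots> \<le> 2 * lattice_sum TYPE('n) * (sobolev_sq 1 (?p n))\<^sup>2"
      by (rule nsq_square_XN_le[OF S trig_XN])
    also have "\<dots> \<le> ?B"
      by (intro mult_left_mono power_mono sobolev_sq_proj_le f) auto
    finally show ?thesis
      by (subst nn_integral_eq_integral[OF int]) (auto intro: ennreal_leI)
  qed
  have "(\<integral>\<^sup>+x. ennreal ((f x)^4) \<partial>torus) = (\<integral>\<^sup>+x. liminf (\<lambda>n. ennreal ((?p n x)^4)) \<partial>torus)"
  proof (rule nn_integral_cong_AE)
    show "AE x in torus. ennreal ((f x)^4) = liminf (\<lambda>n. ennreal ((?p n x)^4))"
      using r(2)
    proof eventually_elim
      case (elim x)
      then have "(\<lambda>n. ennreal ((?p n x)^4)) \<longlonglongrightarrow> ennreal ((f x)^4)" by (intro tendsto_intros)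
      from lim_imp_Liminf[OF _ this] show ?case by simp
    qed
  qed
  also have "\<dots> \<le> liminf (\<lambda>n. \<integral>\<^sup>+x. ennreal ((?p n x)^4) \<partial>torus)"
    by (rule nn_integral_liminf) measurable
  also have "\<dots> \<le> ennreal ?B"
    by (intro Liminf_le[THEN order_trans] Limsup_bounded always_eventually allI pB trivial_limit_sequentially) 
       (auto intro!: Liminf_le_Limsup pB)
  finally have le: "(\<integral>\<^sup>+x. ennreal ((f x)^4) \<partial>torus) \<le> ennreal ?B" .
  have int: "integrable torus (\<lambda>x. (f x)^4)"
  proof (rule integrableI_nonneg)
    show "(\<integral>\<^sup>+x. ennreal ((f x)^4) \<partial>torus) < \<infinity>"
      using le_less_trans[OF le ennreal_less_top] by simp
  qed auto
  have eq: "((f x)\<^sup>2)\<^sup>2 = (f x)^4" for x by (simp add: power_mult[symmetric])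
  show "L2 (\<lambda>x. (f x)\<^sup>2)" unfolding L2_alt eq using int by auto
  have "ennreal (integral\<^sup>L torus (\<lambda>x. (f x)^4)) \<le> ennreal ?B"
    using le by (subst (asm) nn_integral_eq_integral[OF int]) auto
  then show "nsq (\<lambda>x. (f x)\<^sup>2) \<le> ?B" unfolding eq using B0 by (simp add: ennreal_le_iff)
qed

lemma integral_abs_mult_le:
  assumes "L2 f" "L2 g"
  shows "integral\<^sup>L torus (\<lambda>x. \<bar>f x * g x\<bar>) \<le> sqrt (nsq f) * sqrt (nsq g)"
  using abs_ip_le[OF L2_abs[OF assms(1)] L2_abs[OF assms(2)]] by (simp add: abs_mult)

text \<open>Products of L^2-convergent sequences converge in L^1, which suffices for each single
  coefficient. Polynomial estimates can then pass to the limit on finite sets of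
  frequencies.\<close>

lemma fcoef_mult_proj_tendsto:
  assumes f: "L2 f" and g: "L2 g"
  shows "(\<lambda>n. fcoef (\<lambda>x. proj n f x * proj n g x) k) \<longlonglongrightarrow> fcoef (\<lambda>x. f x * g x) k"
proof -
  have pf: "L2 (proj n h)" for n and h :: "real^'a \<Rightarrow> real" by (rule XN_L2[OF trig_XN])
  have bound: "cmod (fcoef (\<lambda>x. proj n f x * proj n g x) k - fcoef (\<lambda>x. f x * g x) k)
     \<le> sqrt (nsq f) * sqrt (nsq (\<lambda>x. g x - proj n g x)) + sqrt (nsq (\<lambda>x. f x - proj n f x)) * sqrt (nsq g)" for n
  proof -
    have i1: "integrable torus (\<lambda>x. f x * (g x - proj n g x))"
      and i2: "integrable torus (\<lambda>x. (f x - proj n f x) * proj n g x)"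
      by (intro L2_mult_integrable L2_diff f g pf)+
    have "cmod (fcoef (\<lambda>x. proj n f x * proj n g x) k - fcoef (\<lambda>x. f x * g x) k)
       = cmod (fcoef (\<lambda>x. f x * g x) k - fcoef (\<lambda>x. proj n f x * proj n g x) k)"
      by (rule norm_minus_commute)
    also have "\<dots> = cmod (fcoef (\<lambda>x. f x * g x - proj n f x * proj n g x) k)"
      by (subst fcoef_diff) (auto intro!: L2_mult_integrable f g pf)
    also have "\<dots> \<le> integral\<^sup>L torus (\<lambda>x. \<bar>f x * g x - proj n f x * proj n g x\<bar>)"
      by (rule norm_fcoef_le)
    also have "\<dots> \<le> integral\<^sup>L torus (\<lambda>x. \<bar>f x * (g x - proj n g x)\<bar> + \<bar>(f x - proj n f x) * proj n g x\<bar>)"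
    proof (rule integral_mono)
      show "integrable torus (\<lambda>x. \<bar>f x * g x - proj n f x * proj n g x\<bar>)"
        by (intro integrable_abs Bochner_Integration.integrable_diff L2_mult_integrable f g pf)
      show "integrable torus (\<lambda>x. \<bar>f x * (g x - proj n g x)\<bar> + \<bar>(f x - proj n f x) * proj n g x\<bar>)"
        using i1 i2 by auto
      fix x
      have "f x * g x - proj n f x * proj n g x = f x * (g x - proj n g x) + (f x - proj n f x) * proj n g x"
        by (simp add: algebra_simps)
      then show "\<bar>f x * g x - proj n f x * proj n g x\<bar> \<le> \<bar>f x * (g x - proj n g x)\<bar> + \<bar>(f x - proj n f x) * proj n g x\<bar>"
        by (metis abs_triangle_ineq)
    qed
    also have "\<dots> = integral\<^sup>L torus (\<lambda>x. \<bar>f x * (g x - proj n g x)\<bar>) + integral\<^sup>L torus (\<lambda>x. \<bar>(f x - proj n f x) * proj n g x\<bar>)"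
      using i1 i2 by (intro Bochner_Integration.integral_add) auto
    also have "\<dots> \<le> sqrt (nsq f) * sqrt (nsq (\<lambda>x. g x - proj n g x)) + sqrt (nsq (\<lambda>x. f x - proj n f x)) * sqrt (nsq (proj n g))"
      by (intro add_mono integral_abs_mult_le L2_diff f g pf)
    also have "\<dots> \<le> sqrt (nsq f) * sqrt (nsq (\<lambda>x. g x - proj n g x)) + sqrt (nsq (\<lambda>x. f x - proj n f x)) * sqrt (nsq g)"
      by (intro add_left_mono mult_left_mono real_sqrt_le_mono nsq_proj_le g) auto
    finally show ?thesis .
  qed
  have "(\<lambda>n. sqrt (nsq f) * sqrt (nsq (\<lambda>x. g x - proj n g x)) + sqrt (nsq (\<lambda>x. f x - proj n f x)) * sqrt (nsq g))
     \<longlonglongrightarrow> sqrt (nsq f) * sqrt 0 + sqrt 0 * sqrt (nsq g)"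
    by (intro tendsto_intros proj_tendsto f g)
  then have lim: "(\<lambda>n. sqrt (nsq f) * sqrt (nsq (\<lambda>x. g x - proj n g x)) + sqrt (nsq (\<lambda>x. f x - proj n f x)) * sqrt (nsq g)) \<longlonglongrightarrow> 0"
    by simp
  have "(\<lambda>n. cmod (fcoef (\<lambda>x. proj n f x * proj n g x) k - fcoef (\<lambda>x. f x * g x) k)) \<longlonglongrightarrow> 0"
    by (rule tendsto_sandwich[OF always_eventually always_eventually tendsto_const lim])
       (intro allI bound norm_ge_zero)+
  then show ?thesis by (simp only: tendsto_norm_zero_iff LIM_zero_iff)
qed

lemma
  fixes f g :: "real^'n \<Rightarrow> real"
  assumes S: "(\<lambda>k::real^'n. 1 / (wt k)\<^sup>2) summable_on Zd" and f: "sobolev 2 f" and g: "sobolev 2 g"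
  shows sobolev_mult: "sobolev 2 (\<lambda>x. f x * g x)"
    and sobolev_sq_mult_le: "sobolev_sq 2 (\<lambda>x. f x * g x) \<le> 16 * lattice_sum TYPE('n) * (sobolev_sq 2 f * sobolev_sq 2 g)"
proof -
  have f1: "sobolev 1 f" and g1: "sobolev 1 g" using f g sobolev_mono by fastforce+
  have fg: "L2 (\<lambda>x. f x * g x)"
    using L2_mult_integrable[OF L4_embedding(1)[OF S f1] L4_embedding(1)[OF S g1]] L2_meas[OF sobolev_L2[OF f]] L2_meas[OF sobolev_L2[OF g]]
    by (simp add: L2_alt power_mult_distrib)
  have "(\<Sum>k\<in>F. wt k ^ 2 * (cmod (fcoef (\<lambda>x. f x * g x) k))\<^sup>2) \<le> 16 * lattice_sum TYPE('n) * (sobolev_sq 2 f * sobolev_sq 2 g)"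
    if F: "finite F" "F \<subseteq> Zd" for F
  proof (rule LIMSEQ_le_const2)
    show "(\<lambda>n. \<Sum>k\<in>F. wt k ^ 2 * (cmod (fcoef (\<lambda>x. proj n f x * proj n g x) k))\<^sup>2) \<longlonglongrightarrow> (\<Sum>k\<in>F. wt k ^ 2 * (cmod (fcoef (\<lambda>x. f x * g x) k))\<^sup>2)"
      by (intro tendsto_intros fcoef_mult_proj_tendsto sobolev_L2[OF f] sobolev_L2[OF g])
    show "\<exists>N. \<forall>n\<ge>N. (\<Sum>k\<in>F. wt k ^ 2 * (cmod (fcoef (\<lambda>x. proj n f x * proj n g x) k))\<^sup>2) \<le> 16 * lattice_sum TYPE('n) * (sobolev_sq 2 f * sobolev_sq 2 g)"
    proof (intro exI allI impI)
      fix n :: nat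
      have "(\<Sum>k\<in>F. wt k ^ 2 * (cmod (fcoef (\<lambda>x. proj n f x * proj n g x) k))\<^sup>2) \<le> sobolev_sq 2 (\<lambda>x. proj n f x * proj n g x)"
        by (intro sum_le_sobolev_sq[OF sobolev_XN[OF XN_mult[OF trig_XN trig_XN]]] F)
      also have "\<dots> \<le> 16 * lattice_sum TYPE('n) * (sobolev_sq 2 (proj n g) * sobolev_sq 2 (proj n f))"
        by (rule sobolev_sq_mult_XN_le[OF S trig_XN trig_XN])
      also have "\<dots> \<le> 16 * lattice_sum TYPE('n) * (sobolev_sq 2 g * sobolev_sq 2 f)"
        by (intro mult_left_mono mult_mono sobolev_sq_proj_le f g) auto
      finally show "(\<Sum>k\<in>F. wt k ^ 2 * (cmod (fcoef (\<lambda>x. proj n f x * proj n g x) k))\<^sup>2) \<le> 16 * lattice_sum TYPE('n) * (sobolev_sq 2 f * sobolev_sq 2 g)"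
        by (simp add: mult_ac)
    qed
  qed
  from hregI[OF fg this] show "sobolev 2 (\<lambda>x. f x * g x)"
    "sobolev_sq 2 (\<lambda>x. f x * g x) \<le> 16 * lattice_sum TYPE('n) * (sobolev_sq 2 f * sobolev_sq 2 g)" by auto
qed

lemma hreg2_bounded:
  fixes f :: "real^'n \<Rightarrow> real"
  assumes S: "(\<lambda>k::real^'n. 1 / (wt k)\<^sup>2) summable_on Zd" and f: "sobolev 2 f"
  shows "AE x in torus. \<bar>f x\<bar> \<le> sqrt (lattice_sum TYPE('n) * sobolev_sq 2 f)"
proof -
  obtain r :: "nat \<Rightarrow> nat" where r: "AE x in torus. (\<lambda>n. proj (r n) f x) \<longlonglongrightarrow> f x"
    using proj_AE_subseq[OF sobolev_L2[OF f]] by blast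
  then show ?thesis
  proof eventually_elim
    case (elim x)
    have "(f x)\<^sup>2 \<le> lattice_sum TYPE('n) * sobolev_sq 2 f"
    proof (rule LIMSEQ_le_const2)
      show "(\<lambda>n. (proj (r n) f x)\<^sup>2) \<longlonglongrightarrow> (f x)\<^sup>2" by (intro tendsto_intros elim)
      have "(proj (r n) f x)\<^sup>2 \<le> lattice_sum TYPE('n) * sobolev_sq 2 f" for n
        using sup_XN_le[OF S trig_XN[of "r n" "fcoef f"], of x]
          mult_left_mono[OF sobolev_sq_proj_le[OF f, of "r n"], of "lattice_sum TYPE('n)"] by simp
      then show "\<exists>N. \<forall>n\<ge>N. (proj (r n) f x)\<^sup>2 \<le> lattice_sum TYPE('n) * sobolev_sq 2 f" by blast
    qed
    then show ?case by (rule real_le_rsqrt[OF _, of "\<bar>f x\<bar>", simplified])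
  qed
qed

text \<open>The last bound plays the zero mode off against the sum of all others and holds at every
  point; it later bounds an iterate of the resolvent from below.\<close>

lemma absolutely_convergent_series:
  fixes c :: "real^'n \<Rightarrow> complex"
  assumes c: "(\<lambda>k. cmod (c k)) summable_on Zd" and sym: "\<And>k. c (- k) = cnj (c k)"
  obtains v where "L2 v" "\<And>k. k \<in> Zd \<Longrightarrow> fcoef v k = c k"
    "\<And>x. v x \<ge> Re (c 0) - infsum (\<lambda>k. cmod (c k)) (Zd - {0})"
proof -
  define v where "v = (\<lambda>x. Re (infsum (\<lambda>k. c k * cis (2 * pi * (k \<bullet> x))) Zd))"
  define A where "A = infsum (\<lambda>k. cmod (c k)) Zd"
  have sm: "(\<lambda>k. c k * cis (2 * pi * (k \<bullet> x))) summable_on Zd" for x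
    by (rule abs_summable_summable) (use c in \<open>simp add: norm_mult\<close>)
  have lim: "(\<lambda>N. trig N c x) \<longlonglongrightarrow> v x" for x
    unfolding trig_def v_def by (intro tendsto_Re has_sum_KN_tendsto has_sum_infsum sm)
  have tm [measurable]: "trig N c \<in> borel_measurable torus" for N using trig_XN XN_L2 L2_meas by blast
  have vm [measurable]: "v \<in> borel_measurable torus"
    by (rule borel_measurable_LIMSEQ_real[OF _ tm]) (rule lim)
  have tA: "\<bar>trig N c x\<bar> \<le> A" for N x
  proof -
    have "\<bar>trig N c x\<bar> \<le> cmod (\<Sum>k\<in>KN N. c k * cis (2 * pi * (k \<bullet> x)))"
      unfolding trig_def by (rule abs_Re_le_cmod)
    also have "\<dots> \<le> (\<Sum>k\<in>KN N. cmod (c k))" by (rule order_trans[OF norm_sum]) (simp add: norm_mult)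
    also have "\<dots> \<le> A" unfolding A_def by (intro finite_sum_le_infsum c KN_subset_Zd) auto
    finally show ?thesis .
  qed
  have vA: "\<bar>v x\<bar> \<le> A" for x
    by (rule LIMSEQ_le_const2[OF tendsto_rabs[OF lim]]) (auto intro: tA)
  have L2v: "L2 v" by (rule L2_bounded[OF vm, of A]) (auto intro: vA)
  have coef: "fcoef v k = c k" if k: "k \<in> Zd" for k
  proof (rule LIMSEQ_unique)
    have "(\<lambda>N. integral\<^sup>L torus (\<lambda>x. complex_of_real (trig N c x) * cis (- (2 * pi * (k \<bullet> x)))))
       \<longlonglongrightarrow> integral\<^sup>L torus (\<lambda>x. complex_of_real (v x) * cis (- (2 * pi * (k \<bullet> x))))"
    proof (rule integral_dominated_convergence[where w="\<lambda>x. A"])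
      have [measurable]: "(\<lambda>x. cis (- (2 * pi * (k \<bullet> x)))) \<in> borel_measurable torus"
        by (intro continuous_measurable_torus continuous_intros)
      show "(\<lambda>x. complex_of_real (v x) * cis (- (2 * pi * (k \<bullet> x)))) \<in> borel_measurable torus"
        "\<And>N. (\<lambda>x. complex_of_real (trig N c x) * cis (- (2 * pi * (k \<bullet> x)))) \<in> borel_measurable torus"
        by measurable
      show "AE x in torus. (\<lambda>N. complex_of_real (trig N c x) * cis (- (2 * pi * (k \<bullet> x)))) \<longlonglongrightarrow> complex_of_real (v x) * cis (- (2 * pi * (k \<bullet> x)))"
        by (intro always_eventually allI tendsto_intros lim)
    qed (auto simp: norm_mult tA)
    then show "(\<lambda>N. fcoef (trig N c) k) \<longlonglongrightarrow> fcoef v k" by (simp add: fcoef_torus)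
    obtain M where "{k} \<subseteq> KN M" using finite_subset_KN[of "{k}"] k by auto
    then have "\<forall>N\<ge>M. fcoef (trig N c) k = c k"
      using KN_mono fcoef_trig_poly[of _ c k] sym k by (metis insert_subset subsetD)
    then show "(\<lambda>N. fcoef (trig N c) k) \<longlonglongrightarrow> c k"
      by (intro tendsto_eventually) (auto simp: eventually_sequentially)
  qed
  have low: "v x \<ge> Re (c 0) - infsum (\<lambda>k. cmod (c k)) (Zd - {0})" for x
  proof (rule LIMSEQ_le_const[OF lim])
    have "trig N c x \<ge> Re (c 0) - infsum (\<lambda>k. cmod (c k)) (Zd - {0})" for N
    proof -
      have c': "(\<lambda>k. cmod (c k)) summable_on (Zd - {0})"
        by (rule summable_on_subset_banach[OF c]) auto
      have "trig N c x = Re (c 0) + Re (\<Sum>k\<in>KN N - {0}. c k * cis (2 * pi * (k \<bullet> x)))"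
        unfolding trig_def by (subst sum.remove[of _ 0]) auto
      moreover have "\<bar>Re (\<Sum>k\<in>KN N - {0}. c k * cis (2 * pi * (k \<bullet> x)))\<bar> \<le> (\<Sum>k\<in>KN N - {0}. cmod (c k))"
        by (rule order_trans[OF abs_Re_le_cmod], rule order_trans[OF norm_sum]) (simp add: norm_mult)
      moreover have "(\<Sum>k\<in>KN N - {0}. cmod (c k)) \<le> infsum (\<lambda>k. cmod (c k)) (Zd - {0})"
        using KN_subset_Zd[of N] by (intro finite_sum_le_infsum c') auto
      ultimately show ?thesis by linarith
    qed
    then show "\<exists>N. \<forall>n\<ge>N. Re (c 0) - infsum (\<lambda>k. cmod (c k)) (Zd - {0}) \<le> trig n c x" by blast
  qed
  show ?thesis using that[OF L2v coef low] by blast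
qed

subsection \<open>The Dirichlet form\<close>

definition dirichlet :: "(real^'n \<Rightarrow> real) \<Rightarrow> (real^'n \<Rightarrow> real) \<Rightarrow> real" where
  "dirichlet f g = infsum (\<lambda>k. kap k * Re (fcoef f k * cnj (fcoef g k))) Zd"

text \<open>Only the total order a + b counts. Besides the pair (1, 1), the pair (0, 2) occurs: in
  Picone's identity one argument is merely square integrable while u is in H^2.\<close>

lemma dirichlet_abs_summable:
  assumes f: "sobolev a f" and g: "sobolev b g" and ab: "2 \<le> a + b"
  shows "(\<lambda>k. wt k * (cmod (fcoef f k) * cmod (fcoef g k))) summable_on Zd"
proof (rule summable_on_comparison_real)
  show "(\<lambda>k. wt k ^ a * (cmod (fcoef f k))\<^sup>2 + wt k ^ b * (cmod (fcoef g k))\<^sup>2) summable_on Zd"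
    by (intro summable_on_add sobolev_summable f g)
  fix k
  let ?X = "wt k ^ a * (cmod (fcoef f k))\<^sup>2" and ?Y = "wt k ^ b * (cmod (fcoef g k))\<^sup>2"
  have "(wt k * (cmod (fcoef f k) * cmod (fcoef g k)))\<^sup>2 = wt k ^ 2 * ((cmod (fcoef f k))\<^sup>2 * (cmod (fcoef g k))\<^sup>2)"
    by (simp add: power_mult_distrib)
  also have "\<dots> \<le> wt k ^ (a + b) * ((cmod (fcoef f k))\<^sup>2 * (cmod (fcoef g k))\<^sup>2)"
    using ab by (intro mult_right_mono power_increasing) auto
  also have "\<dots> = ?X * ?Y" by (simp add: power_add)
  also have "\<dots> \<le> (?X + ?Y)\<^sup>2"
  proof -
    have *: "x * y \<le> (x + y)\<^sup>2" if "0 \<le> x" "0 \<le> y" for x y :: real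
      using that mult_nonneg_nonneg[OF that] by (simp add: power2_sum)
    show ?thesis by (rule *) auto
  qed
  finally show "wt k * (cmod (fcoef f k) * cmod (fcoef g k)) \<le> ?X + ?Y"
    by (rule power2_le_imp_le) auto
qed auto

lemma dirichlet_has_sum:
  assumes f: "sobolev a f" and g: "sobolev b g" and ab: "2 \<le> a + b"
  shows "((\<lambda>k. kap k * Re (fcoef f k * cnj (fcoef g k))) has_sum dirichlet f g) Zd"
  unfolding dirichlet_def
proof (rule has_sum_infsum, rule abs_summable_summable, rule summable_on_comparison_real[OF dirichlet_abs_summable[OF assms]])
  fix k
  have "\<bar>Re (fcoef f k * cnj (fcoef g k))\<bar> \<le> cmod (fcoef f k) * cmod (fcoef g k)"
    using abs_Re_le_cmod[of "fcoef f k * cnj (fcoef g k)"] by (simp add: norm_mult)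
  then show "norm (kap k * Re (fcoef f k * cnj (fcoef g k))) \<le> wt k * (cmod (fcoef f k) * cmod (fcoef g k))"
    unfolding real_norm_def abs_mult by (intro mult_mono) (auto simp: wt_def)
qed auto

lemma dirichlet_commute: "dirichlet f g = dirichlet g f"
  unfolding dirichlet_def by (intro infsum_cong) (simp add: mult.commute)

lemma dirichlet_add_scale:
  assumes f: "sobolev 1 f" and g: "sobolev 1 g" and h: "sobolev 1 h"
  shows "dirichlet (\<lambda>x. f x + t * g x) h = dirichlet f h + t * dirichlet g h"
proof -
  have "((\<lambda>k. kap k * Re (fcoef f k * cnj (fcoef h k)) + t * (kap k * Re (fcoef g k * cnj (fcoef h k)))) has_sum (dirichlet f h + t * dirichlet g h)) Zd"
    by (intro has_sum_add has_sum_cmult_right dirichlet_has_sum[OF f h] dirichlet_has_sum[OF g h]) auto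
  moreover have "kap k * Re (fcoef (\<lambda>x. f x + t * g x) k * cnj (fcoef h k)) = kap k * Re (fcoef f k * cnj (fcoef h k)) + t * (kap k * Re (fcoef g k * cnj (fcoef h k)))" for k
    by (subst fcoef_add) (auto simp: fcoef_cmult algebra_simps intro!: L2_integrable sobolev_L2[OF f] L2_cmult sobolev_L2[OF g])
  ultimately show ?thesis unfolding dirichlet_def by (intro infsumI) simp
qed

lemma dirichlet_add_scale2:
  assumes "sobolev 1 f" "sobolev 1 g" "sobolev 1 h"
  shows "dirichlet h (\<lambda>x. f x + t * g x) = dirichlet h f + t * dirichlet h g"
  using dirichlet_add_scale[OF assms] by (simp only: dirichlet_commute[of h])

lemma grad_sq_dirichlet: "grad_sq f = dirichlet f f"
  unfolding grad_sq_def dirichlet_def kap_def by (simp only: Re_mult_cnj_self)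

lemma sobolev_sq_1: "sobolev 1 f \<Longrightarrow> sobolev_sq 1 f = nsq f + dirichlet f f"
proof -
  assume f: "sobolev 1 f"
  have "((\<lambda>k. (cmod (fcoef f k))\<^sup>2 + kap k * Re (fcoef f k * cnj (fcoef f k))) has_sum (nsq f + dirichlet f f)) Zd"
    by (intro has_sum_add Parseval sobolev_L2[OF f] dirichlet_has_sum[OF f f]) auto
  moreover have "(cmod (fcoef f k))\<^sup>2 + kap k * Re (fcoef f k * cnj (fcoef f k)) = wt k ^ 1 * (cmod (fcoef f k))\<^sup>2" for k
    unfolding Re_mult_cnj_self by (simp add: wt_def algebra_simps)
  ultimately show ?thesis unfolding sobolev_sq_def by (intro infsumI) simp
qed

lemma dirichlet_nonneg: "0 \<le> dirichlet f f"
  unfolding dirichlet_def Re_mult_cnj_self by (intro infsum_nonneg) auto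

lemma dirichlet_XN:
  assumes "p \<in> XN N"
  shows "dirichlet f p = (\<Sum>k\<in>KN N. kap k * Re (fcoef f k * cnj (fcoef p k)))"
proof -
  have "((\<lambda>k. kap k * Re (fcoef f k * cnj (fcoef p k))) has_sum (\<Sum>k\<in>KN N. kap k * Re (fcoef f k * cnj (fcoef p k)))) Zd"
    by (rule has_sum_finite_neutralI) (use KN_subset_Zd fcoef_XN_outside[OF assms] in auto)
  then show ?thesis unfolding dirichlet_def by (rule infsumI)
qed

text \<open>The X inner product is diagonal in the plane waves, so its orthogonal projection is
  plain truncation. Uniqueness follows by testing with the difference of the two candidates.\<close>

lemma PiN_eq_proj:
  assumes u: "L2 u"
  shows "PiN N u = proj N u"
  unfolding PiN_def
proof (rule the_equality)
  have coef: "fcoef (\<lambda>x. u x - p x) k = fcoef u k - fcoef p k" if "p \<in> XN N" for p k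
    by (intro fcoef_diff L2_integrable u XN_integrable[OF that])
  have inner: "inner_X (\<lambda>x. u x - p x) v = (\<Sum>k\<in>KN N. wt k * Re ((fcoef u k - fcoef p k) * cnj (fcoef v k)))"
    if "p \<in> XN N" "v \<in> XN N" for p v
  proof -
    have "((\<lambda>k. wt k * Re ((fcoef u k - fcoef p k) * cnj (fcoef v k))) has_sum (\<Sum>k\<in>KN N. wt k * Re ((fcoef u k - fcoef p k) * cnj (fcoef v k)))) Zd"
      by (rule has_sum_finite_neutralI) (use KN_subset_Zd fcoef_XN_outside[OF that(2)] in auto)
    then show ?thesis unfolding inner_X_def Hs_weight_1 coef[OF that(1)] by (rule infsumI)
  qed
  have pr: "fcoef (proj N u) k = fcoef u k" if "k \<in> KN N" for k
    using that by (simp add: fcoef_proj KN_def)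
  show "proj N u \<in> XN N \<and> (\<forall>v\<in>XN N. inner_X (\<lambda>x. u x - proj N u x) v = 0)"
    by (auto simp: trig_XN inner pr)
  fix p assume p: "p \<in> XN N \<and> (\<forall>v\<in>XN N. inner_X (\<lambda>x. u x - p x) v = 0)"
  define v where "v = (\<lambda>x. proj N u x - p x)"
  have v: "v \<in> XN N" unfolding v_def using p by (intro XN_diff trig_XN) auto
  have vc: "fcoef v k = fcoef u k - fcoef p k" if "k \<in> KN N" for k
    unfolding v_def using p that
    by (subst fcoef_diff) (auto intro: XN_integrable trig_XN simp: pr)
  have "0 = inner_X (\<lambda>x. u x - p x) v" using p v by simp
  also have "\<dots> = (\<Sum>k\<in>KN N. wt k * (cmod (fcoef u k - fcoef p k))\<^sup>2)"
    using p v by (subst inner) (simp_all add: vc Re_mult_cnj_self del: complex_cnj_diff times_complex.sel cong: sum.cong)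
  finally have "\<forall>k\<in>KN N. wt k * (cmod (fcoef u k - fcoef p k))\<^sup>2 = 0"
    by (subst (asm) eq_commute, subst (asm) sum_nonneg_eq_0_iff) auto
  then have "fcoef p k = fcoef (proj N u) k" if "k \<in> KN N" for k using that pr by auto
  then show "p = proj N u" using p by (intro XN_eqI[of _ N]) (auto simp: trig_XN)
qed

subsection \<open>A positive kernel approximating the Laplacian\<close>

text \<open>The Fourier coefficients of an even power 2 n of the cosine, divided by the central one
  so that the zero mode is 1.\<close>

definition kernel_ratio :: "nat \<Rightarrow> nat \<Rightarrow> real" where
  "kernel_ratio n j = real ((2 * n) choose (n + j)) / real ((2 * n) choose n)"

lemma choose_Suc_mult: "Suc k * (N choose Suc k) = (N - k) * (N choose k)"
proof (cases N)
  case (Suc M)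
  then show ?thesis
    using Suc_times_binomial[of k M] binomial_absorb_comp[of N k] by simp
qed simp

lemma kernel_ratio_nonneg: "0 \<le> kernel_ratio n j" by (simp add: kernel_ratio_def)

lemma kernel_ratio_le_1: "kernel_ratio n j \<le> 1"
  using binomial_maximum'[of n "n + j"] by (simp add: kernel_ratio_def divide_le_eq)

lemma kernel_ratio_0 [simp]: "kernel_ratio n 0 = 1" by (simp add: kernel_ratio_def)

lemma kernel_ratio_outside: "n < j \<Longrightarrow> kernel_ratio n j = 0" by (simp add: kernel_ratio_def)

lemma kernel_ratio_Suc: "kernel_ratio n (Suc j) * (real n + real j + 1) = kernel_ratio n j * (real n - real j)"
proof -
  have "real (Suc (n + j) * ((2 * n) choose Suc (n + j))) = real ((2 * n - (n + j)) * ((2 * n) choose (n + j)))"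
    by (subst choose_Suc_mult) simp
  also have "\<dots> = (real n - real j) * real ((2 * n) choose (n + j))"
    by (cases "j \<le> n") (auto simp: of_nat_diff)
  finally have "(real n + real j + 1) * real ((2 * n) choose (n + Suc j)) = (real n - real j) * real ((2 * n) choose (n + j))"
    by (simp add: algebra_simps)
  then have "(real n + real j + 1) * real ((2 * n) choose (n + Suc j)) / real ((2 * n) choose n) = (real n - real j) * real ((2 * n) choose (n + j)) / real ((2 * n) choose n)"
    by simp
  then show ?thesis by (simp add: kernel_ratio_def mult.commute)
qed

text \<open>Passing from j to j + 1 adds about (2 j + 1) / n to the defect. These odd numbers add up
  to j^2, which gives both the bound and the limit below by induction on j.\<close>

lemma kernel_ratio_Suc_diff: "1 - kernel_ratio n (Suc j) = (1 - kernel_ratio n j) + kernel_ratio n j * ((2 * real j + 1) / (real n + real j + 1))"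
proof -
  have pos: "real n + real j + 1 > 0" by simp
  have "kernel_ratio n (Suc j) = kernel_ratio n j * (real n - real j) / (real n + real j + 1)"
    using kernel_ratio_Suc[of n j] pos by (simp add: field_simps)
  also have "\<dots> = kernel_ratio n j - kernel_ratio n j * ((2 * real j + 1) / (real n + real j + 1))"
    using pos by (simp add: field_simps)
  finally show ?thesis by simp
qed

lemma kernel_ratio_bound: "real n * (1 - kernel_ratio n j) \<le> (real j)\<^sup>2"
proof (induction j)
  case (Suc j)
  have "kernel_ratio n j * (real n * (2 * real j + 1) / (real n + real j + 1)) \<le> 1 * (2 * real j + 1)"
    by (intro mult_mono kernel_ratio_le_1) (auto simp: divide_le_eq algebra_simps)
  then have "real n * (1 - kernel_ratio n (Suc j)) \<le> (real j)\<^sup>2 + (2 * real j + 1)"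
    using Suc unfolding kernel_ratio_Suc_diff by (simp add: algebra_simps)
  then show ?case by (simp add: power2_eq_square algebra_simps)
qed simp

lemma kernel_ratio_tendsto: "(\<lambda>n. real n * (1 - kernel_ratio n j)) \<longlonglongrightarrow> (real j)\<^sup>2"
proof (induction j)
  case (Suc j)
  have "(\<lambda>n. inverse (real n) * (real n * (1 - kernel_ratio n j))) \<longlonglongrightarrow> 0 * (real j)\<^sup>2"
    by (intro tendsto_mult Suc lim_inverse_n)
  then have "(\<lambda>n. 1 - kernel_ratio n j) \<longlonglongrightarrow> 0 * (real j)\<^sup>2"
    by (rule Lim_transform_eventually)
       (rule eventually_mono[OF eventually_gt_at_top[of 0]], simp)
  from tendsto_diff[OF tendsto_const[of 1] this] have kr1: "(\<lambda>n. kernel_ratio n j) \<longlonglongrightarrow> 1" by simp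
  have "(\<lambda>n. inverse (real n) * (real j + 1)) \<longlonglongrightarrow> 0 * (real j + 1)"
    by (intro tendsto_mult lim_inverse_n tendsto_const)
  then have "(\<lambda>n. (2 * real j + 1) / (1 + inverse (real n) * (real j + 1))) \<longlonglongrightarrow> (2 * real j + 1) / (1 + 0 * (real j + 1))"
    by (intro tendsto_intros) auto
  then have "(\<lambda>n. real n * ((2 * real j + 1) / (real n + real j + 1))) \<longlonglongrightarrow> (2 * real j + 1) / (1 + 0 * (real j + 1))"
  proof (rule Lim_transform_eventually)
    show "\<forall>\<^sub>F n in sequentially. (2 * real j + 1) / (1 + inverse (real n) * (real j + 1)) = real n * ((2 * real j + 1) / (real n + real j + 1))"
      using eventually_gt_at_top[of 0]
    proof eventually_elim
      case (elim n)
      then have "1 + inverse (real n) * (real j + 1) = (real n + real j + 1) / real n"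
        by (simp add: field_simps)
      then show ?case by simp
    qed
  qed
  then have "(\<lambda>n. real n * (1 - kernel_ratio n j) + kernel_ratio n j * (real n * ((2 * real j + 1) / (real n + real j + 1)))) \<longlonglongrightarrow> (real j)\<^sup>2 + 1 * ((2 * real j + 1) / (1 + 0 * (real j + 1)))"
    by (intro tendsto_add tendsto_mult Suc kr1)
  moreover have "real n * (1 - kernel_ratio n j) + kernel_ratio n j * (real n * ((2 * real j + 1) / (real n + real j + 1))) = real n * (1 - kernel_ratio n (Suc j))" for n
    unfolding kernel_ratio_Suc_diff by (simp add: algebra_simps)
  moreover have "(real j)\<^sup>2 + 1 * ((2 * real j + 1) / (1 + 0 * (real j + 1))) = (real (Suc j))\<^sup>2"
    by (simp add: power2_eq_square algebra_simps)
  ultimately show ?case by simp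
qed simp

lemma one_plus_cis: "1 + cis \<theta> = cis (\<theta> / 2) * of_real (2 * cos (\<theta> / 2))"
proof -
  have "cis (\<theta>/2) * (cis (\<theta>/2) + cis (- (\<theta>/2))) = cis \<theta> + 1"
    unfolding ring_distribs cis_mult by simp
  moreover have "cis (\<theta>/2) + cis (- (\<theta>/2)) = of_real (2 * cos (\<theta> / 2))"
    by (simp add: complex_eq_iff)
  ultimately show ?thesis by simp
qed

text \<open>The binomial theorem for (1 + cis \<theta>)^(2 n), recentred by n; the right-hand side
  is an even power, hence nonnegative.\<close>

lemma kernel_ratio_cos_power:
  "(\<Sum>m\<in>{- int n..int n}. complex_of_real (kernel_ratio n (nat \<bar>m\<bar>)) * cis (real_of_int m * \<theta>))
    = of_real ((2 * cos (\<theta> / 2)) ^ (2 * n) / real ((2 * n) choose n))"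
proof -
  have "(\<Sum>m\<in>{- int n..int n}. complex_of_real (kernel_ratio n (nat \<bar>m\<bar>)) * cis (real_of_int m * \<theta>))
     = (\<Sum>j\<le>2 * n. of_real (real ((2 * n) choose j) / real ((2 * n) choose n)) * cis ((real j - real n) * \<theta>))"
  proof (rule sum.reindex_bij_witness[where i="\<lambda>j. int j - int n" and j="\<lambda>m. nat (m + int n)"])
    fix m assume m: "m \<in> {- int n..int n}"
    have "(2 * n) choose (nat (m + int n)) = (2 * n) choose (n + nat \<bar>m\<bar>)"
    proof (cases "m \<ge> 0")
      case True
      then show ?thesis by (simp add: nat_add_distrib add.commute)
    next
      case False
      have "(2 * n) choose (nat (m + int n)) = (2 * n) choose (2 * n - nat (m + int n))"
        using m by (intro binomial_symmetric) auto
      also have "2 * n - nat (m + int n) = n + nat \<bar>m\<bar>" using m False by auto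
      finally show ?thesis .
    qed
    moreover have "real (nat (m + int n)) - real n = real_of_int m" using m by simp
    ultimately show "of_real (real ((2 * n) choose (nat (m + int n))) / real ((2 * n) choose n)) * cis ((real (nat (m + int n)) - real n) * \<theta>)
        = complex_of_real (kernel_ratio n (nat \<bar>m\<bar>)) * cis (real_of_int m * \<theta>)"
      unfolding kernel_ratio_def by (simp only:)
  qed auto
  also have "\<dots> = (\<Sum>j\<le>2 * n. of_real (1 / real ((2 * n) choose n)) * cis (- (real n * \<theta>)) * (of_nat ((2 * n) choose j) * cis \<theta> ^ j * 1 ^ (2 * n - j)))"
  proof (intro sum.cong refl)
    fix j
    have "cis ((real j - real n) * \<theta>) = cis (- (real n * \<theta>)) * cis \<theta> ^ j"
    proof -
      have "(real j - real n) * \<theta> = - (real n * \<theta>) + real j * \<theta>" by (simp add: algebra_simps)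
      then show ?thesis by (simp only: Complex.DeMoivre cis_mult)
    qed
    then show "of_real (real ((2 * n) choose j) / real ((2 * n) choose n)) * cis ((real j - real n) * \<theta>)
       = of_real (1 / real ((2 * n) choose n)) * cis (- (real n * \<theta>)) * (of_nat ((2 * n) choose j) * cis \<theta> ^ j * 1 ^ (2 * n - j))"
      by simp
  qed
  also have "\<dots> = of_real (1 / real ((2 * n) choose n)) * cis (- (real n * \<theta>)) * (cis \<theta> + 1) ^ (2 * n)"
    unfolding binomial_ring sum_distrib_left ..
  also have "cis \<theta> + 1 = cis (\<theta> / 2) * of_real (2 * cos (\<theta> / 2))"
    using one_plus_cis[of \<theta>] by (simp add: add.commute)
  also have "(cis (\<theta> / 2) * of_real (2 * cos (\<theta> / 2))) ^ (2 * n) = cis (real n * \<theta>) * of_real ((2 * cos (\<theta> / 2)) ^ (2 * n))"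
    unfolding power_mult_distrib Complex.DeMoivre by simp
  also have "of_real (1 / real ((2 * n) choose n)) * cis (- (real n * \<theta>)) * (cis (real n * \<theta>) * of_real ((2 * cos (\<theta> / 2)) ^ (2 * n)))
    = of_real (1 / real ((2 * n) choose n)) * (cis (- (real n * \<theta>)) * cis (real n * \<theta>)) * of_real ((2 * cos (\<theta> / 2)) ^ (2 * n))"
    by (simp only: mult_ac)
  also have "\<dots> = of_real ((2 * cos (\<theta> / 2)) ^ (2 * n) / real ((2 * n) choose n))"
    by (simp add: cis_mult)
  finally show ?thesis .
qed

text \<open>The floor only turns an integer coordinate, stored as a real, into a natural
  number.\<close>

definition kernel_coef :: "nat \<Rightarrow> real^'n \<Rightarrow> real" where
  "kernel_coef n k = (\<Prod>i\<in>UNIV. kernel_ratio n (nat \<lfloor>\<bar>k $ i\<bar>\<rfloor>))"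

lemma kernel_coef_le_1: "kernel_coef n k \<le> 1" unfolding kernel_coef_def by (intro prod_le_1) (auto intro: kernel_ratio_nonneg kernel_ratio_le_1)
lemma kernel_coef_0 [simp]: "kernel_coef n 0 = 1" unfolding kernel_coef_def by simp

lemma Zd_nat_abs: "k \<in> Zd \<Longrightarrow> real (nat \<lfloor>\<bar>k $ i\<bar>\<rfloor>) = \<bar>k $ i\<bar>"
proof -
  assume "k \<in> Zd"
  then obtain m where "k $ i = of_int m" by (auto simp: Zd_def elim: Ints_cases)
  then show ?thesis by simp
qed

lemma kernel_coef_outside:
  assumes "k \<in> Zd" "k \<notin> lattice_box n" shows "kernel_coef n k = 0"
proof -
  obtain i where "\<bar>k $ i\<bar> > real n" using assms by (auto simp: lattice_box_def not_le)
  then have "n < nat \<lfloor>\<bar>k $ i\<bar>\<rfloor>" using Zd_nat_abs[OF assms(1), of i] by linarith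
  then show ?thesis unfolding kernel_coef_def by (intro prod_zero) (auto intro!: exI[of _ i] kernel_ratio_outside)
qed

lemma one_minus_prod_le:
  fixes a :: "'i \<Rightarrow> real"
  assumes "finite I" "\<And>i. i \<in> I \<Longrightarrow> 0 \<le> a i \<and> a i \<le> 1"
  shows "1 - (\<Prod>i\<in>I. a i) \<le> (\<Sum>i\<in>I. 1 - a i)"
  using assms
proof (induction rule: finite_induct)
  case (insert x F)
  have "0 \<le> (\<Prod>i\<in>F. a i)" "(\<Prod>i\<in>F. a i) \<le> 1" using insert by (auto intro!: prod_nonneg prod_le_1)
  moreover have "0 \<le> a x" "a x \<le> 1" using insert by auto
  ultimately have "(1 - a x) * (1 - (\<Prod>i\<in>F. a i)) \<ge> 0" by simp
  then show ?case using insert by (simp add: algebra_simps)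
qed simp

lemma norm_sq_sum: "(norm (k::real^'n))\<^sup>2 = (\<Sum>i\<in>UNIV. (k $ i)\<^sup>2)"
  by (simp add: norm_vec_def L2_set_def sum_nonneg)

lemma kernel_coef_bound:
  assumes "k \<in> Zd" shows "real n * (1 - kernel_coef n k) \<le> (norm k)\<^sup>2"
proof -
  have "real n * (1 - kernel_coef n k) \<le> real n * (\<Sum>i\<in>UNIV. 1 - kernel_ratio n (nat \<lfloor>\<bar>k $ i\<bar>\<rfloor>))"
    unfolding kernel_coef_def by (intro mult_left_mono one_minus_prod_le) (auto intro: kernel_ratio_nonneg kernel_ratio_le_1)
  also have "\<dots> \<le> (\<Sum>i\<in>UNIV. (k $ i)\<^sup>2)"
    unfolding sum_distrib_left
    by (intro sum_mono) (use kernel_ratio_bound Zd_nat_abs[OF assms] in \<open>metis power2_abs\<close>)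
  finally show ?thesis by (simp add: norm_sq_sum)
qed

text \<open>From 1 - a b = (1 - a) + (1 - b) - (1 - a) (1 - b): after multiplication by n the last
  term is 1/n times a convergent product.\<close>

lemma prod_defect_tendsto:
  fixes a :: "nat \<Rightarrow> 'i \<Rightarrow> real"
  assumes "finite I" "\<And>i. i \<in> I \<Longrightarrow> (\<lambda>n. real n * (1 - a n i)) \<longlonglongrightarrow> b i"
  shows "(\<lambda>n. real n * (1 - (\<Prod>i\<in>I. a n i))) \<longlonglongrightarrow> (\<Sum>i\<in>I. b i)"
  using assms
proof (induction rule: finite_induct)
  case (insert x F)
  have A: "(\<lambda>n. real n * (1 - a n x)) \<longlonglongrightarrow> b x" using insert by auto
  have B: "(\<lambda>n. real n * (1 - (\<Prod>i\<in>F. a n i))) \<longlonglongrightarrow> (\<Sum>i\<in>F. b i)" using insert by auto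
  have "(\<lambda>n. real n * (1 - a n x) + real n * (1 - (\<Prod>i\<in>F. a n i)) - inverse (real n) * ((real n * (1 - a n x)) * (real n * (1 - (\<Prod>i\<in>F. a n i))))) \<longlonglongrightarrow> b x + (\<Sum>i\<in>F. b i) - 0 * (b x * (\<Sum>i\<in>F. b i))"
    by (intro tendsto_intros A B lim_inverse_n)
  then have "(\<lambda>n. real n * (1 - a n x * (\<Prod>i\<in>F. a n i))) \<longlonglongrightarrow> b x + (\<Sum>i\<in>F. b i) - 0 * (b x * (\<Sum>i\<in>F. b i))"
  proof (rule Lim_transform_eventually)
    show "\<forall>\<^sub>F n in sequentially. real n * (1 - a n x) + real n * (1 - (\<Prod>i\<in>F. a n i)) - inverse (real n) * ((real n * (1 - a n x)) * (real n * (1 - (\<Prod>i\<in>F. a n i)))) = real n * (1 - a n x * (\<Prod>i\<in>F. a n i))"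
      using eventually_gt_at_top[of 0]
    proof eventually_elim
      case (elim n)
      have "inverse (real n) * ((real n * X) * (real n * Y)) = real n * (X * Y)" for X Y
        using elim by simp
      then have "inverse (real n) * ((real n * (1 - a n x)) * (real n * (1 - (\<Prod>i\<in>F. a n i)))) = real n * ((1 - a n x) * (1 - (\<Prod>i\<in>F. a n i)))" .
      then show ?case by (simp only:) (simp add: algebra_simps)
    qed
  qed
  then show ?case using insert by simp
qed simp

lemma kernel_coef_tendsto:
  assumes "k \<in> Zd" shows "(\<lambda>n. real n * (1 - kernel_coef n k)) \<longlonglongrightarrow> (norm k)\<^sup>2"
proof -
  have "(\<lambda>n. real n * (1 - kernel_coef n k)) \<longlonglongrightarrow> (\<Sum>i\<in>UNIV. (real (nat \<lfloor>\<bar>k $ i\<bar>\<rfloor>))\<^sup>2)"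
    unfolding kernel_coef_def by (intro prod_defect_tendsto kernel_ratio_tendsto) auto
  then show ?thesis by (simp add: norm_sq_sum Zd_nat_abs[OF assms])
qed

lemma kernel_nonneg:
  fixes z :: "real^'n"
  obtains q where "0 \<le> q" "(\<Sum>k\<in>lattice_box n. complex_of_real (kernel_coef n k) * cis (2 * pi * (k \<bullet> z))) = complex_of_real q"
proof -
  let ?F = "\<lambda>(i::'n) t. complex_of_real (kernel_ratio n (nat \<lfloor>\<bar>t\<bar>\<rfloor>)) * cis (t * (2 * pi * z $ i))"
  have "(\<Sum>k\<in>lattice_box n. complex_of_real (kernel_coef n k) * cis (2 * pi * (k \<bullet> z))) = (\<Sum>k\<in>(lattice_box n :: (real^'n) set). \<Prod>i\<in>UNIV. ?F i (k $ i))"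
  proof (intro sum.cong refl)
    fix k :: "real^'n"
    have "2 * pi * (k \<bullet> z) = (\<Sum>i\<in>UNIV. k $ i * (2 * pi * z $ i))"
      by (simp add: inner_vec_def sum_distrib_left mult_ac)
    then show "complex_of_real (kernel_coef n k) * cis (2 * pi * (k \<bullet> z)) = (\<Prod>i\<in>UNIV. ?F i (k $ i))"
      by (simp add: kernel_coef_def cis_sum prod.distrib)
  qed
  also have "\<dots> = (\<Prod>i\<in>(UNIV::'n set). \<Sum>m\<in>{- int n..int n}. ?F i (real_of_int m))"
    by (rule sum_lattice_box_prod)
  also have "\<dots> = (\<Prod>i\<in>(UNIV::'n set). of_real ((2 * cos ((2 * pi * z $ i) / 2)) ^ (2 * n) / real ((2 * n) choose n)))"
    by (intro prod.cong refl, subst kernel_ratio_cos_power[symmetric])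
       (simp add: of_int_abs[symmetric] del: of_int_abs)
  also have "\<dots> = of_real (\<Prod>i\<in>(UNIV::'n set). (2 * cos ((2 * pi * z $ i) / 2)) ^ (2 * n) / real ((2 * n) choose n))"
    by (rule of_real_prod[symmetric])
  finally show ?thesis
    by (rule that[rotated]) (intro prod_nonneg divide_nonneg_nonneg ballI, auto)
qed

text \<open>In Fourier variables, the double integral of q(x - y) f(x) g(y), where q is the
  nonnegative kernel with coefficients \<open>kernel_coef n\<close>.\<close>

definition kernel_form :: "nat \<Rightarrow> (real^'n \<Rightarrow> real) \<Rightarrow> (real^'n \<Rightarrow> real) \<Rightarrow> real" where
  "kernel_form n f g = (\<Sum>k\<in>lattice_box n. kernel_coef n k * Re (fcoef f k * cnj (fcoef g k)))"

text \<open>An inequality in pairs (x, y) survives integration against the nonnegative kernel q(x -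
  y). The arguments on modulus, negative part and Picone's identity each amount to a choice of the
  families f and g.\<close>

lemma kernel_form_sum_nonneg:
  fixes f g :: "'i \<Rightarrow> real^'n \<Rightarrow> real"
  assumes I: "finite I" and f: "\<And>i. i \<in> I \<Longrightarrow> L2 (f i)" and g: "\<And>i. i \<in> I \<Longrightarrow> L2 (g i)"
    and pos: "AE y in torus. AE x in torus. 0 \<le> (\<Sum>i\<in>I. f i x * g i y)"
  shows "0 \<le> (\<Sum>i\<in>I. kernel_form n (f i) (g i))"
proof -
  \<comment> \<open>\<open>H\<close> is the inner integral over x, expressed by coefficients of f;
    integrating it over y produces the kernel forms without an exchange of integrals.\<close>
  define H where "H y = (\<Sum>i\<in>I. \<Sum>k\<in>lattice_box n. of_real (kernel_coef n k) * cnj (fcoef (f i) k) * (complex_of_real (g i y) * cis (- (2 * pi * (k \<bullet> y)))))" for y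
  have fi: "integrable torus (f i)" and gi: "integrable torus (g i)" if "i \<in> I" for i
    using f[OF that] g[OF that] L2_integrable by auto
  have Hint: "integrable torus H" unfolding H_def
    by (intro Bochner_Integration.integrable_sum Bochner_Integration.integrable_mult_right impI fcoef_integrable gi)
  have fc: "cnj (fcoef (f i) k) = integral\<^sup>L torus (\<lambda>x. complex_of_real (f i x) * cis (2 * pi * (k \<bullet> x)))" for i k
    using fcoef_minus_freq[of "f i" k] by (simp add: fcoef_torus)
  have Hpos: "AE y in torus. 0 \<le> Re (H y)"
    using pos
  proof eventually_elim
    case (elim y)
    define q where "q = (\<lambda>z::real^'n. SOME q. 0 \<le> q \<and> (\<Sum>k\<in>lattice_box n. complex_of_real (kernel_coef n k) * cis (2 * pi * (k \<bullet> z))) = complex_of_real q)"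
    have q: "0 \<le> q z" "(\<Sum>k\<in>lattice_box n. complex_of_real (kernel_coef n k) * cis (2 * pi * (k \<bullet> z))) = complex_of_real (q z)" for z
    proof -
      have "0 \<le> q z \<and> (\<Sum>k\<in>lattice_box n. complex_of_real (kernel_coef n k) * cis (2 * pi * (k \<bullet> z))) = complex_of_real (q z)"
        unfolding q_def by (rule someI_ex) (use kernel_nonneg[of n z] in blast)
      then show "0 \<le> q z" "(\<Sum>k\<in>lattice_box n. complex_of_real (kernel_coef n k) * cis (2 * pi * (k \<bullet> z))) = complex_of_real (q z)"
        by auto
    qed
    have "H y = (\<Sum>i\<in>I. \<Sum>k\<in>lattice_box n. integral\<^sup>L torus (\<lambda>x. of_real (kernel_coef n k) * (complex_of_real (f i x) * cis (2 * pi * (k \<bullet> x))) * (complex_of_real (g i y) * cis (- (2 * pi * (k \<bullet> y))))))"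
      unfolding H_def fc by (intro sum.cong refl) simp
    also have "\<dots> = integral\<^sup>L torus (\<lambda>x. \<Sum>i\<in>I. \<Sum>k\<in>lattice_box n. of_real (kernel_coef n k) * (complex_of_real (f i x) * cis (2 * pi * (k \<bullet> x))) * (complex_of_real (g i y) * cis (- (2 * pi * (k \<bullet> y)))))"
      by (subst Bochner_Integration.integral_sum, intro Bochner_Integration.integrable_sum Bochner_Integration.integrable_mult_left Bochner_Integration.integrable_mult_right impI integrable_mult_plane_wave fi continuous_intros, assumption,
          intro sum.cong refl, subst Bochner_Integration.integral_sum)
         (auto intro!: Bochner_Integration.integrable_mult_left Bochner_Integration.integrable_mult_right integrable_mult_plane_wave fi continuous_intros)
    also have "\<dots> = integral\<^sup>L torus (\<lambda>x. complex_of_real (q (x - y) * (\<Sum>i\<in>I. f i x * g i y)))"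
    proof (rule Bochner_Integration.integral_cong[OF refl])
      fix x
      have "(\<Sum>i\<in>I. \<Sum>k\<in>lattice_box n. of_real (kernel_coef n k) * (complex_of_real (f i x) * cis (2 * pi * (k \<bullet> x))) * (complex_of_real (g i y) * cis (- (2 * pi * (k \<bullet> y)))))
         = (\<Sum>i\<in>I. complex_of_real (f i x * g i y) * (\<Sum>k\<in>lattice_box n. of_real (kernel_coef n k) * cis (2 * pi * (k \<bullet> (x - y)))))"
        unfolding sum_distrib_left
      proof (intro sum.cong refl)
        fix i k
        have *: "cis (2 * pi * (k \<bullet> (x - y))) = cis (2 * pi * (k \<bullet> x)) * cis (- (2 * pi * (k \<bullet> y)))"
          by (simp add: cis_mult inner_diff_right algebra_simps)
        show "of_real (kernel_coef n k) * (complex_of_real (f i x) * cis (2 * pi * (k \<bullet> x))) * (complex_of_real (g i y) * cis (- (2 * pi * (k \<bullet> y))))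
            = complex_of_real (f i x * g i y) * (of_real (kernel_coef n k) * cis (2 * pi * (k \<bullet> (x - y))))"
          unfolding * by (simp add: mult_ac)
      qed
      then show "(\<Sum>i\<in>I. \<Sum>k\<in>lattice_box n. of_real (kernel_coef n k) * (complex_of_real (f i x) * cis (2 * pi * (k \<bullet> x))) * (complex_of_real (g i y) * cis (- (2 * pi * (k \<bullet> y)))))
         = complex_of_real (q (x - y) * (\<Sum>i\<in>I. f i x * g i y))"
        unfolding q(2) by (simp add: sum_distrib_left sum_distrib_right mult_ac)
    qed
    also have "\<dots> = complex_of_real (integral\<^sup>L torus (\<lambda>x. q (x - y) * (\<Sum>i\<in>I. f i x * g i y)))"
      by (rule integral_complex_of_real)
    finally have "Re (H y) = integral\<^sup>L torus (\<lambda>x. q (x - y) * (\<Sum>i\<in>I. f i x * g i y))" by simp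
    also have "\<dots> \<ge> 0"
      by (rule integral_nonneg_AE) (use elim q(1) in \<open>auto elim!: eventually_mono\<close>)
    finally show ?case .
  qed
  have "integral\<^sup>L torus H = (\<Sum>i\<in>I. \<Sum>k\<in>lattice_box n. of_real (kernel_coef n k) * cnj (fcoef (f i) k) * fcoef (g i) k)"
    unfolding H_def fcoef_torus[of "g _"]
    by (subst Bochner_Integration.integral_sum, intro Bochner_Integration.integrable_sum Bochner_Integration.integrable_mult_right impI fcoef_integrable gi, assumption,
        intro sum.cong refl, subst Bochner_Integration.integral_sum)
       (auto intro!: Bochner_Integration.integrable_mult_right fcoef_integrable gi)
  then have "integral\<^sup>L torus (\<lambda>y. Re (H y)) = Re (\<Sum>i\<in>I. \<Sum>k\<in>lattice_box n. of_real (kernel_coef n k) * cnj (fcoef (f i) k) * fcoef (g i) k)"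
    using Hint by simp
  also have "\<dots> = (\<Sum>i\<in>I. kernel_form n (f i) (g i))"
    unfolding kernel_form_def by (simp add: mult.assoc algebra_simps)
  finally show ?thesis using integral_nonneg_AE[OF Hpos] by simp
qed

lemma infsum_dominated_convergence:
  fixes h :: "nat \<Rightarrow> 'a \<Rightarrow> real"
  assumes g: "g summable_on A" and bd: "\<And>n k. k \<in> A \<Longrightarrow> \<bar>h n k\<bar> \<le> g k"
    and lim: "\<And>k. k \<in> A \<Longrightarrow> (\<lambda>n. h n k) \<longlonglongrightarrow> l k"
  shows "(\<lambda>n. infsum (h n) A) \<longlonglongrightarrow> infsum l A"
proof -
  have l: "\<bar>l k\<bar> \<le> g k" if "k \<in> A" for k
    by (rule LIMSEQ_le_const2[OF tendsto_rabs[OF lim[OF that]]]) (use bd that in auto)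
  have *: "infsum f A = integral\<^sup>L (count_space A) f \<and> integrable (count_space A) f"
    if "\<And>k. k \<in> A \<Longrightarrow> \<bar>f k\<bar> \<le> g k" for f :: "'a \<Rightarrow> real"
  proof -
    have "(\<lambda>k. norm (f k)) summable_on A"
      by (rule summable_on_comparison_real[OF g]) (use that in auto)
    then have "Infinite_Set_Sum.abs_summable_on f A" using abs_summable_equivalent by blast
    then show ?thesis
      by (simp add: infsetsum_infsum[symmetric] infsetsum_def Infinite_Set_Sum.abs_summable_on_def)
  qed
  have g0: "\<bar>g k\<bar> \<le> g k" if "k \<in> A" for k using l[OF that] by linarith
  have "(\<lambda>n. integral\<^sup>L (count_space A) (h n)) \<longlonglongrightarrow> integral\<^sup>L (count_space A) l"
    by (rule integral_dominated_convergence[where w=g]) (use *[OF g0] bd lim in auto)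
  then show ?thesis using *[OF bd] *[OF l] by simp
qed

lemma kernel_form_has_sum: "((\<lambda>k. kernel_coef n k * Re (fcoef f k * cnj (fcoef g k))) has_sum kernel_form n f g) Zd"
  unfolding kernel_form_def
proof (rule has_sum_finite_neutralI)
  show "lattice_box n \<subseteq> Zd" by (auto simp: lattice_box_def)
qed (auto simp: finite_lattice_box kernel_coef_outside)

lemma ip_minus_kernel_form_has_sum:
  assumes "L2 f" "L2 g"
  shows "((\<lambda>k. (1 - kernel_coef n k) * Re (fcoef f k * cnj (fcoef g k))) has_sum (ip f g - kernel_form n f g)) Zd"
  using has_sum_add[OF Parseval_ip[OF assms] has_sum_cmult_right[OF kernel_form_has_sum[of n f g], of "-1"]]
  by (simp add: left_diff_distrib)

lemma Re_mult_cnj_le: "\<bar>Re (a * cnj b)\<bar> \<le> cmod a * cmod b"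
  using abs_Re_le_cmod[of "a * cnj b"] by (simp add: norm_mult)

text \<open>Since n (1 - kernel_coef n k) tends to |k|^2 and never exceeds it, dominated convergence
  over the lattice applies; (2 pi)^2 turns |k|^2 into \<open>kap k\<close>.\<close>

lemma kernel_form_limit:
  assumes f: "sobolev a f" and g: "sobolev b g" and ab: "2 \<le> a + b"
  shows "(\<lambda>n. (2 * pi)\<^sup>2 * (real n * (ip f g - kernel_form n f g))) \<longlonglongrightarrow> dirichlet f g"
proof -
  let ?h = "\<lambda>n k. (2 * pi)\<^sup>2 * (real n * ((1 - kernel_coef n k) * Re (fcoef f k * cnj (fcoef g k))))"
  have "(\<lambda>n. infsum (?h n) Zd) \<longlonglongrightarrow> dirichlet f g"
    unfolding dirichlet_def
  proof (rule infsum_dominated_convergence[OF dirichlet_abs_summable[OF assms]])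
    fix n :: nat and k :: "real^'a" assume k: "k \<in> Zd"
    have r: "0 \<le> real n * (1 - kernel_coef n k)" using kernel_coef_le_1[of n k] by simp
    have "\<bar>?h n k\<bar> = (2 * pi)\<^sup>2 * (real n * (1 - kernel_coef n k)) * \<bar>Re (fcoef f k * cnj (fcoef g k))\<bar>"
      using r kernel_coef_le_1[of n k] by (simp add: abs_mult mult.assoc)
    also have "\<dots> \<le> wt k * (cmod (fcoef f k) * cmod (fcoef g k))"
    proof (intro mult_mono Re_mult_cnj_le)
      have "(2 * pi)\<^sup>2 * (real n * (1 - kernel_coef n k)) \<le> (2 * pi)\<^sup>2 * (norm k)\<^sup>2"
        by (intro mult_left_mono kernel_coef_bound k) auto
      also have "\<dots> \<le> wt k" by (simp add: wt_def kap_def power_mult_distrib)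
      finally show "(2 * pi)\<^sup>2 * (real n * (1 - kernel_coef n k)) \<le> wt k" .
    qed auto
    finally show "\<bar>?h n k\<bar> \<le> wt k * (cmod (fcoef f k) * cmod (fcoef g k))" .
  next
    fix k :: "real^'a" assume k: "k \<in> Zd"
    have "(\<lambda>n. (2 * pi)\<^sup>2 * (real n * (1 - kernel_coef n k)) * Re (fcoef f k * cnj (fcoef g k))) \<longlonglongrightarrow> (2 * pi)\<^sup>2 * (norm k)\<^sup>2 * Re (fcoef f k * cnj (fcoef g k))"
      by (intro tendsto_intros kernel_coef_tendsto k)
    then show "(\<lambda>n. ?h n k) \<longlonglongrightarrow> kap k * Re (fcoef f k * cnj (fcoef g k))"
      by (simp add: kap_def power_mult_distrib mult.assoc)
  qed
  moreover have "infsum (?h n) Zd = (2 * pi)\<^sup>2 * (real n * (ip f g - kernel_form n f g))" for n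
    by (intro infsumI has_sum_cmult_right ip_minus_kernel_form_has_sum sobolev_L2[OF f] sobolev_L2[OF g])
  ultimately show ?thesis by simp
qed

lemma nsq_ip: "nsq f = ip f f" by (simp add: power2_eq_square)

lemma kernel_form_Bessel:
  assumes "L2 f" "finite F" "F \<subseteq> Zd"
  shows "(\<Sum>k\<in>F. (1 - kernel_coef n k) * (cmod (fcoef f k))\<^sup>2) \<le> nsq f - kernel_form n f f"
proof (rule finite_sum_le_has_sum)
  show "((\<lambda>k. (1 - kernel_coef n k) * (cmod (fcoef f k))\<^sup>2) has_sum (nsq f - kernel_form n f f)) Zd"
    using ip_minus_kernel_form_has_sum[OF assms(1,1), of n] by (simp only: Re_mult_cnj_self nsq_ip)
  show "0 \<le> (1 - kernel_coef n k) * (cmod (fcoef f k))\<^sup>2" for k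
    using kernel_coef_le_1[of n k] by simp
qed (use assms in auto)

lemma kernel_form_le_nsq: "L2 f \<Longrightarrow> kernel_form n f f \<le> nsq f"
  using kernel_form_Bessel[of f "{}" n] by simp

lemma kernel_form_cmult_right: "kernel_form n f (\<lambda>x. c * g x) = c * kernel_form n f g"
  unfolding kernel_form_def by (simp add: fcoef_cmult sum_distrib_left algebra_simps)

lemma kernel_form_commute: "kernel_form n f g = kernel_form n g f"
  unfolding kernel_form_def by (intro sum.cong refl) (simp add: mult.commute)

text \<open>Meant for functions not yet known to lie in H^1: a bound on the kernel defects bounds
  every finite part of the Dirichlet sum, from which membership can be concluded.\<close>

lemma dirichlet_partial_sum_le:
  assumes f: "L2 f" and F: "finite F" "F \<subseteq> Zd"
    and le: "\<And>n. (2 * pi)\<^sup>2 * (real n * (nsq f - kernel_form n f f)) \<le> X n" and X: "X \<longlonglongrightarrow> L"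
  shows "(\<Sum>k\<in>F. kap k * (cmod (fcoef f k))\<^sup>2) \<le> L"
proof (rule LIMSEQ_le[OF _ X])
  have "(\<lambda>n. \<Sum>k\<in>F. (2 * pi)\<^sup>2 * (real n * (1 - kernel_coef n k)) * (cmod (fcoef f k))\<^sup>2) \<longlonglongrightarrow> (\<Sum>k\<in>F. (2 * pi)\<^sup>2 * (norm k)\<^sup>2 * (cmod (fcoef f k))\<^sup>2)"
    using F by (intro tendsto_intros kernel_coef_tendsto) auto
  then show "(\<lambda>n. \<Sum>k\<in>F. (2 * pi)\<^sup>2 * (real n * (1 - kernel_coef n k)) * (cmod (fcoef f k))\<^sup>2) \<longlonglongrightarrow> (\<Sum>k\<in>F. kap k * (cmod (fcoef f k))\<^sup>2)"
    by (simp add: kap_def power_mult_distrib)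
  have "(\<Sum>k\<in>F. (2 * pi)\<^sup>2 * (real n * (1 - kernel_coef n k)) * (cmod (fcoef f k))\<^sup>2) \<le> X n" for n
  proof -
    have "(\<Sum>k\<in>F. (2 * pi)\<^sup>2 * (real n * (1 - kernel_coef n k)) * (cmod (fcoef f k))\<^sup>2) = (2 * pi)\<^sup>2 * (real n * (\<Sum>k\<in>F. (1 - kernel_coef n k) * (cmod (fcoef f k))\<^sup>2))"
      by (simp add: sum_distrib_left mult.assoc)
    also have "\<dots> \<le> (2 * pi)\<^sup>2 * (real n * (nsq f - kernel_form n f f))"
      by (intro mult_left_mono kernel_form_Bessel f F) auto
    also have "\<dots> \<le> X n" by (rule le)
    finally show ?thesis .
  qed
  then show "\<exists>N. \<forall>n\<ge>N. (\<Sum>k\<in>F. (2 * pi)\<^sup>2 * (real n * (1 - kernel_coef n k)) * (cmod (fcoef f k))\<^sup>2) \<le> X n" by blast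
qed

subsection \<open>Modulus, negative part and the weak maximum principle\<close>

text \<open>The two-point inequality is |v(x)| |v(y)| >= v(x) v(y). As v and its modulus have the
  same L^2 norm, the modulus cannot have the larger Dirichlet form.\<close>

lemma kernel_form_abs_ge:
  assumes v: "L2 v" shows "kernel_form n v v \<le> kernel_form n (\<lambda>x. \<bar>v x\<bar>) (\<lambda>x. \<bar>v x\<bar>)"
proof -
  have "0 \<le> (\<Sum>b\<in>{True, False}. kernel_form n (if b then (\<lambda>x. \<bar>v x\<bar>) else v) (if b then (\<lambda>x. \<bar>v x\<bar>) else (\<lambda>x. -1 * v x)))"
  proof (rule kernel_form_sum_nonneg)
    show "AE y in torus. AE x in torus. 0 \<le> (\<Sum>b\<in>{True, False}. (if b then (\<lambda>x. \<bar>v x\<bar>) else v) x * (if b then (\<lambda>x. \<bar>v x\<bar>) else (\<lambda>x. -1 * v x)) y)"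
    proof (intro always_eventually allI)
      fix x y
      show "0 \<le> (\<Sum>b\<in>{True, False}. (if b then (\<lambda>x. \<bar>v x\<bar>) else v) x * (if b then (\<lambda>x. \<bar>v x\<bar>) else (\<lambda>x. -1 * v x)) y)"
        using abs_ge_self[of "v x * v y"] by (simp add: abs_mult)
    qed
  qed (use v L2_abs[OF v] L2_cmult[OF v, of "-1"] in auto)
  then show ?thesis using kernel_form_cmult_right[of n v "-1" v] by simp
qed

lemma sobolev_abs:
  assumes v: "sobolev 1 v" shows "sobolev 1 (\<lambda>x. \<bar>v x\<bar>)"
proof (rule hregI(1))
  have L: "L2 v" using v by (rule sobolev_L2)
  show A: "L2 (\<lambda>x. \<bar>v x\<bar>)" by (rule L2_abs[OF L])
  fix F :: "(real^'a) set" assume F: "finite F" "F \<subseteq> Zd"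
  have "(\<Sum>k\<in>F. kap k * (cmod (fcoef (\<lambda>x. \<bar>v x\<bar>) k))\<^sup>2) \<le> dirichlet v v"
  proof (rule dirichlet_partial_sum_le[OF A F _ kernel_form_limit[OF v v]])
    fix n
    show "(2 * pi)\<^sup>2 * (real n * (nsq (\<lambda>x. \<bar>v x\<bar>) - kernel_form n (\<lambda>x. \<bar>v x\<bar>) (\<lambda>x. \<bar>v x\<bar>))) \<le> (2 * pi)\<^sup>2 * (real n * (ip v v - kernel_form n v v))"
      using kernel_form_abs_ge[OF L, of n] by (intro mult_left_mono) (auto simp: power2_eq_square)
  qed auto
  moreover have "(\<Sum>k\<in>F. (cmod (fcoef (\<lambda>x. \<bar>v x\<bar>) k))\<^sup>2) \<le> nsq v"
    using Bessel[OF A F] by simp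
  moreover have "(\<Sum>k\<in>F. wt k ^ 1 * (cmod (fcoef (\<lambda>x. \<bar>v x\<bar>) k))\<^sup>2) = (\<Sum>k\<in>F. (cmod (fcoef (\<lambda>x. \<bar>v x\<bar>) k))\<^sup>2) + (\<Sum>k\<in>F. kap k * (cmod (fcoef (\<lambda>x. \<bar>v x\<bar>) k))\<^sup>2)"
    by (simp add: wt_def ring_distribs sum.distrib)
  ultimately show "(\<Sum>k\<in>F. wt k ^ 1 * (cmod (fcoef (\<lambda>x. \<bar>v x\<bar>) k))\<^sup>2) \<le> nsq v + dirichlet v v" by linarith
qed

definition negpart :: "(real^'n \<Rightarrow> real) \<Rightarrow> real^'n \<Rightarrow> real" where
  "negpart v = (\<lambda>x. max (- v x) 0)"

lemma negpart_eq: "negpart v = (\<lambda>x. (1/2) * (\<bar>v x\<bar> + (-1) * v x))"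
  unfolding negpart_def by (rule ext) (auto simp: max_def abs_if)

lemma sobolev_negpart: "sobolev 1 v \<Longrightarrow> sobolev 1 (negpart v)"
  unfolding negpart_eq by (intro sobolev_cmult sobolev_add sobolev_abs)

lemma mult_negpart: "v x * negpart v x = - (negpart v x)\<^sup>2"
  by (auto simp: negpart_def max_def power2_eq_square)

text \<open>Write v+ = v + v-. Nonnegativity of v+(x) v-(y) bounds minus the kernel form of v and v-
  by that of v- with itself, hence by the squared norm of v-; this is offset by ip v v-, which is
  minus that squared norm.\<close>

lemma dirichlet_negpart_le_0:
  assumes v: "sobolev 1 v" shows "dirichlet v (negpart v) \<le> 0"
proof (rule LIMSEQ_le_const2[OF kernel_form_limit[OF v sobolev_negpart[OF v]]])
  let ?w = "negpart v"
  have L: "L2 v" "L2 ?w" using v sobolev_negpart[OF v] sobolev_L2 by blast+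
  have ip: "ip v ?w = - nsq ?w" by (simp add: mult_negpart)
  have "(2 * pi)\<^sup>2 * (real n * (ip v ?w - kernel_form n v ?w)) \<le> 0" for n
  proof -
    have "0 \<le> (\<Sum>b\<in>{True, False}. kernel_form n (if b then v else ?w) ?w)"
    proof (rule kernel_form_sum_nonneg)
      show "AE y in torus. AE x in torus. 0 \<le> (\<Sum>b\<in>{True, False}. (if b then v else ?w) x * ?w y)"
      proof (intro always_eventually allI)
        fix x y
        have "0 \<le> (v x + ?w x) * ?w y" by (intro mult_nonneg_nonneg) (auto simp: negpart_def max_def)
        then show "0 \<le> (\<Sum>b\<in>{True, False}. (if b then v else ?w) x * ?w y)" by (simp add: ring_distribs)
      qed
    qed (use L in auto)
    then have "ip v ?w - kernel_form n v ?w \<le> 0" using kernel_form_le_nsq[OF L(2), of n] ip by simp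
    then show ?thesis by (intro mult_nonneg_nonpos) auto
  qed
  then show "\<exists>N. \<forall>n\<ge>N. (2 * pi)\<^sup>2 * (real n * (ip v ?w - kernel_form n v ?w)) \<le> 0" by blast
qed simp

text \<open>The coefficient identity says (c - Laplacian) v = h. Tested with the negative part of v,
  the right side is nonnegative and both terms on the left are nonpositive.\<close>

lemma weak_maximum_principle:
  assumes v: "sobolev 1 v" and h: "L2 h" "AE x in torus. 0 \<le> h x" and c: "0 < c"
    and eq: "\<And>k. k \<in> Zd \<Longrightarrow> of_real (c + kap k) * fcoef v k = fcoef h k"
  shows "AE x in torus. 0 \<le> v x"
proof -
  let ?w = "negpart v"
  have w: "sobolev 1 ?w" by (rule sobolev_negpart[OF v])
  have L: "L2 v" "L2 ?w" using v w sobolev_L2 by blast+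
  have "((\<lambda>k. c * Re (fcoef v k * cnj (fcoef ?w k)) + kap k * Re (fcoef v k * cnj (fcoef ?w k))) has_sum (c * ip v ?w + dirichlet v ?w)) Zd"
    by (intro has_sum_add has_sum_cmult_right Parseval_ip L dirichlet_has_sum[OF v w]) simp
  moreover have "c * Re (fcoef v k * cnj (fcoef ?w k)) + kap k * Re (fcoef v k * cnj (fcoef ?w k)) = Re (fcoef h k * cnj (fcoef ?w k))" if "k \<in> Zd" for k
  proof -
    have "Re (fcoef h k * cnj (fcoef ?w k)) = Re (of_real (c + kap k) * (fcoef v k * cnj (fcoef ?w k)))"
      unfolding eq[OF that, symmetric] by (simp only: mult.assoc)
    also have "\<dots> = (c + kap k) * Re (fcoef v k * cnj (fcoef ?w k))"
      by (simp only: times_complex.sel Re_complex_of_real Im_complex_of_real)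
    finally show ?thesis by (simp only: ring_distribs)
  qed
  ultimately have "((\<lambda>k. Re (fcoef h k * cnj (fcoef ?w k))) has_sum (c * ip v ?w + dirichlet v ?w)) Zd"
    by (simp cong: has_sum_cong)
  then have "ip h ?w = c * ip v ?w + dirichlet v ?w"
    using Parseval_ip[OF h(1) L(2)] has_sum_unique by blast
  moreover have "0 \<le> ip h ?w"
    by (rule integral_nonneg_AE) (use h(2) in \<open>auto simp: negpart_def elim!: eventually_mono\<close>)
  moreover have "ip v ?w = - nsq ?w" by (simp add: mult_negpart)
  ultimately have "c * nsq ?w \<le> 0" using dirichlet_negpart_le_0[OF v] by simp
  then have "nsq ?w = 0" using c nsq_nonneg[of ?w] by (simp add: mult_le_0_iff)
  from nsq_zero_AE[OF L(2) this] show ?thesis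
    by eventually_elim (auto simp: negpart_def max_def split: if_splits)
qed

subsection \<open>The Euler--Lagrange equation\<close>

lemma L2_mult_L4: "L2 (\<lambda>x. (f x)\<^sup>2) \<Longrightarrow> L2 (\<lambda>x. (g x)\<^sup>2) \<Longrightarrow> f \<in> borel_measurable torus \<Longrightarrow> g \<in> borel_measurable torus \<Longrightarrow> L2 (\<lambda>x. f x * g x)"
  using L2_mult_integrable[of "\<lambda>x. (f x)\<^sup>2" "\<lambda>x. (g x)\<^sup>2"] by (simp add: L2_alt power_mult_distrib)

lemma quartic_integrable:
  assumes f: "L2 (\<lambda>x. (f x)\<^sup>2)" "f \<in> borel_measurable torus" and g: "L2 (\<lambda>x. (g x)\<^sup>2)" "g \<in> borel_measurable torus"
  shows "integrable torus (\<lambda>x. (f x)^4)" "integrable torus (\<lambda>x. (f x)^3 * g x)" "integrable torus (\<lambda>x. (f x)\<^sup>2 * (g x)\<^sup>2)"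
proof -
  have fg: "L2 (\<lambda>x. f x * g x)" by (intro L2_mult_L4 f g)
  show "integrable torus (\<lambda>x. (f x)^4)"
    using L2_mult_integrable[OF f(1) f(1)] by (simp add: power2_eq_square power4_eq_xxxx mult.assoc)
  show "integrable torus (\<lambda>x. (f x)^3 * g x)"
    using L2_mult_integrable[OF f(1) fg] by (simp add: power2_eq_square power3_eq_cube mult.assoc)
  show "integrable torus (\<lambda>x. (f x)\<^sup>2 * (g x)\<^sup>2)"
    by (rule L2_mult_integrable[OF f(1) g(1)])
qed

lemma quartic_expand:
  assumes f: "L2 (\<lambda>x. (f x)\<^sup>2)" "f \<in> borel_measurable torus" and g: "L2 (\<lambda>x. (g x)\<^sup>2)" "g \<in> borel_measurable torus"
  shows "integral\<^sup>L torus (\<lambda>x. (f x + t * g x)^4) = integral\<^sup>L torus (\<lambda>x. (f x)^4) + 4 * t * integral\<^sup>L torus (\<lambda>x. (f x)^3 * g x)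
    + 6 * t\<^sup>2 * integral\<^sup>L torus (\<lambda>x. (f x)\<^sup>2 * (g x)\<^sup>2) + 4 * t^3 * integral\<^sup>L torus (\<lambda>x. (g x)^3 * f x) + t^4 * integral\<^sup>L torus (\<lambda>x. (g x)^4)"
proof -
  have "(f x + t * g x)^4 = (f x)^4 + 4 * t * ((f x)^3 * g x) + 6 * t\<^sup>2 * ((f x)\<^sup>2 * (g x)\<^sup>2) + 4 * t^3 * ((g x)^3 * f x) + t^4 * (g x)^4" for x
    by (simp add: power2_eq_square power3_eq_cube power4_eq_xxxx algebra_simps)
  then show ?thesis
    using quartic_integrable[OF f g] quartic_integrable[OF g f] by simp
qed

lemma dirichlet_cmult: "dirichlet (\<lambda>x. c * f x) (\<lambda>x. c * f x) = c\<^sup>2 * dirichlet f f"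
proof -
  have "dirichlet (\<lambda>x. c * f x) (\<lambda>x. c * f x) = infsum (\<lambda>k. c\<^sup>2 * (kap k * Re (fcoef f k * cnj (fcoef f k)))) Zd"
    unfolding dirichlet_def Re_mult_cnj_self
    by (intro infsum_cong) (simp add: fcoef_cmult norm_mult power_mult_distrib)
  also have "\<dots> = c\<^sup>2 * dirichlet f f" unfolding dirichlet_def by (rule infsum_cmult_right')
  finally show ?thesis .
qed

lemma E_eig_torus:
  "E_eig V w = dirichlet w w / 2 + integral\<^sup>L torus (\<lambda>x. V x * (w x)\<^sup>2) / 2 + integral\<^sup>L torus (\<lambda>x. (w x)^4) / 4"
  by (simp add: E_eig_def grad_sq_dirichlet set_integral_Omega)

text \<open>Stated for a general linear class Y, so that one proof covers the continuous minimiser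
  (Y = \<open>Xsp\<close>) and the discrete one (Y = \<open>XN N\<close>).\<close>

lemma Euler_Lagrange:
  fixes V u \<phi> :: "real^'n \<Rightarrow> real"
  assumes S: "(\<lambda>k::real^'n. 1 / (wt k)\<^sup>2) summable_on Zd"
    and V: "V \<in> borel_measurable torus" "AE x in torus. \<bar>V x\<bar> \<le> Vb"
    and min: "is_minimiser_on V Y u"
    and Y: "\<And>f. f \<in> Y \<Longrightarrow> sobolev 1 f" "\<And>f g t. f \<in> Y \<Longrightarrow> g \<in> Y \<Longrightarrow> (\<lambda>x. f x + t * g x) \<in> Y"
      "\<And>f t. f \<in> Y \<Longrightarrow> (\<lambda>x. t * f x) \<in> Y"
    and \<phi>: "\<phi> \<in> Y"
  shows "dirichlet u \<phi> + integral\<^sup>L torus (\<lambda>x. V x * (u x * \<phi> x)) + integral\<^sup>L torus (\<lambda>x. (u x)^3 * \<phi> x)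
    = (dirichlet u u + integral\<^sup>L torus (\<lambda>x. V x * (u x)\<^sup>2) + integral\<^sup>L torus (\<lambda>x. (u x)^4)) * ip u \<phi>"
proof -
  have u: "u \<in> Y" "nsq u = 1" and le: "\<And>w. w \<in> Y \<Longrightarrow> nsq w = 1 \<Longrightarrow> E_eig V u \<le> E_eig V w"
    using min by (auto simp: is_minimiser_on_def L2_norm_nsq)
  have hu: "sobolev 1 u" and h\<phi>: "sobolev 1 \<phi>" using Y(1) u \<phi> by auto
  have Lu: "L2 u" and L\<phi>: "L2 \<phi>" using hu h\<phi> sobolev_L2 by auto
  have mu: "u \<in> borel_measurable torus" and m\<phi>: "\<phi> \<in> borel_measurable torus" using Lu L\<phi> L2_meas by auto
  have u4: "L2 (\<lambda>x. (u x)\<^sup>2)" and \<phi>4: "L2 (\<lambda>x. (\<phi> x)\<^sup>2)" using L4_embedding(1)[OF S] hu h\<phi> by auto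
  define a0 where "a0 = dirichlet u u + integral\<^sup>L torus (\<lambda>x. V x * (u x)\<^sup>2)"
  define \<alpha> where "\<alpha> = dirichlet u \<phi> + integral\<^sup>L torus (\<lambda>x. V x * (u x * \<phi> x))"
  define a2 where "a2 = dirichlet \<phi> \<phi> + integral\<^sup>L torus (\<lambda>x. V x * (\<phi> x)\<^sup>2)"
  define \<nu> where "\<nu> = ip u \<phi>"
  define n2 where "n2 = nsq \<phi>"
  define q0 where "q0 = integral\<^sup>L torus (\<lambda>x. (u x)^4)"
  define \<beta> where "\<beta> = integral\<^sup>L torus (\<lambda>x. (u x)^3 * \<phi> x)"
  define q2 where "q2 = integral\<^sup>L torus (\<lambda>x. (u x)\<^sup>2 * (\<phi> x)\<^sup>2)"
  define q3 where "q3 = integral\<^sup>L torus (\<lambda>x. (\<phi> x)^3 * u x)"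
  define q4 where "q4 = integral\<^sup>L torus (\<lambda>x. (\<phi> x)^4)"
  \<comment> \<open>With v = u + t \<phi> and m = nsq v, this is 4 (E(v / sqrt m) - E(u)) m^2.
    Clearing the denominators of the normalisation leaves a polynomial in t with a local minimum at
    0, whose derivative there is the equation.\<close>
  define P where "P = (\<lambda>t. 2 * (a0 + 2 * t * \<alpha> + t\<^sup>2 * a2) * (1 + 2 * t * \<nu> + t\<^sup>2 * n2) + (q0 + 4 * t * \<beta> + 6 * t\<^sup>2 * q2 + 4 * t^3 * q3 + t^4 * q4) - (2 * a0 + q0) * (1 + 2 * t * \<nu> + t\<^sup>2 * n2)\<^sup>2)"
  have E0: "4 * E_eig V u = 2 * a0 + q0" by (simp add: E_eig_torus a0_def q0_def)
  have P0: "P 0 = 0" by (simp add: P_def)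
  have Ppos: "0 \<le> P t" if pos: "1 + 2 * t * \<nu> + t\<^sup>2 * n2 > 0" for t
  proof -
    define v where "v = (\<lambda>x. u x + t * \<phi> x)"
    define m where "m = 1 + 2 * t * \<nu> + t\<^sup>2 * n2"
    have m: "m > 0" using pos by (simp add: m_def)
    have nv: "nsq v = m" unfolding v_def m_def nsq_add_scale[OF Lu L\<phi>] u(2) \<nu>_def n2_def by simp
    have vY: "v \<in> Y" unfolding v_def by (intro Y(2) u \<phi>)
    define s where "s = 1 / sqrt m"
    have s2: "s\<^sup>2 = 1 / m" using m by (simp add: s_def power_divide)
    have s4: "s^4 = 1 / m\<^sup>2" using s2 by (metis (no_types, lifting) mult_2 numeral_Bit0 power_add power2_eq_square power_one_over times_divide_eq_right one_power2 mult.right_neutral)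
    have "E_eig V u \<le> E_eig V (\<lambda>x. s * v x)"
      by (rule le[OF Y(3)[OF vY]]) (use m nv in \<open>simp add: power_mult_distrib s2\<close>)
    also have "E_eig V (\<lambda>x. s * v x) = s\<^sup>2 * ((dirichlet v v + integral\<^sup>L torus (\<lambda>x. V x * (v x)\<^sup>2)) / 2) + s^4 * (integral\<^sup>L torus (\<lambda>x. (v x)^4) / 4)"
      unfolding E_eig_torus dirichlet_cmult power_mult_distrib mult.left_commute[of _ "s\<^sup>2"] by (simp add: add_divide_distrib distrib_left)
    also have "dirichlet v v = dirichlet u u + 2 * t * dirichlet u \<phi> + t\<^sup>2 * dirichlet \<phi> \<phi>"
      unfolding v_def using hu h\<phi> sobolev_add[OF hu sobolev_cmult[OF h\<phi>, of t]]
      by (simp add: dirichlet_add_scale dirichlet_add_scale2 dirichlet_commute[of \<phi> u] power2_eq_square algebra_simps)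
    also have "integral\<^sup>L torus (\<lambda>x. V x * (v x)\<^sup>2) = integral\<^sup>L torus (\<lambda>x. V x * (u x)\<^sup>2) + 2 * t * integral\<^sup>L torus (\<lambda>x. V x * (u x * \<phi> x)) + t\<^sup>2 * integral\<^sup>L torus (\<lambda>x. V x * (\<phi> x)\<^sup>2)"
    proof -
      have "V x * (v x)\<^sup>2 = V x * (u x)\<^sup>2 + 2 * t * (V x * (u x * \<phi> x)) + t\<^sup>2 * (V x * (\<phi> x)\<^sup>2)" for x
        by (simp add: v_def power2_eq_square algebra_simps)
      moreover have "integrable torus (\<lambda>x. V x * (u x)\<^sup>2)" "integrable torus (\<lambda>x. V x * (u x * \<phi> x))" "integrable torus (\<lambda>x. V x * (\<phi> x)\<^sup>2)"
        by (intro integral_mult_bounded[OF _ V] L2_sq Lu L\<phi> L2_mult_integrable)+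
      ultimately show ?thesis by simp
    qed
    also have "integral\<^sup>L torus (\<lambda>x. (v x)^4) = q0 + 4 * t * \<beta> + 6 * t\<^sup>2 * q2 + 4 * t^3 * q3 + t^4 * q4"
      unfolding v_def quartic_expand[OF u4 mu \<phi>4 m\<phi>] q0_def \<beta>_def q2_def q3_def q4_def ..
    finally have fin: "E_eig V u \<le> s\<^sup>2 * ((dirichlet u u + 2 * t * dirichlet u \<phi> + t\<^sup>2 * dirichlet \<phi> \<phi> + (integral\<^sup>L torus (\<lambda>x. V x * (u x)\<^sup>2) + 2 * t * integral\<^sup>L torus (\<lambda>x. V x * (u x * \<phi> x)) + t\<^sup>2 * integral\<^sup>L torus (\<lambda>x. V x * (\<phi> x)\<^sup>2))) / 2) + s^4 * ((q0 + 4 * t * \<beta> + 6 * t\<^sup>2 * q2 + 4 * t^3 * q3 + t^4 * q4) / 4)" .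
    have aux: "4 * X \<le> 2 * s2 * A + s4 * B" if "X \<le> s2 * (A / 2) + s4 * (B / 4)" for X A B s2 s4 :: real
      using that by (simp add: field_simps)
    have "dirichlet u u + 2 * t * dirichlet u \<phi> + t\<^sup>2 * dirichlet \<phi> \<phi> + (integral\<^sup>L torus (\<lambda>x. V x * (u x)\<^sup>2) + 2 * t * integral\<^sup>L torus (\<lambda>x. V x * (u x * \<phi> x)) + t\<^sup>2 * integral\<^sup>L torus (\<lambda>x. V x * (\<phi> x)\<^sup>2)) = a0 + 2 * t * \<alpha> + t\<^sup>2 * a2"
      unfolding a0_def \<alpha>_def a2_def by (simp add: algebra_simps)
    from aux[OF fin[unfolded this]] have "4 * E_eig V u \<le> 2 * s\<^sup>2 * (a0 + 2 * t * \<alpha> + t\<^sup>2 * a2) + s^4 * (q0 + 4 * t * \<beta> + 6 * t\<^sup>2 * q2 + 4 * t^3 * q3 + t^4 * q4)"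
      .
    then have "(2 * a0 + q0) * m\<^sup>2 \<le> (2 * s\<^sup>2 * (a0 + 2 * t * \<alpha> + t\<^sup>2 * a2) + s^4 * (q0 + 4 * t * \<beta> + 6 * t\<^sup>2 * q2 + 4 * t^3 * q3 + t^4 * q4)) * m\<^sup>2"
      unfolding E0 by (intro mult_right_mono) auto
    also have "\<dots> = 2 * (a0 + 2 * t * \<alpha> + t\<^sup>2 * a2) * m + (q0 + 4 * t * \<beta> + 6 * t\<^sup>2 * q2 + 4 * t^3 * q3 + t^4 * q4)"
      unfolding s2 s4 using m by (simp add: field_simps power2_eq_square)
    finally show ?thesis unfolding P_def m_def by linarith
  qed
  have "(\<lambda>t. 1 + 2 * t * \<nu> + t\<^sup>2 * n2) \<midarrow>0\<rightarrow> 1 + 2 * 0 * \<nu> + 0\<^sup>2 * n2"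
    by (intro tendsto_intros)
  then have "eventually (\<lambda>t. 1 + 2 * t * \<nu> + t\<^sup>2 * n2 > 0) (at 0)"
    by (intro order_tendstoD(1)[of _ 1]) auto
  then obtain d where d: "d > 0" "\<And>t. t \<noteq> 0 \<Longrightarrow> dist t 0 < d \<Longrightarrow> 1 + 2 * t * \<nu> + t\<^sup>2 * n2 > 0"
    unfolding eventually_at by auto
  have "\<forall>y. \<bar>0 - y\<bar> < d \<longrightarrow> P 0 \<le> P y"
  proof (intro allI impI)
    fix y assume "\<bar>0 - y\<bar> < d"
    then show "P 0 \<le> P y" using P0 Ppos[of y] d(2)[of y] by (cases "y = 0") auto
  qed
  moreover have "DERIV P 0 :> 4 * (\<alpha> + \<beta> - \<nu> * (a0 + q0))"
    unfolding P_def by (auto intro!: derivative_eq_intros simp: algebra_simps)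
  ultimately have "4 * (\<alpha> + \<beta> - \<nu> * (a0 + q0)) = 0" using d(1) DERIV_local_min by blast
  then show ?thesis unfolding \<alpha>_def \<beta>_def \<nu>_def a0_def q0_def by (simp add: algebra_simps)
qed

lemma sobolev_const: "sobolev m (\<lambda>x. c)" by (rule sobolev_XN[OF XN_const[of c 0]])

lemma dirichlet_const_right: "dirichlet f (\<lambda>x. c) = 0"
proof -
  have "dirichlet f (\<lambda>x. c) = (\<Sum>k\<in>KN 0. kap k * Re (fcoef f k * cnj (fcoef (\<lambda>x. c) k)))"
    by (rule dirichlet_XN[OF XN_const])
  also have "\<dots> = 0" by (intro sum.neutral) (auto simp: KN_def)
  finally show ?thesis .
qed

lemma sobolev_0: "L2 f \<Longrightarrow> sobolev 0 f"
  using Parseval by (auto simp: sobolev_def summable_on_def)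

lemma kap_ge: "k \<in> Zd \<Longrightarrow> k \<noteq> 0 \<Longrightarrow> (2 * pi)\<^sup>2 \<le> kap k"
proof -
  assume k: "k \<in> Zd" "k \<noteq> 0"
  then obtain i where i: "k $ i \<noteq> 0" by (auto simp: vec_eq_iff)
  obtain m where m: "k $ i = of_int m" using k by (auto simp: Zd_def elim: Ints_cases)
  then have "1 \<le> \<bar>k $ i\<bar>" using i by auto
  also have "\<dots> \<le> norm k" by (rule component_le_norm_cart)
  finally have "2 * pi * 1 \<le> 2 * pi * norm k" by (intro mult_left_mono) auto
  then show ?thesis unfolding kap_def by (intro power_mono) auto
qed

text \<open>A Hermitian family is itself the coefficient family of a test function, and testing with
  that one leaves a sum of squares. This turns weak equations into equations mode by mode.\<close>

lemma XN_coef_zero: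
  assumes sym: "\<And>k. c (- k) = cnj (c k)"
    and orth: "\<And>v. v \<in> XN N \<Longrightarrow> (\<Sum>k\<in>KN N. Re (c k * cnj (fcoef v k))) = 0" and k: "k \<in> KN N"
  shows "c k = 0"
proof -
  have "0 = (\<Sum>j\<in>KN N. Re (c j * cnj (fcoef (trig N c) j)))" using orth[OF trig_XN] by simp
  also have "\<dots> = (\<Sum>j\<in>KN N. (cmod (c j))\<^sup>2)"
  proof (intro sum.cong refl)
    fix j :: "real^'a" assume "j \<in> KN N"
    then have "fcoef (trig N c) j = c j" using KN_subset_Zd by (subst fcoef_trig_poly) (auto simp: sym)
    then show "Re (c j * cnj (fcoef (trig N c) j)) = (cmod (c j))\<^sup>2" by (simp only: Re_mult_cnj_self)
  qed
  finally have "\<forall>j\<in>KN N. (cmod (c j))\<^sup>2 = 0"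
    by (subst (asm) eq_commute, subst (asm) sum_nonneg_eq_0_iff) auto
  then show ?thesis using k by auto
qed

section \<open>The ground state: multiplier, boundedness and H^4 regularity\<close>

locale ground_state =
  fixes V u :: "real^'n \<Rightarrow> real" and Vmin :: real
  assumes dim: "CARD('n) \<le> 3" and V_reg: "sobolev 2 V" and Vmin: "0 < Vmin"
    and V_lower: "AE x in torus. Vmin \<le> V x"
    and u_min: "is_minimiser_on V Xsp u" and u_pos: "AE x in torus. 0 < u x"
begin

lemma summable_weights: "(\<lambda>k::real^'n. 1 / (wt k)\<^sup>2) summable_on Zd"
  by (rule summable_wt[OF dim])

definition Vb where "Vb = sqrt (lattice_sum TYPE('n) * sobolev_sq 2 V)"

lemma Vb_nonneg: "0 \<le> Vb" by (simp add: Vb_def)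

lemma V_bounded: "AE x in torus. \<bar>V x\<bar> \<le> Vb"
  unfolding Vb_def by (rule hreg2_bounded[OF summable_weights V_reg])

lemma V_meas [measurable]: "V \<in> borel_measurable torus"
  by (intro L2_meas sobolev_L2[OF V_reg])

lemma u_hreg1: "sobolev 1 u" using u_min by (simp add: is_minimiser_on_def Xsp_sobolev)
lemma u_L2: "L2 u" by (rule sobolev_L2[OF u_hreg1])
lemma u_meas [measurable]: "u \<in> borel_measurable torus" by (rule L2_meas[OF u_L2])
lemma nsq_u: "nsq u = 1" using u_min by (simp add: is_minimiser_on_def L2_norm_nsq)

text \<open>The Lagrange multiplier, found by testing with u; it exceeds twice the energy by half
  the integral of u^4.\<close>

definition lam where "lam = dirichlet u u + integral\<^sup>L torus (\<lambda>x. V x * (u x)\<^sup>2) + integral\<^sup>L torus (\<lambda>x. (u x)^4)"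

lemma EL:
  assumes "sobolev 1 \<phi>"
  shows "dirichlet u \<phi> + integral\<^sup>L torus (\<lambda>x. V x * (u x * \<phi> x)) + integral\<^sup>L torus (\<lambda>x. (u x)^3 * \<phi> x) = lam * ip u \<phi>"
  unfolding lam_def
  by (rule Euler_Lagrange[OF summable_weights V_meas V_bounded u_min])
     (use assms in \<open>auto simp: Xsp_sobolev intro: sobolev_add sobolev_cmult\<close>)

lemma lam_ge: "Vmin \<le> lam"
proof -
  have "Vmin * nsq u \<le> integral\<^sup>L torus (\<lambda>x. V x * (u x)\<^sup>2)"
    unfolding Bochner_Integration.integral_mult_right_zero[symmetric]
  proof (rule integral_mono_AE)
    show "integrable torus (\<lambda>x. V x * (u x)\<^sup>2)" by (intro integral_mult_bounded[OF _ V_meas V_bounded] L2_sq u_L2)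
    show "AE x in torus. Vmin * (u x)\<^sup>2 \<le> V x * (u x)\<^sup>2"
      using V_lower by eventually_elim (auto intro: mult_right_mono)
  qed (use L2_sq[OF u_L2] in auto)
  moreover have "0 \<le> integral\<^sup>L torus (\<lambda>x. (u x)^4)" by (intro integral_nonneg_AE) auto
  ultimately show ?thesis unfolding lam_def using dirichlet_nonneg[of u] by (simp only: nsq_u)
qed

lemma lam_pos: "0 < lam" using lam_ge Vmin by linarith

text \<open>Testing the equation with the positive part of \<open>u - sqrt lam\<close>.\<close>
lemma u_le: "AE x in torus. u x \<le> sqrt lam"
proof -
  define m where "m = sqrt lam"
  have m: "0 < m" "m\<^sup>2 = lam" using lam_pos by (auto simp: m_def)
  define v where "v = (\<lambda>x. m + (-1) * u x)"
  define \<phi> where "\<phi> = negpart v"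
  have v1: "sobolev 1 v" unfolding v_def by (intro sobolev_add sobolev_const sobolev_cmult u_hreg1)
  have \<phi>1: "sobolev 1 \<phi>" unfolding \<phi>_def by (rule sobolev_negpart[OF v1])
  have \<phi>L: "L2 \<phi>" by (rule sobolev_L2[OF \<phi>1])
  have [measurable]: "\<phi> \<in> borel_measurable torus" by (rule L2_meas[OF \<phi>L])
  have "dirichlet v \<phi> = dirichlet (\<lambda>x. m) \<phi> + (-1) * dirichlet u \<phi>"
    unfolding v_def by (rule dirichlet_add_scale[OF sobolev_const u_hreg1 \<phi>1])
  also have "dirichlet (\<lambda>x. m) \<phi> = 0" by (subst dirichlet_commute) (rule dirichlet_const_right)
  finally have D: "0 \<le> dirichlet u \<phi>" using dirichlet_negpart_le_0[OF v1] by (simp add: \<phi>_def)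
  have i1: "integrable torus (\<lambda>x. u x * \<phi> x)" by (intro L2_mult_integrable u_L2 \<phi>L)
  have i2: "integrable torus (\<lambda>x. V x * (u x * \<phi> x))" by (intro integral_mult_bounded[OF _ V_meas V_bounded] i1)
  have i3: "integrable torus (\<lambda>x. (u x)^3 * \<phi> x)"
    by (intro quartic_integrable(2) L4_embedding(1)[OF summable_weights] u_hreg1 \<phi>1) measurable
  have \<phi>0: "0 \<le> \<phi> x" for x by (simp add: \<phi>_def negpart_def)
  \<comment> \<open>Where \<phi> is positive, u^2 exceeds \<open>lam\<close>, so the cubic term
    alone absorbs the multiplier term. What V contributes on top, at least \<open>Vmin > 0\<close>
    times the integral of u \<phi>, forces that integral to vanish.\<close>
  have "Vmin * ip u \<phi> \<le> integral\<^sup>L torus (\<lambda>x. V x * (u x * \<phi> x))"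
    unfolding Bochner_Integration.integral_mult_right_zero[symmetric]
  proof (rule integral_mono_AE)
    show "AE x in torus. Vmin * (u x * \<phi> x) \<le> V x * (u x * \<phi> x)"
      using V_lower u_pos by eventually_elim (auto intro!: mult_right_mono mult_nonneg_nonneg \<phi>0)
  qed (use i1 i2 in auto)
  moreover have "lam * ip u \<phi> \<le> integral\<^sup>L torus (\<lambda>x. (u x)^3 * \<phi> x)"
    unfolding Bochner_Integration.integral_mult_right_zero[symmetric]
  proof (rule integral_mono_AE)
    show "AE x in torus. lam * (u x * \<phi> x) \<le> (u x)^3 * \<phi> x"
      using u_pos
    proof eventually_elim
      case (elim x)
      show ?case
      proof (cases "u x \<le> m")
        case True
        then have "\<phi> x = 0" by (simp add: \<phi>_def negpart_def v_def)
        then show ?thesis by simp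
      next
        case False
        then have "m\<^sup>2 \<le> (u x)\<^sup>2" using m by (intro power_mono) auto
        then have "m\<^sup>2 * (u x * \<phi> x) \<le> (u x)\<^sup>2 * (u x * \<phi> x)"
          using elim \<phi>0[of x] by (intro mult_right_mono) auto
        moreover have "(u x)\<^sup>2 * (u x * \<phi> x) = (u x)^3 * \<phi> x"
          by (simp add: power2_eq_square power3_eq_cube mult.assoc)
        ultimately show ?thesis by (simp only: m(2))
      qed
    qed
  qed (use i1 i3 in auto)
  ultimately have "Vmin * ip u \<phi> \<le> 0" using EL[OF \<phi>1] D by linarith
  then have le0: "ip u \<phi> \<le> 0" using Vmin by (simp add: mult_le_0_iff)
  have nn: "AE x in torus. 0 \<le> u x * \<phi> x" using u_pos by eventually_elim (simp add: \<phi>0)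
  then have "ip u \<phi> = 0" using le0 integral_nonneg_AE[OF nn] by linarith
  then have "AE x in torus. u x * \<phi> x = 0"
    using integral_nonneg_eq_0_iff_AE[OF i1 nn] by simp
  with u_pos show ?thesis
  proof eventually_elim
    case (elim x)
    then have "\<phi> x = 0" by simp
    then show ?case by (simp add: \<phi>_def negpart_def v_def m_def max_def split: if_splits)
  qed
qed

lemma u_bounded: "AE x in torus. \<bar>u x\<bar> \<le> sqrt lam"
  using u_le u_pos by eventually_elim auto

lemma u_sq_le: "AE x in torus. (u x)\<^sup>2 \<le> lam"
  using u_bounded
proof eventually_elim
  case (elim x)
  then show ?case using power_mono[of "\<bar>u x\<bar>" "sqrt lam" 2] lam_pos by simp
qed

text \<open>Minus the Laplacian of u, as the Euler-Lagrange equation expresses it.\<close>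

definition lap where "lap = (\<lambda>x. lam * u x - V x * u x - (u x)^3)"

lemma usq_L2: "L2 (\<lambda>x. (u x)\<^sup>2 * f x)" if "L2 f"
  by (rule L2_mult_bounded[OF that, of _ lam]) (use u_sq_le in auto)

lemma lap_L2: "L2 lap"
proof -
  have "L2 (\<lambda>x. (u x)^3)" using usq_L2[OF u_L2] by (simp add: power2_eq_square power3_eq_cube)
  then show ?thesis unfolding lap_def
    by (intro L2_diff L2_cmult L2_mult_bounded[OF _ V_meas V_bounded] u_L2)
qed

lemma ip_lap:
  assumes "sobolev 1 \<phi>"
  shows "ip lap \<phi> = dirichlet u \<phi>"
proof -
  have \<phi>: "L2 \<phi>" by (rule sobolev_L2[OF assms])
  then have [measurable]: "\<phi> \<in> borel_measurable torus" by (rule L2_meas)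
  have i1: "integrable torus (\<lambda>x. u x * \<phi> x)" by (intro L2_mult_integrable u_L2 \<phi>)
  have i2: "integrable torus (\<lambda>x. V x * (u x * \<phi> x))" by (intro integral_mult_bounded[OF _ V_meas V_bounded] i1)
  have i3: "integrable torus (\<lambda>x. (u x)^3 * \<phi> x)"
    by (intro quartic_integrable(2) L4_embedding(1)[OF summable_weights] u_hreg1 assms) measurable
  have "lap x * \<phi> x = lam * (u x * \<phi> x) - V x * (u x * \<phi> x) - (u x)^3 * \<phi> x" for x
    by (simp add: lap_def algebra_simps)
  then have "ip lap \<phi> = lam * ip u \<phi> - integral\<^sup>L torus (\<lambda>x. V x * (u x * \<phi> x)) - integral\<^sup>L torus (\<lambda>x. (u x)^3 * \<phi> x)"
    using i1 i2 i3 by simp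
  then show ?thesis using EL[OF assms] by simp
qed

lemma fcoef_lap:
  assumes "k \<in> Zd" shows "of_real (kap k) * fcoef u k = fcoef lap k"
proof -
  obtain N where N: "{k} \<subseteq> KN N" using finite_subset_KN[of "{k}"] assms by auto
  define c where "c = (\<lambda>j. of_real (kap j) * fcoef u j - fcoef lap j)"
  have "c k = 0"
  proof (rule XN_coef_zero[of c N])
    show "c (- j) = cnj (c j)" for j by (simp add: c_def fcoef_minus_freq)
    fix v :: "real^'n \<Rightarrow> real" assume v: "v \<in> XN N"
    have "(\<Sum>j\<in>KN N. Re (c j * cnj (fcoef v j))) = (\<Sum>j\<in>KN N. kap j * Re (fcoef u j * cnj (fcoef v j)) - Re (fcoef lap j * cnj (fcoef v j)))"
      by (intro sum.cong refl) (simp add: c_def algebra_simps)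
    also have "\<dots> = dirichlet u v - ip lap v"
      unfolding dirichlet_XN[OF v] ip_trig[OF L2_integrable[OF lap_L2] v] by (simp only: sum_subtractf)
    finally show "(\<Sum>j\<in>KN N. Re (c j * cnj (fcoef v j))) = 0"
      using ip_lap[OF sobolev_XN[OF v]] by simp
  qed (use N in auto)
  then show ?thesis by (simp add: c_def)
qed

lemma wt_fcoef_u: "k \<in> Zd \<Longrightarrow> of_real (wt k) * fcoef u k = fcoef (\<lambda>x. u x + lap x) k"
  using fcoef_lap[of k]
  by (simp add: fcoef_add L2_integrable u_L2 lap_L2 wt_def distrib_right)

lemma u_sobolev_Suc2:
  assumes "sobolev m (\<lambda>x. u x + lap x)" shows "sobolev (m + 2) u"
proof (rule hregI(1)[OF u_L2])
  fix F :: "(real^'n) set" assume F: "finite F" "F \<subseteq> Zd"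
  have "(\<Sum>k\<in>F. wt k ^ (m + 2) * (cmod (fcoef u k))\<^sup>2) = (\<Sum>k\<in>F. wt k ^ m * (cmod (fcoef (\<lambda>x. u x + lap x) k))\<^sup>2)"
  proof (intro sum.cong refl)
    fix k assume "k \<in> F"
    then have "k \<in> Zd" using F by auto
    from wt_fcoef_u[OF this, symmetric] show "wt k ^ (m + 2) * (cmod (fcoef u k))\<^sup>2 = wt k ^ m * (cmod (fcoef (\<lambda>x. u x + lap x) k))\<^sup>2"
      by (simp add: norm_mult power_mult_distrib power_add power2_eq_square)
  qed
  also have "\<dots> \<le> sobolev_sq m (\<lambda>x. u x + lap x)" by (rule sum_le_sobolev_sq[OF assms F])
  finally show "(\<Sum>k\<in>F. wt k ^ (m + 2) * (cmod (fcoef u k))\<^sup>2) \<le> sobolev_sq m (\<lambda>x. u x + lap x)" .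
qed

lemma u_hreg2: "sobolev 2 u"
  using u_sobolev_Suc2[OF sobolev_0[OF L2_add[OF u_L2 lap_L2]]] by (simp add: numeral_2_eq_2)

lemma usq_hreg2: "sobolev 2 (\<lambda>x. (u x)\<^sup>2)"
  unfolding power2_eq_square by (rule sobolev_mult[OF summable_weights u_hreg2 u_hreg2])

text \<open>Second round of elliptic regularity. Boundedness of u put \<open>lap\<close> in L^2 and
  u in H^2; now the algebra property, with V also in H^2, puts \<open>lap\<close> in H^2.\<close>

lemma u_hreg4: "sobolev 4 u"
proof -
  have "sobolev 2 (\<lambda>x. (u x)\<^sup>2 * u x)" by (rule sobolev_mult[OF summable_weights usq_hreg2 u_hreg2])
  then have "sobolev 2 (\<lambda>x. (u x)^3)" by (simp add: power2_eq_square power3_eq_cube)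
  then have "sobolev 2 lap" unfolding lap_def
    by (intro sobolev_diff sobolev_cmult u_hreg2 sobolev_mult[OF summable_weights V_reg u_hreg2])
  from u_sobolev_Suc2[OF sobolev_add[OF u_hreg2 this]] show ?thesis by simp
qed

section \<open>A positive lower bound for the ground state\<close>

text \<open>Chosen so that cc u + lap = u (1 + (Vb - V) + (lam - u^2)) >= u, which makes the
  resolvent of u at most u.\<close>

definition cc where "cc = 1 + Vb"

lemma cc_ge_1: "1 \<le> cc" using Vb_nonneg by (simp add: cc_def)

lemma wt_le_cc: "wt k \<le> cc + kap k" using cc_ge_1 by (simp add: wt_def)

lemma wt_le_cc_power: "wt k \<le> (cc + kap k) ^ Suc j"
proof -
  have "1 \<le> cc + kap k" using wt_le_cc[of k] wt_ge_1[of k] by linarith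
  then have "(cc + kap k) ^ 1 \<le> (cc + kap k) ^ Suc j" by (intro power_increasing) auto
  then show ?thesis using wt_le_cc[of k] by simp
qed

text \<open>The resolvent \<open>R = (cc - Laplacian)\<^sup>-\<^sup>1\<close> preserves positivity and \<open>R u \<le> u\<close>, hence \<open>R\<^sup>j u \<le> u\<close>.\<close>
lemma resolvent_iterate_le:
  "\<exists>v. L2 v \<and> (\<forall>k\<in>Zd. fcoef v k = fcoef u k / of_real ((cc + kap k) ^ j)) \<and> (AE x in torus. v x \<le> u x)
    \<and> (0 < j \<longrightarrow> (\<forall>x. v x \<ge> Re (fcoef u 0 / of_real (cc ^ j)) - infsum (\<lambda>k. cmod (fcoef u k / of_real ((cc + kap k) ^ j))) (Zd - {0})))"
proof (induction j)
  case 0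
  \<comment> \<open>At j = 0 the iterate is u itself; the pointwise lower bound is claimed only once
    the iterate is given by a convergent series.\<close>
  show ?case by (intro exI[of _ u]) (auto simp: u_L2)
next
  case (Suc j)
  then obtain v where v: "L2 v" "\<And>k. k \<in> Zd \<Longrightarrow> fcoef v k = fcoef u k / of_real ((cc + kap k) ^ j)" "AE x in torus. v x \<le> u x"
    by blast
  \<comment> \<open>Coefficients of the next iterate. A single resolvent factor already makes them
    absolutely summable, as |u_k| / wt k <= |u_k|^2 + 1 / (wt k)^2.\<close>
  define c where "c = (\<lambda>k. fcoef u k / complex_of_real ((cc + kap k) ^ Suc j))"
  have cpos: "0 < cc + kap k" for k using wt_le_cc[of k] wt_pos[of k] by linarith
  have cle: "cmod (c k) \<le> cmod (fcoef u k) / wt k" for k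
  proof -
    have "cmod (c k) = cmod (fcoef u k) / (cc + kap k) ^ Suc j"
      using zero_less_power[OF cpos[of k], of "Suc j"] by (simp only: c_def norm_divide norm_of_real abs_of_pos)
    also have "\<dots> \<le> cmod (fcoef u k) / wt k"
      by (intro divide_left_mono wt_le_cc_power mult_pos_pos wt_pos zero_less_power cpos) auto
    finally show ?thesis .
  qed
  have "(\<lambda>k. cmod (c k)) summable_on Zd"
  proof (rule summable_on_comparison_real)
    show "(\<lambda>k. (cmod (fcoef u k))\<^sup>2 + 1 / (wt k)\<^sup>2) summable_on Zd"
      using summable_weights Parseval[OF u_L2] by (intro summable_on_add) (auto simp: summable_on_def)
    fix k
    have "cmod (fcoef u k) * (1 / wt k) \<le> (cmod (fcoef u k))\<^sup>2 + (1 / wt k)\<^sup>2"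
    proof -
      have *: "a * b \<le> a\<^sup>2 + b\<^sup>2" if "0 \<le> a" "0 \<le> b" for a b :: real
        using sum_squares_bound[of a b] mult_nonneg_nonneg[OF that] by linarith
      show ?thesis by (rule *) auto
    qed
    then show "cmod (c k) \<le> (cmod (fcoef u k))\<^sup>2 + 1 / (wt k)\<^sup>2"
      using cle[of k] by (simp add: power_divide)
  qed auto
  moreover have "c (- k) = cnj (c k)" for k by (simp add: c_def fcoef_minus_freq)
  ultimately obtain w where w: "L2 w" "\<And>k. k \<in> Zd \<Longrightarrow> fcoef w k = c k"
    "\<And>x. w x \<ge> Re (c 0) - infsum (\<lambda>k. cmod (c k)) (Zd - {0})"
    using absolutely_convergent_series[of c] by blast
  have w1: "sobolev 1 w"
  proof (rule hregI(1)[OF w(1)])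
    fix F :: "(real^'n) set" assume F: "finite F" "F \<subseteq> Zd"
    have "(\<Sum>k\<in>F. wt k ^ 1 * (cmod (fcoef w k))\<^sup>2) \<le> (\<Sum>k\<in>F. wt k ^ 1 * (cmod (fcoef u k))\<^sup>2)"
    proof (intro sum_mono mult_left_mono power_mono)
      fix k assume "k \<in> F"
      then have "cmod (fcoef w k) \<le> cmod (fcoef u k) / wt k" using F w(2) cle by auto
      also have "\<dots> \<le> cmod (fcoef u k) / 1" by (intro divide_left_mono) auto
      finally show "cmod (fcoef w k) \<le> cmod (fcoef u k)" by simp
    qed auto
    also have "\<dots> \<le> sobolev_sq 1 u" by (rule sum_le_sobolev_sq[OF u_hreg1 F])
    finally show "(\<Sum>k\<in>F. wt k ^ 1 * (cmod (fcoef w k))\<^sup>2) \<le> sobolev_sq 1 u" .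
  qed
  define g where "g = (\<lambda>x. cc * u x + lap x)"
  have gL: "L2 g" unfolding g_def by (intro L2_add L2_cmult u_L2 lap_L2)
  have gu: "AE x in torus. u x \<le> g x"
    using u_pos u_sq_le V_bounded
  proof eventually_elim
    case (elim x)
    have "g x - u x = u x * ((Vb - V x) + (lam - (u x)\<^sup>2))"
      by (simp add: g_def lap_def cc_def power2_eq_square power3_eq_cube algebra_simps)
    also have "\<dots> \<ge> 0" using elim by (intro mult_nonneg_nonneg add_nonneg_nonneg) auto
    finally show ?case by simp
  qed
  \<comment> \<open>(cc - Laplacian) (u - w) = g - v, and g >= u >= v by the choice of
    \<open>cc\<close> and the induction hypothesis.\<close>
  have "AE x in torus. 0 \<le> (\<lambda>x. u x - w x) x"
  proof (rule weak_maximum_principle)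
    show "sobolev 1 (\<lambda>x. u x - w x)" by (intro sobolev_diff u_hreg1 w1)
    show "L2 (\<lambda>x. g x - v x)" by (intro L2_diff gL v)
    show "AE x in torus. 0 \<le> g x - v x" using gu v(3) by eventually_elim auto
    show "0 < cc" using cc_ge_1 by linarith
    fix k :: "real^'n" assume k: "k \<in> Zd"
    have nz: "complex_of_real (cc + kap k) \<noteq> 0" using cpos[of k] by (simp only: of_real_eq_0_iff)
    have "fcoef (\<lambda>x. g x - v x) k = of_real cc * fcoef u k + fcoef lap k - fcoef v k"
      unfolding g_def by (simp add: fcoef_diff fcoef_add fcoef_cmult L2_integrable L2_add L2_cmult u_L2 lap_L2 v)
    also have "\<dots> = of_real (cc + kap k) * fcoef u k - fcoef u k / of_real ((cc + kap k) ^ j)"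
      using fcoef_lap[OF k] v(2)[OF k] by (simp add: distrib_right)
    also have "fcoef u k / of_real ((cc + kap k) ^ j) = of_real (cc + kap k) * c k"
      using nz by (simp add: c_def divide_simps)
    also have "of_real (cc + kap k) * fcoef u k - of_real (cc + kap k) * c k = of_real (cc + kap k) * fcoef (\<lambda>x. u x - w x) k"
      by (simp add: fcoef_diff L2_integrable u_L2 w k right_diff_distrib)
    finally show "of_real (cc + kap k) * fcoef (\<lambda>x. u x - w x) k = fcoef (\<lambda>x. g x - v x) k" ..
  qed
  then have "AE x in torus. w x \<le> u x" by eventually_elim simp
  moreover have "\<forall>x. w x \<ge> Re (fcoef u 0 / of_real (cc ^ Suc j)) - infsum (\<lambda>k. cmod (fcoef u k / of_real ((cc + kap k) ^ Suc j))) (Zd - {0})"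
    using w(3) unfolding c_def by (simp only: kap_0 add_0_right) blast
  ultimately show ?case
    using w(1,2) unfolding c_def by blast
qed

text \<open>High powers of the resolvent flatten u: relative to the zero mode, every other mode is
  damped by at least a factor \<theta> < 1 per step. Once the other modes sum to at most half of the
  zero mode, which is a positive mean, the iterate is bounded below, and so is u.\<close>

lemma u_lower_bound: obtains c0 where "0 < c0" "AE x in torus. c0 \<le> u x"
proof -
  define I where "I = integral\<^sup>L torus u"
  have I0: "0 \<le> I" unfolding I_def by (intro integral_nonneg_AE) (use u_pos in \<open>auto elim!: eventually_mono\<close>)
  have "I \<noteq> 0"
  proof
    assume "I = 0"
    moreover have "AE x in torus. 0 \<le> u x" using u_pos by eventually_elim simp
    ultimately have "AE x in torus. u x = 0"
      unfolding I_def using integral_nonneg_eq_0_iff_AE[OF L2_integrable[OF u_L2]] by blast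
    from nsq_u have "nsq u = 1" .
    moreover have "nsq u = integral\<^sup>L torus (\<lambda>x::real^'n. 0)"
      by (rule integral_cong_AE) (use \<open>AE x in torus. u x = 0\<close> in \<open>auto elim!: eventually_mono\<close>)
    ultimately show False by simp
  qed
  then have I: "0 < I" using I0 by simp
  have uI: "cmod (fcoef u k) \<le> I" for k
  proof -
    have "cmod (fcoef u k) \<le> integral\<^sup>L torus (\<lambda>x. \<bar>u x\<bar>)" by (rule norm_fcoef_le)
    also have "\<dots> = I" unfolding I_def by (rule integral_cong_AE) (use u_pos in \<open>auto elim!: eventually_mono\<close>)
    finally show ?thesis .
  qed
  \<comment> \<open>The weakest damping occurs at the smallest nonzero value of \<open>kap\<close>,
    which is at least (2 pi)^2.\<close>
  define \<theta> where "\<theta> = cc / (cc + (2 * pi)\<^sup>2)"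
  have pi0: "(2 * pi)\<^sup>2 > 0" by simp
  have cc0: "0 < cc" using cc_ge_1 by linarith
  have \<theta>: "0 < \<theta>" "\<theta> < 1" using cc0 pi0 by (auto simp: \<theta>_def divide_less_eq add_pos_pos)
  have "(\<lambda>m. \<theta> ^ m * (cc\<^sup>2 * lattice_sum TYPE('n))) \<longlonglongrightarrow> 0 * (cc\<^sup>2 * lattice_sum TYPE('n))"
    using \<theta> by (intro tendsto_intros LIMSEQ_realpow_zero) auto
  then have "eventually (\<lambda>m. \<theta> ^ m * (cc\<^sup>2 * lattice_sum TYPE('n)) < 1/2) sequentially"
    by (intro order_tendstoD(2)[of _ 0]) auto
  then obtain m where m: "\<theta> ^ m * (cc\<^sup>2 * lattice_sum TYPE('n)) < 1/2" by (auto simp: eventually_sequentially)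
  \<comment> \<open>Two of the J factors are set aside for the convergence of the lattice
    sum.\<close>
  define J where "J = m + 2"
  obtain v where v: "AE x in torus. v x \<le> u x"
    "\<And>x. v x \<ge> Re (fcoef u 0 / of_real (cc ^ J)) - infsum (\<lambda>k. cmod (fcoef u k / of_real ((cc + kap k) ^ J))) (Zd - {0})"
    using resolvent_iterate_le[of J] by (auto simp: J_def)
  have bnd: "cmod (fcoef u k / of_real ((cc + kap k) ^ J)) \<le> (I / cc ^ J * (\<theta> ^ m * cc\<^sup>2)) * (1 / (wt k)\<^sup>2)" if k: "k \<in> Zd" "k \<noteq> 0" for k
  proof -
    have p: "0 < cc + kap k" using cc0 kap_nonneg[of k] by linarith
    have "cmod (fcoef u k / of_real ((cc + kap k) ^ J)) = cmod (fcoef u k) / (cc + kap k) ^ J"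
      using zero_less_power[OF p, of J] by (simp only: norm_divide norm_of_real abs_of_pos)
    also have "\<dots> \<le> I / (cc + kap k) ^ J" using p by (intro divide_right_mono uI) auto
    also have "\<dots> = I / cc ^ J * ((cc / (cc + kap k)) ^ m * (cc / (cc + kap k))\<^sup>2)"
    proof -
      have "(cc / (cc + kap k)) ^ m * (cc / (cc + kap k))\<^sup>2 = (cc / (cc + kap k)) ^ J"
        by (simp only: J_def power_add)
      also have "\<dots> = cc ^ J / (cc + kap k) ^ J" by (rule power_divide)
      finally show ?thesis using cc0 by simp
    qed
    also have "\<dots> \<le> I / cc ^ J * (\<theta> ^ m * (cc / wt k)\<^sup>2)"
    proof (intro mult_left_mono mult_mono power_mono)
      show "cc / (cc + kap k) \<le> \<theta>" unfolding \<theta>_def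
        by (intro divide_left_mono add_left_mono kap_ge[OF k] mult_pos_pos p add_pos_pos[OF cc0 pi0])
           (use cc0 in auto)
      show "cc / (cc + kap k) \<le> cc / wt k"
        using cc0 p by (intro divide_left_mono wt_le_cc mult_pos_pos) auto
    qed (use cc0 p I \<theta> in auto)
    also have "\<dots> = (I / cc ^ J * (\<theta> ^ m * cc\<^sup>2)) * (1 / (wt k)\<^sup>2)" by (simp add: power_divide)
    finally show ?thesis .
  qed
  have A0: "0 \<le> I / cc ^ J * (\<theta> ^ m * cc\<^sup>2)" using I cc0 \<theta> by simp
  have fin: "(\<Sum>k\<in>F. cmod (fcoef u k / of_real ((cc + kap k) ^ J))) \<le> I / cc ^ J * (\<theta> ^ m * cc\<^sup>2) * lattice_sum TYPE('n)"
    if F: "finite F" "F \<subseteq> Zd - {0}" for F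
  proof -
    have "(\<Sum>k\<in>F. cmod (fcoef u k / of_real ((cc + kap k) ^ J))) \<le> (\<Sum>k\<in>F. (I / cc ^ J * (\<theta> ^ m * cc\<^sup>2)) * (1 / (wt k)\<^sup>2))"
      using F by (intro sum_mono bnd) auto
    also have "\<dots> = (I / cc ^ J * (\<theta> ^ m * cc\<^sup>2)) * (\<Sum>k\<in>F. 1 / (wt k)\<^sup>2)" by (simp only: sum_distrib_left)
    also have "\<dots> \<le> (I / cc ^ J * (\<theta> ^ m * cc\<^sup>2)) * lattice_sum TYPE('n)"
      unfolding lattice_sum_def using F by (intro mult_left_mono finite_sum_le_infsum summable_weights A0) auto
    finally show ?thesis .
  qed
  have "(\<lambda>k. cmod (fcoef u k / of_real ((cc + kap k) ^ J))) summable_on (Zd - {0})"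
    using fin by (intro nonneg_bdd_above_summable_on bdd_aboveI2) auto
  then have "infsum (\<lambda>k. cmod (fcoef u k / of_real ((cc + kap k) ^ J))) (Zd - {0}) \<le> I / cc ^ J * (\<theta> ^ m * cc\<^sup>2) * lattice_sum TYPE('n)"
    by (rule infsum_le_finite_sums) (use fin in auto)
  also have "\<dots> = I / cc ^ J * (\<theta> ^ m * (cc\<^sup>2 * lattice_sum TYPE('n)))" by (simp only: mult.assoc)
  also have "\<dots> \<le> I / cc ^ J * (1 / 2)" using m I cc0 by (intro mult_left_mono) auto
  finally have low: "v x \<ge> I / cc ^ J / 2" for x
    using v(2)[of x] fcoef_0[of u] by (simp add: I_def flip: of_real_power of_real_divide)
  have "AE x in torus. I / cc ^ J / 2 \<le> u x"
    using v(1) by eventually_elim (rule order_trans[OF low])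
  moreover have "0 < I / cc ^ J / 2" using I cc0 by simp
  ultimately show ?thesis using that by blast
qed

end

subsection \<open>Linear problems on finite-dimensional function spaces\<close>

inductive_set lin :: "('a \<Rightarrow> real) set \<Rightarrow> ('a \<Rightarrow> real) set" for F where
  zero: "(\<lambda>x. 0) \<in> lin F"
| step: "f \<in> F \<Longrightarrow> g \<in> lin F \<Longrightarrow> (\<lambda>x. g x + c * f x) \<in> lin F"

lemma lin_add_scale:
  assumes "f \<in> lin F" "g \<in> lin F" shows "(\<lambda>x. f x + c * g x) \<in> lin F"
  using assms(2)
proof induction
  case zero
  then show ?case using assms(1) by simp
next
  case (step h g d)
  from lin.step[OF step(1) step(3), of "c * d"]
  show ?case by (simp add: distrib_left add.assoc mult.assoc)
qed

lemma lin_base: "f \<in> F \<Longrightarrow> f \<in> lin F"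
  using lin.step[OF _ lin.zero, of f F 1] by simp

lemma lin_cmult: "f \<in> lin F \<Longrightarrow> (\<lambda>x. c * f x) \<in> lin F"
  using lin_add_scale[OF lin.zero, of f F c] by simp

lemma lin_sum: "(\<And>i. i \<in> I \<Longrightarrow> f i \<in> lin F) \<Longrightarrow> (\<lambda>x. \<Sum>i\<in>I. f i x) \<in> lin F"
proof (induction I rule: infinite_finite_induct)
  case (insert i I)
  then show ?case using lin_add_scale[of "\<lambda>x. \<Sum>i\<in>I. f i x" F "f i" 1] by (simp add: add.commute)
qed (auto intro: lin.zero)

lemma lin_mono: "F \<subseteq> G \<Longrightarrow> f \<in> lin F \<Longrightarrow> f \<in> lin G"
  by (rotate_tac, induction rule: lin.induct) (auto intro: lin.intros)

lemma lin_insert: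
  assumes "f \<in> lin (insert a F)"
  obtains w c where "w \<in> lin F" "f = (\<lambda>x. w x + c * a x)"
proof -
  have "\<exists>w c. w \<in> lin F \<and> f = (\<lambda>x. w x + c * a x)"
    using assms
  proof induction
    case zero
    then show ?case by (intro exI[of _ "\<lambda>x. 0"] exI[of _ 0]) (auto intro: lin.zero)
  next
    case (step h g d)
    then obtain w c where w: "w \<in> lin F" "g = (\<lambda>x. w x + c * a x)" by blast
    show ?case
    proof (cases "h = a")
      case True
      then show ?thesis using w by (intro exI[of _ w] exI[of _ "c + d"]) (auto simp: algebra_simps)
    next
      case False
      then have "h \<in> F" using step by simp
      from lin.step[OF this w(1), of d] show ?thesis using w
        by (intro exI[of _ "\<lambda>x. w x + d * h x"] exI[of _ c]) (auto simp: algebra_simps)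
    qed
  qed
  with that show ?thesis by blast
qed

lemma lin_subset:
  assumes "F \<subseteq> Y" "(\<lambda>x. 0) \<in> Y" "\<And>f g c. f \<in> Y \<Longrightarrow> g \<in> Y \<Longrightarrow> (\<lambda>x. f x + c * g x) \<in> Y"
  shows "f \<in> lin F \<Longrightarrow> f \<in> Y"
  by (induction rule: lin.induct) (use assms in auto)

text \<open>A finite-dimensional Lax-Milgram lemma, by adding one generator a at a time: the part h
  of a that is B-orthogonal to the old span corrects the old solution z. If
  \<open>B h h = 0\<close>, definiteness shows that a was already in the span.\<close>

lemma Riesz_lin:
  fixes B :: "('a \<Rightarrow> real) \<Rightarrow> ('a \<Rightarrow> real) \<Rightarrow> real"
  assumes F: "finite F" "F \<subseteq> Y" and Y: "(\<lambda>x. 0) \<in> Y" "\<And>f g c. f \<in> Y \<Longrightarrow> g \<in> Y \<Longrightarrow> (\<lambda>x. f x + c * g x) \<in> Y"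
    and lin1: "\<And>f g h c. f \<in> Y \<Longrightarrow> g \<in> Y \<Longrightarrow> h \<in> Y \<Longrightarrow> B (\<lambda>x. f x + c * g x) h = B f h + c * B g h"
    and lin2: "\<And>f g h c. f \<in> Y \<Longrightarrow> g \<in> Y \<Longrightarrow> h \<in> Y \<Longrightarrow> B h (\<lambda>x. f x + c * g x) = B h f + c * B h g"
    and def: "\<And>f. f \<in> Y \<Longrightarrow> B f f = 0 \<Longrightarrow> f = (\<lambda>x. 0)"
    and l: "\<And>f g c. f \<in> Y \<Longrightarrow> g \<in> Y \<Longrightarrow> l (\<lambda>x. f x + c * g x) = l f + c * l g"
  shows "\<exists>\<psi>\<in>lin F. \<forall>v\<in>lin F. B \<psi> v = l v"
  using F l
proof (induction arbitrary: l rule: finite_induct)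
  case empty
  have eq: "v = (\<lambda>x. 0)" if "v \<in> lin {}" for v :: "'a \<Rightarrow> real"
    using that by induction auto
  have "B (\<lambda>x. 0) (\<lambda>x. 0) = 0" using lin1[OF Y(1) Y(1) Y(1), of 1] by simp
  moreover have "l (\<lambda>x. 0) = 0" using empty(2)[OF Y(1) Y(1), of 1] by simp
  ultimately show ?case using eq lin.zero by metis
next
  case (insert a F)
  have aY: "a \<in> Y" and FY: "F \<subseteq> Y" using insert by auto
  have inY: "f \<in> Y" if "f \<in> lin F" for f using lin_subset[OF FY Y that] .
  \<comment> \<open>The induction hypothesis, used for the functional \<open>B a\<close>, supplies
    the projection of a onto the old span.\<close>
  obtain y where y: "y \<in> lin F" "\<And>v. v \<in> lin F \<Longrightarrow> B y v = B a v"
    using insert.IH[OF FY, of "B a"] lin2[OF _ _ aY] by blast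
  obtain z where z: "z \<in> lin F" "\<And>v. v \<in> lin F \<Longrightarrow> B z v = l v"
    using insert.IH[OF FY, of l] insert.prems(2) by blast
  define h where "h = (\<lambda>x. a x + (-1) * y x)"
  have hY: "h \<in> Y" unfolding h_def by (intro Y(2) aY inY y)
  have h0: "B h v = 0" if "v \<in> lin F" for v
    unfolding h_def using lin1[OF aY inY[OF y(1)] inY[OF that], of "-1"] y(2)[OF that] by simp
  have hh: "B h h = B h a"
  proof -
    have "B h h = B h a + (-1) * B h y" by (subst (2) h_def) (rule lin2[OF aY inY[OF y(1)] hY])
    then show ?thesis using h0[OF y(1)] by simp
  qed
  show ?case
  proof (cases "B h h = 0")
    case True
    then have "h = (\<lambda>x. 0)" by (rule def[OF hY])
    then have ay: "a = y" by (auto simp: h_def fun_eq_iff)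
    have "v \<in> lin F" if "v \<in> lin (insert a F)" for v
      using that by (rule lin_insert) (use ay y in \<open>auto intro: lin_add_scale\<close>)
    then show ?thesis using z lin_mono[of F "insert a F" z] by blast
  next
    case False
    define t where "t = (l a - B z a) / B h a"
    define \<psi> where "\<psi> = (\<lambda>x. z x + t * h x)"
    have hl: "h \<in> lin (insert a F)" unfolding h_def
      by (intro lin_add_scale lin_base lin_mono[of F "insert a F" y] y) auto
    have \<psi>l: "\<psi> \<in> lin (insert a F)" unfolding \<psi>_def
      by (intro lin_add_scale hl lin_mono[of F "insert a F" z] z) auto
    have \<psi>Y: "\<psi> \<in> Y" unfolding \<psi>_def by (intro Y(2) inY z hY)
    have "B \<psi> v = l v" if "v \<in> lin (insert a F)" for v
    proof -
      obtain w c where w: "w \<in> lin F" "v = (\<lambda>x. w x + c * a x)" using lin_insert[OF \<open>v \<in> _\<close>] by blast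
      have "B \<psi> w = l w"
        unfolding \<psi>_def using lin1[OF inY[OF z(1)] hY inY[OF w(1)], of t] z(2)[OF w(1)] h0[OF w(1)] by simp
      moreover have "B \<psi> a = l a"
        unfolding \<psi>_def using lin1[OF inY[OF z(1)] hY aY, of t] False hh by (simp add: t_def)
      ultimately show ?thesis
        unfolding w(2) lin2[OF inY[OF w(1)] aY \<psi>Y] insert.prems(2)[OF inY[OF w(1)] aY] by simp
    qed
    then show ?thesis using \<psi>l by blast
  qed
qed

text \<open>Finitely many real generators of X_N, to which \<open>Riesz_lin\<close> can be
  applied.\<close>

definition real_waves :: "nat \<Rightarrow> (real^'n \<Rightarrow> real) set" where
  "real_waves N = (\<lambda>k x. cos (2 * pi * (k \<bullet> x))) ` KN N \<union> (\<lambda>k x. sin (2 * pi * (k \<bullet> x))) ` KN N"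

lemma XN_add_scale: "f \<in> XN N \<Longrightarrow> g \<in> XN N \<Longrightarrow> (\<lambda>x. f x + c * g x) \<in> XN N"
  by (intro XN_add XN_cmult)

lemma lin_real_waves: "lin (real_waves N) = XN N"
proof (intro equalityI subsetI)
  fix f :: "real^'n \<Rightarrow> real" assume "f \<in> lin (real_waves N)"
  then show "f \<in> XN N"
    by (rule lin_subset[rotated -1]) (auto simp: real_waves_def intro: cos_in_XN sin_in_XN XN_const XN_add_scale)
next
  fix f :: "real^'n \<Rightarrow> real" assume f: "f \<in> XN N"
  have eq: "f = (\<lambda>x. (\<Sum>k\<in>KN N. Re (fcoef f k) * cos (2 * pi * (k \<bullet> x))) + (-1) * (\<Sum>k\<in>KN N. Im (fcoef f k) * sin (2 * pi * (k \<bullet> x))))"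
  proof
    fix x
    have "Re (complex_of_real (f x)) = Re (\<Sum>k\<in>KN N. fcoef f k * cis (2 * pi * (k \<bullet> x)))"
      using XN_expansion[OF f, of x] by (simp only:)
    then show "f x = (\<Sum>k\<in>KN N. Re (fcoef f k) * cos (2 * pi * (k \<bullet> x))) + (-1) * (\<Sum>k\<in>KN N. Im (fcoef f k) * sin (2 * pi * (k \<bullet> x)))"
      by (simp add: sum_subtractf)
  qed
  have "(\<lambda>x. (\<Sum>k\<in>KN N. Re (fcoef f k) * cos (2 * pi * (k \<bullet> x))) + (-1) * (\<Sum>k\<in>KN N. Im (fcoef f k) * sin (2 * pi * (k \<bullet> x)))) \<in> lin (real_waves N)"
    by (intro lin_add_scale lin_sum lin_cmult lin_base) (auto simp: real_waves_def)
  then show "f \<in> lin (real_waves N)" by (simp only: eq[symmetric])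
qed

text \<open>Only the zero mode of the constant survives, and the kernel is normalised there. In
  Picone's identity this evaluates the terms containing f^2.\<close>

lemma kernel_form_one: "kernel_form n f (\<lambda>x. 1) = integral\<^sup>L torus f"
proof -
  have "kernel_form n f (\<lambda>x. 1) = (\<Sum>k\<in>{0}. kernel_coef n k * Re (fcoef f k * cnj (fcoef (\<lambda>x. 1) k)))"
    unfolding kernel_form_def
  proof (rule sum.mono_neutral_right[OF finite_lattice_box])
    show "{0} \<subseteq> lattice_box n" by (simp add: lattice_box_def)
    show "\<forall>k\<in>lattice_box n - {0}. kernel_coef n k * Re (fcoef f k * cnj (fcoef (\<lambda>x. 1) k)) = 0"
      by (auto simp: lattice_box_def fcoef_const)
  qed
  then show ?thesis by (simp add: fcoef_0[of f] fcoef_const)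
qed

subsection \<open>Spectral gap\<close>

context ground_state
begin

definition c0 where "c0 = (SOME c. 0 < c \<and> (AE x in torus. c \<le> u x))"

lemma c0: "0 < c0" "AE x in torus. c0 \<le> u x"
proof -
  have "0 < c0 \<and> (AE x in torus. c0 \<le> u x)"
    unfolding c0_def by (rule someI_ex) (use u_lower_bound in blast)
  then show "0 < c0" "AE x in torus. c0 \<le> u x" by auto
qed

definition Q where
  "Q \<phi> = dirichlet \<phi> \<phi> + integral\<^sup>L torus (\<lambda>x. V x * (\<phi> x)\<^sup>2) + integral\<^sup>L torus (\<lambda>x. (u x)\<^sup>2 * (\<phi> x)\<^sup>2) - lam * nsq \<phi>"

text \<open>Thanks to the equation for u, the form can be evaluated against an h that is merely
  square integrable, such as \<phi>^2 / u.\<close>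

lemma dirichlet_u_right:
  assumes "L2 h" shows "dirichlet h u = ip h lap"
proof -
  have "((\<lambda>k. Re (fcoef h k * cnj (fcoef lap k))) has_sum ip h lap) Zd" by (rule Parseval_ip[OF assms lap_L2])
  moreover have "Re (fcoef h k * cnj (fcoef lap k)) = kap k * Re (fcoef h k * cnj (fcoef u k))" if "k \<in> Zd" for k
    unfolding fcoef_lap[OF that, symmetric] by (simp add: algebra_simps)
  ultimately have "((\<lambda>k. kap k * Re (fcoef h k * cnj (fcoef u k))) has_sum ip h lap) Zd"
    by (simp cong: has_sum_cong)
  then show ?thesis unfolding dirichlet_def by (rule infsumI)
qed

text \<open>Jacobi's (Picone's) identity: writing \<open>\<phi> = u f\<close>, the form \<open>Q \<phi>\<close> equals the integral of
  \<open>u\<^sup>2 |grad f|\<^sup>2\<close>; here the pointwise inequality is applied under the positive kernel.\<close>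
lemma Picone:
  assumes \<phi>: "\<phi> \<in> XN N" and F: "finite F" "F \<subseteq> Zd"
  shows "(\<Sum>k\<in>F. kap k * (cmod (fcoef (\<lambda>x. \<phi> x / u x) k))\<^sup>2) \<le> Q \<phi> / c0\<^sup>2"
proof -
  define f where "f = (\<lambda>x. \<phi> x / u x)"
  define h where "h = (\<lambda>x. (\<phi> x)\<^sup>2 / u x)"
  define f2 where "f2 = (\<lambda>x. (f x)\<^sup>2)"
  have \<phi>L: "L2 \<phi>" by (rule XN_L2[OF \<phi>])
  have [measurable]: "\<phi> \<in> borel_measurable torus" by (rule L2_meas[OF \<phi>L])
  obtain B where B: "\<And>x. x \<in> Omega \<Longrightarrow> \<bar>\<phi> x\<bar> \<le> B"
    using trig_poly_bounded[of \<phi>] \<phi> by (auto simp: trig_poly_def)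
  have fB: "AE x in torus. \<bar>f x\<bar> \<le> B / c0"
    using c0(2) AE_space
  proof eventually_elim
    case (elim x)
    then have "\<bar>f x\<bar> = \<bar>\<phi> x\<bar> / u x" using c0(1) by (simp add: f_def)
    also have "\<dots> \<le> B / c0" using elim B[of x] c0(1) by (intro frac_le) auto
    finally show ?case .
  qed
  have fm [measurable]: "f \<in> borel_measurable torus" unfolding f_def by measurable
  have fL: "L2 f" by (rule L2_bounded[OF fm fB])
  have f2L: "L2 f2" unfolding f2_def power2_eq_square by (rule L2_mult_bounded[OF fL fm fB])
  have hL: "L2 h"
  proof -
    have "h = (\<lambda>x. f x * \<phi> x)" by (rule ext) (simp add: h_def f_def power2_eq_square)
    then show ?thesis using L2_mult_bounded[OF \<phi>L fm fB] by simp
  qed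
  have pos: "AE x in torus. 0 < u x" by (rule u_pos)
  have ker: "c0\<^sup>2 * (nsq f - kernel_form n f f) \<le> (nsq \<phi> - kernel_form n \<phi> \<phi>) - (ip h u - kernel_form n h u)" for n
  proof -
    \<comment> \<open>The six products add up to (u(x) u(y) - c0^2) (f(x) - f(y))^2, nonnegative
      because u >= c0. Replacing the weight u(x) u(y) by the constant c0^2 leaves the Dirichlet form
      of f itself.\<close>
    let ?f = "\<lambda>i::nat. [h, u, \<phi>, f2, \<lambda>x. 1, f] ! i"
    let ?g = "\<lambda>i::nat. [u, h, \<lambda>x. -2 * \<phi> x, \<lambda>x. - c0\<^sup>2 * 1, \<lambda>x. - c0\<^sup>2 * f2 x, \<lambda>x. 2 * c0\<^sup>2 * f x] ! i"
    have "0 \<le> (\<Sum>i\<in>{0,1,2,3,4,5}. kernel_form n (?f i) (?g i))"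
    proof (rule kernel_form_sum_nonneg)
      show "L2 (?f i)" if "i \<in> {0,1,2,3,4,5}" for i
        using that u_L2 \<phi>L fL f2L hL L2_const by auto
      show "L2 (?g i)" if "i \<in> {0,1,2,3,4,5}" for i
        using that u_L2 hL L2_const[of "- c0\<^sup>2 * 1"] L2_cmult[OF \<phi>L, of "-2"] L2_cmult[OF fL, of "2 * c0\<^sup>2"] L2_cmult[OF f2L, of "- c0\<^sup>2"] by auto
      show "AE y in torus. AE x in torus. 0 \<le> (\<Sum>i\<in>{0,1,2,3,4,5}. ?f i x * ?g i y)"
        using c0(2)
      proof eventually_elim
        case y: (elim y)
        show ?case using c0(2)
        proof eventually_elim
          case (elim x)
          have px: "0 < u x" "0 < u y" using elim y c0(1) by auto
          have e1: "h x = u x * (f x)\<^sup>2" "h y = u y * (f y)\<^sup>2" "\<phi> x = u x * f x" "\<phi> y = u y * f y"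
            using px by (auto simp: h_def f_def power2_eq_square field_simps)
          have "(\<Sum>i\<in>{0,1,2,3,4,5}. ?f i x * ?g i y) = (u x * u y - c0\<^sup>2) * (f x - f y)\<^sup>2"
            unfolding f2_def by (simp add: e1) (simp add: power2_eq_square algebra_simps)
          moreover have "c0\<^sup>2 \<le> u x * u y"
            unfolding power2_eq_square using elim y c0(1) px by (intro mult_mono) auto
          ultimately show ?case by simp
        qed
      qed
    qed simp
    also have "(\<Sum>i\<in>{0,1,2,3,4,5}. kernel_form n (?f i) (?g i)) = kernel_form n h u + kernel_form n u h - 2 * kernel_form n \<phi> \<phi> - c0\<^sup>2 * kernel_form n f2 (\<lambda>x. 1) - c0\<^sup>2 * kernel_form n (\<lambda>x. 1) f2 + 2 * c0\<^sup>2 * kernel_form n f f"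
      using kernel_form_cmult_right[of n \<phi> "-2" \<phi>] kernel_form_cmult_right[of n f2 "- c0\<^sup>2" "\<lambda>x. 1"] kernel_form_cmult_right[of n "\<lambda>x. 1" "- c0\<^sup>2" f2] kernel_form_cmult_right[of n f "2 * c0\<^sup>2" f]
      by simp
    finally have "0 \<le> kernel_form n h u - kernel_form n \<phi> \<phi> - c0\<^sup>2 * nsq f + c0\<^sup>2 * kernel_form n f f"
      using kernel_form_commute[of n u h] kernel_form_commute[of n "\<lambda>x. 1" f2] kernel_form_one[of n f2] by (simp add: f2_def)
    moreover have "ip h u = nsq \<phi>"
    proof (rule integral_cong_AE)
      show "AE x in torus. h x * u x = (\<phi> x)\<^sup>2" using pos by eventually_elim (simp add: h_def)
      show "(\<lambda>x. h x * u x) \<in> borel_measurable torus" unfolding h_def by measurable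
    qed measurable
    ultimately show ?thesis by (simp add: algebra_simps)
  qed
  \<comment> \<open>h is known only in L^2, so its limit is taken with the orders 0 and 2.\<close>
  have lim: "(\<lambda>n. ((2 * pi)\<^sup>2 * (real n * (ip \<phi> \<phi> - kernel_form n \<phi> \<phi>)) - (2 * pi)\<^sup>2 * (real n * (ip h u - kernel_form n h u))) / c0\<^sup>2) \<longlonglongrightarrow> (dirichlet \<phi> \<phi> - dirichlet h u) / c0\<^sup>2"
    using c0(1) by (intro tendsto_intros kernel_form_limit[OF sobolev_XN[OF \<phi>, of 1] sobolev_XN[OF \<phi>, of 1]] kernel_form_limit[OF sobolev_0[OF hL] u_hreg2]) auto
  have "(\<Sum>k\<in>F. kap k * (cmod (fcoef f k))\<^sup>2) \<le> (dirichlet \<phi> \<phi> - dirichlet h u) / c0\<^sup>2"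
  proof (rule dirichlet_partial_sum_le[OF fL F _ lim])
    fix n :: nat
    have "(2 * pi)\<^sup>2 * real n * (c0\<^sup>2 * (nsq f - kernel_form n f f)) \<le> (2 * pi)\<^sup>2 * real n * ((nsq \<phi> - kernel_form n \<phi> \<phi>) - (ip h u - kernel_form n h u))"
      by (intro mult_left_mono ker) auto
    then show "(2 * pi)\<^sup>2 * (real n * (nsq f - kernel_form n f f)) \<le> ((2 * pi)\<^sup>2 * (real n * (ip \<phi> \<phi> - kernel_form n \<phi> \<phi>)) - (2 * pi)\<^sup>2 * (real n * (ip h u - kernel_form n h u))) / c0\<^sup>2"
      unfolding pos_le_divide_eq[OF zero_less_power[OF c0(1), of 2]] nsq_ip[of \<phi>] by (simp add: algebra_simps)
  qed
  moreover have "dirichlet h u = lam * nsq \<phi> - integral\<^sup>L torus (\<lambda>x. V x * (\<phi> x)\<^sup>2) - integral\<^sup>L torus (\<lambda>x. (u x)\<^sup>2 * (\<phi> x)\<^sup>2)"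
  proof -
    have "ip h lap = integral\<^sup>L torus (\<lambda>x. lam * (\<phi> x)\<^sup>2 - V x * (\<phi> x)\<^sup>2 - (u x)\<^sup>2 * (\<phi> x)\<^sup>2)"
    proof (rule integral_cong_AE)
      show "AE x in torus. h x * lap x = lam * (\<phi> x)\<^sup>2 - V x * (\<phi> x)\<^sup>2 - (u x)\<^sup>2 * (\<phi> x)\<^sup>2"
        using pos
      proof eventually_elim
        case (elim x)
        have "lap x = u x * (lam - V x - (u x)\<^sup>2)" by (simp add: lap_def power2_eq_square power3_eq_cube algebra_simps)
        then have "h x * lap x = (\<phi> x)\<^sup>2 * (lam - V x - (u x)\<^sup>2)" using elim by (simp add: h_def)
        then show ?case by (simp add: algebra_simps)
      qed
      show "(\<lambda>x. h x * lap x) \<in> borel_measurable torus" unfolding h_def lap_def by measurable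
    qed measurable
    also have "\<dots> = lam * nsq \<phi> - integral\<^sup>L torus (\<lambda>x. V x * (\<phi> x)\<^sup>2) - integral\<^sup>L torus (\<lambda>x. (u x)\<^sup>2 * (\<phi> x)\<^sup>2)"
    proof -
      have "integrable torus (\<lambda>x. (\<phi> x)\<^sup>2)" by (rule L2_sq[OF \<phi>L])
      moreover have "integrable torus (\<lambda>x. V x * (\<phi> x)\<^sup>2)" by (intro integral_mult_bounded[OF _ V_meas V_bounded] L2_sq \<phi>L)
      moreover have "integrable torus (\<lambda>x. (u x)\<^sup>2 * (\<phi> x)\<^sup>2)"
        by (rule integral_mult_bounded[OF L2_sq[OF \<phi>L], of _ lam]) (use u_sq_le in auto)
      ultimately show ?thesis by simp
    qed
    finally show ?thesis using dirichlet_u_right[OF hL] by simp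
  qed
  then have "dirichlet \<phi> \<phi> - dirichlet h u = Q \<phi>" unfolding Q_def by simp
  ultimately show ?thesis unfolding f_def by (simp only:)
qed

lemma Q_nonneg: "\<phi> \<in> XN N \<Longrightarrow> 0 \<le> Q \<phi>"
  using Picone[of \<phi> N "{}"] c0(1) by (simp add: zero_le_divide_iff not_le)

text \<open>With f = \<phi> / u and a its mean, Parseval and kap >= 1 off the zero mode give a
  Poincare inequality for f - a; multiplying back by u costs u^2 <= lam.\<close>

lemma spectral_gap:
  assumes \<phi>: "\<phi> \<in> XN N"
  shows "\<exists>a. nsq (\<lambda>x. \<phi> x - a * u x) \<le> lam / c0\<^sup>2 * Q \<phi>"
proof -
  define f where "f = (\<lambda>x. \<phi> x / u x)"
  have \<phi>L: "L2 \<phi>" by (rule XN_L2[OF \<phi>])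
  have [measurable]: "\<phi> \<in> borel_measurable torus" by (rule L2_meas[OF \<phi>L])
  have fm [measurable]: "f \<in> borel_measurable torus" unfolding f_def by measurable
  have fL: "L2 f"
  proof -
    have "L2 (\<lambda>x. (1 / u x) * \<phi> x)"
    proof (rule L2_mult_bounded[OF \<phi>L, of _ "1 / c0"])
      show "AE x in torus. \<bar>1 / u x\<bar> \<le> 1 / c0"
        using c0(2) by eventually_elim (use c0(1) in \<open>auto intro!: divide_left_mono\<close>)
    qed measurable
    then show ?thesis by (simp add: f_def)
  qed
  define a where "a = integral\<^sup>L torus f"
  define g where "g = (\<lambda>x. f x - a)"
  have gL: "L2 g" unfolding g_def by (intro L2_diff fL L2_const)
  have gc: "fcoef g k = (if k = 0 then 0 else fcoef f k)" if "k \<in> Zd" for k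
    unfolding g_def using that by (simp add: fcoef_diff L2_integrable fL fcoef_const fcoef_0 a_def)
  have "nsq g = infsum (\<lambda>k. (cmod (fcoef g k))\<^sup>2) Zd" using infsumI[OF Parseval[OF gL]] by simp
  also have "\<dots> \<le> Q \<phi> / c0\<^sup>2"
  proof (rule infsum_le_finite_sums)
    show "(\<lambda>k. (cmod (fcoef g k))\<^sup>2) summable_on Zd" using Parseval[OF gL] by (auto simp: summable_on_def)
    fix F :: "(real^'n) set" assume F: "finite F" "F \<subseteq> Zd"
    have "(\<Sum>k\<in>F. (cmod (fcoef g k))\<^sup>2) \<le> (\<Sum>k\<in>F. kap k * (cmod (fcoef f k))\<^sup>2)"
    proof (rule sum_mono)
      fix k assume "k \<in> F"
      then have k: "k \<in> Zd" using F by auto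
      show "(cmod (fcoef g k))\<^sup>2 \<le> kap k * (cmod (fcoef f k))\<^sup>2"
      proof (cases "k = 0")
        case False
        have "1 \<le> 2 * pi" using pi_gt3 by linarith
        then have "1 \<le> (2 * pi)\<^sup>2" by (rule one_le_power)
        then have "1 \<le> kap k" using kap_ge[OF k False] by linarith
        then show ?thesis using False mult_right_mono[of 1 "kap k" "(cmod (fcoef f k))\<^sup>2"] by (simp add: gc[OF k])
      qed (simp add: gc)
    qed
    also have "\<dots> \<le> Q \<phi> / c0\<^sup>2" unfolding f_def by (rule Picone[OF \<phi> F])
    finally show "(\<Sum>k\<in>F. (cmod (fcoef g k))\<^sup>2) \<le> Q \<phi> / c0\<^sup>2" .
  qed
  finally have nsqg: "nsq g \<le> Q \<phi> / c0\<^sup>2" .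
  have "nsq (\<lambda>x. \<phi> x - a * u x) = nsq (\<lambda>x. u x * g x)"
  proof (rule integral_cong_AE)
    show "AE x in torus. (\<phi> x - a * u x)\<^sup>2 = (u x * g x)\<^sup>2"
      using u_pos by eventually_elim (simp add: g_def f_def algebra_simps)
    show "(\<lambda>x. (u x * g x)\<^sup>2) \<in> borel_measurable torus" unfolding g_def by measurable
  qed measurable
  also have "\<dots> \<le> (sqrt lam)\<^sup>2 * nsq g" by (rule nsq_mult_bounded_le[OF gL u_meas u_bounded])
  also have "(sqrt lam)\<^sup>2 = lam" using lam_pos by simp
  also have "lam * nsq g \<le> lam * (Q \<phi> / c0\<^sup>2)" using lam_pos nsqg by (intro mult_left_mono) auto
  finally show ?thesis by (intro exI[of _ a]) simp
qed

subsection \<open>The linearised discrete problem\<close>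

text \<open>The potential of the linearised operator: it has 3 u^2, the derivative of u^3, where
  \<open>Q\<close> has u^2.\<close>

definition W where "W = (\<lambda>x. V x + 3 * (u x)\<^sup>2 - lam)"

definition Wb where "Wb = Vb + 4 * lam"

lemma W_meas [measurable]: "W \<in> borel_measurable torus" unfolding W_def by measurable

lemma W_bounded: "AE x in torus. \<bar>W x\<bar> \<le> Wb"
  using V_bounded u_sq_le
proof eventually_elim
  case (elim x)
  have "0 \<le> (u x)\<^sup>2" by simp
  with elim lam_pos show ?case unfolding W_def Wb_def by linarith
qed

definition BL where "BL f g = dirichlet f g + integral\<^sup>L torus (\<lambda>x. W x * (f x * g x))"

lemma W_int: "L2 f \<Longrightarrow> L2 g \<Longrightarrow> integrable torus (\<lambda>x. W x * (f x * g x))"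
  by (intro integral_mult_bounded[OF _ W_meas W_bounded] L2_mult_integrable)

lemma BL_commute: "BL f g = BL g f"
  unfolding BL_def dirichlet_commute[of f g] by (simp only: mult.commute[of "f _"])

lemma BL_add_scale:
  assumes "sobolev 1 f" "sobolev 1 g" "sobolev 1 h"
  shows "BL (\<lambda>x. f x + c * g x) h = BL f h + c * BL g h"
proof -
  have L: "L2 f" "L2 g" "L2 h" using assms sobolev_L2 by auto
  have "W x * ((f x + c * g x) * h x) = W x * (f x * h x) + c * (W x * (g x * h x))" for x
    by (simp add: algebra_simps)
  then have "integral\<^sup>L torus (\<lambda>x. W x * ((f x + c * g x) * h x)) = integral\<^sup>L torus (\<lambda>x. W x * (f x * h x)) + c * integral\<^sup>L torus (\<lambda>x. W x * (g x * h x))"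
    using W_int[OF L(1,3)] W_int[OF L(2,3)] by simp
  then show ?thesis unfolding BL_def dirichlet_add_scale[OF assms] by (simp add: algebra_simps)
qed

text \<open>\<open>BL\<close> exceeds \<open>Q\<close> by twice the integral of u^2 \<psi>^2, and u
  >= c0. Hence the form is coercive on all of X_N and the dual problem can be solved without a
  constraint.\<close>

lemma BL_coercive:
  assumes \<psi>: "\<psi> \<in> XN N" shows "2 * c0\<^sup>2 * nsq \<psi> \<le> BL \<psi> \<psi>"
proof -
  have L: "L2 \<psi>" by (rule XN_L2[OF \<psi>])
  have i1: "integrable torus (\<lambda>x. (\<psi> x)\<^sup>2)" by (rule L2_sq[OF L])
  have i2: "integrable torus (\<lambda>x. V x * (\<psi> x)\<^sup>2)" by (intro integral_mult_bounded[OF _ V_meas V_bounded] i1)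
  have i3: "integrable torus (\<lambda>x. (u x)\<^sup>2 * (\<psi> x)\<^sup>2)"
    by (rule integral_mult_bounded[OF i1, of _ lam]) (use u_sq_le in auto)
  have "W x * (\<psi> x * \<psi> x) = V x * (\<psi> x)\<^sup>2 + 3 * ((u x)\<^sup>2 * (\<psi> x)\<^sup>2) - lam * (\<psi> x)\<^sup>2" for x
    by (simp add: W_def power2_eq_square algebra_simps)
  then have "integral\<^sup>L torus (\<lambda>x. W x * (\<psi> x * \<psi> x)) = integral\<^sup>L torus (\<lambda>x. V x * (\<psi> x)\<^sup>2 + 3 * ((u x)\<^sup>2 * (\<psi> x)\<^sup>2) - lam * (\<psi> x)\<^sup>2)"
    by (simp only:)
  also have "\<dots> = integral\<^sup>L torus (\<lambda>x. V x * (\<psi> x)\<^sup>2) + 3 * integral\<^sup>L torus (\<lambda>x. (u x)\<^sup>2 * (\<psi> x)\<^sup>2) - lam * nsq \<psi>"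
    using i1 i2 i3 by simp
  finally have "BL \<psi> \<psi> = Q \<psi> + 2 * integral\<^sup>L torus (\<lambda>x. (u x)\<^sup>2 * (\<psi> x)\<^sup>2)"
    unfolding BL_def Q_def by simp
  moreover have "c0\<^sup>2 * nsq \<psi> \<le> integral\<^sup>L torus (\<lambda>x. (u x)\<^sup>2 * (\<psi> x)\<^sup>2)"
    unfolding Bochner_Integration.integral_mult_right_zero[symmetric]
  proof (rule integral_mono_AE)
    show "AE x in torus. c0\<^sup>2 * (\<psi> x)\<^sup>2 \<le> (u x)\<^sup>2 * (\<psi> x)\<^sup>2"
      using c0(2) by eventually_elim (use c0(1) in \<open>auto intro!: mult_right_mono power_mono\<close>)
  qed (use i1 i3 in auto)
  ultimately show ?thesis using Q_nonneg[OF \<psi>] by simp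
qed

text \<open>The constant of \<open>2 * nsq f + 2 * (1 + Wb)\<^sup>2 * nsq \<psi>\<close>, with the
  norm of \<psi> controlled by the coercivity constant 2 c0^2.\<close>

definition Cd where "Cd = 2 + 2 * (1 + Wb)\<^sup>2 / (2 * c0\<^sup>2)\<^sup>2"

text \<open>The Galerkin equations hold mode by mode on \<open>KN N\<close>, so (1 - Laplacian)
  \<psi> is the truncation of the L^2 function f + (1 - W) \<psi>, and Bessel's inequality bounds it
  uniformly in N.\<close>

lemma dual_solution:
  assumes f: "L2 f"
  obtains \<psi> where "\<psi> \<in> XN N" "\<And>v. v \<in> XN N \<Longrightarrow> BL \<psi> v = ip f v" "sobolev_sq 2 \<psi> \<le> Cd * nsq f"
proof -
  have fin: "finite (real_waves N :: (real^'n \<Rightarrow> real) set)" by (simp add: real_waves_def)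
  have sub: "real_waves N \<subseteq> (XN N :: (real^'n \<Rightarrow> real) set)" using lin_base lin_real_waves by blast
  have "\<exists>\<psi>\<in>lin (real_waves N). \<forall>v\<in>lin (real_waves N). BL \<psi> v = ip f v"
  proof (rule Riesz_lin[OF fin sub])
    fix p q h :: "real^'n \<Rightarrow> real" and c assume p: "p \<in> XN N" and q: "q \<in> XN N"
    show "ip f (\<lambda>x. p x + c * q x) = ip f p + c * ip f q"
      using L2_mult_integrable[OF f XN_L2[OF p]] L2_mult_integrable[OF f XN_L2[OF q]]
      by (simp add: distrib_left mult.left_commute)
    assume h: "h \<in> XN N"
    show "BL (\<lambda>x. p x + c * q x) h = BL p h + c * BL q h"
      by (intro BL_add_scale sobolev_XN[OF p] sobolev_XN[OF q] sobolev_XN[OF h])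
    then show "BL h (\<lambda>x. p x + c * q x) = BL h p + c * BL h q" by (simp only: BL_commute[of h])
  next
    fix p :: "real^'n \<Rightarrow> real" assume p: "p \<in> XN N" and 0: "BL p p = 0"
    then have "nsq p \<le> 0" using BL_coercive[OF p] c0(1) by (simp add: mult_le_0_iff)
    then have "(\<Sum>k\<in>KN N. (cmod (fcoef p k))\<^sup>2) = 0" using nsq_trig[OF p] nsq_nonneg[of p] by simp
    then have "\<forall>k\<in>KN N. (cmod (fcoef p k))\<^sup>2 = 0" by (subst (asm) sum_nonneg_eq_0_iff) auto
    then show "p = (\<lambda>x. 0)"
      by (intro XN_eqI[OF p XN_const[of 0]]) (auto simp: fcoef_const KN_def)
  qed (auto intro: XN_const XN_add_scale)
  then obtain \<psi> where \<psi>: "\<psi> \<in> XN N" and eq: "\<And>v. v \<in> XN N \<Longrightarrow> BL \<psi> v = ip f v"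
    unfolding lin_real_waves by blast
  have \<psi>L: "L2 \<psi>" by (rule XN_L2[OF \<psi>])
  define d where "d = 2 * c0\<^sup>2"
  have d: "0 < d" using c0(1) by (simp add: d_def)
  have nsq\<psi>: "d\<^sup>2 * nsq \<psi> \<le> nsq f"
  proof (cases "nsq \<psi> = 0")
    case False
    then have pos: "0 < nsq \<psi>" using nsq_nonneg[of \<psi>] by linarith
    have "d * nsq \<psi> \<le> ip f \<psi>" using BL_coercive[OF \<psi>] eq[OF \<psi>] by (simp add: d_def)
    then have "(d * nsq \<psi>)\<^sup>2 \<le> (ip f \<psi>)\<^sup>2" using d by (intro power_mono) auto
    also have "\<dots> \<le> nsq f * nsq \<psi>" by (rule ip_Cauchy_Schwarz[OF f \<psi>L])
    finally have "(d\<^sup>2 * nsq \<psi>) * nsq \<psi> \<le> nsq f * nsq \<psi>" by (simp add: power_mult_distrib power2_eq_square mult_ac)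
    then show ?thesis using pos by simp
  qed simp
  have W\<psi>: "L2 (\<lambda>x. W x * \<psi> x)" by (rule L2_mult_bounded[OF \<psi>L W_meas W_bounded])
  define r where "r = (\<lambda>x. f x + (1 - W x) * \<psi> x)"
  have W1: "AE x in torus. \<bar>1 - W x\<bar> \<le> 1 + Wb" using W_bounded by eventually_elim linarith
  have W1\<psi>: "L2 (\<lambda>x. (1 - W x) * \<psi> x)" by (rule L2_mult_bounded[OF \<psi>L _ W1]) measurable
  have rL: "L2 r" unfolding r_def by (intro L2_add f W1\<psi>)
  have coef: "of_real (wt k) * fcoef \<psi> k = fcoef r k" if k: "k \<in> KN N" for k
  proof -
    define c where "c = (\<lambda>k. of_real (kap k) * fcoef \<psi> k + fcoef (\<lambda>x. W x * \<psi> x) k - fcoef f k)"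
    have "c k = 0"
    proof (rule XN_coef_zero[OF _ _ k])
      show "c (- k) = cnj (c k)" for k by (simp add: c_def fcoef_minus_freq)
      fix v :: "real^'n \<Rightarrow> real" assume v: "v \<in> XN N"
      have "(\<Sum>k\<in>KN N. Re (c k * cnj (fcoef v k))) = (\<Sum>k\<in>KN N. kap k * Re (fcoef \<psi> k * cnj (fcoef v k)) + Re (fcoef (\<lambda>x. W x * \<psi> x) k * cnj (fcoef v k)) - Re (fcoef f k * cnj (fcoef v k)))"
        by (intro sum.cong refl) (simp add: c_def algebra_simps)
      also have "\<dots> = dirichlet \<psi> v + ip (\<lambda>x. W x * \<psi> x) v - ip f v"
        unfolding dirichlet_XN[OF v] ip_trig[OF L2_integrable[OF f] v] ip_trig[OF L2_integrable[OF W\<psi>] v]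
        by (simp only: sum.distrib sum_subtractf)
      also have "\<dots> = 0" using eq[OF v] by (simp add: BL_def mult.assoc)
      finally show "(\<Sum>k\<in>KN N. Re (c k * cnj (fcoef v k))) = 0" .
    qed
    moreover have "fcoef r k = fcoef f k + fcoef \<psi> k - fcoef (\<lambda>x. W x * \<psi> x) k"
    proof -
      have "r = (\<lambda>x. (f x + \<psi> x) - W x * \<psi> x)" by (rule ext) (simp add: r_def algebra_simps)
      then show ?thesis by (simp add: fcoef_diff fcoef_add L2_integrable f \<psi>L W\<psi>)
    qed
    moreover have "of_real (wt k) * fcoef \<psi> k = fcoef \<psi> k + of_real (kap k) * fcoef \<psi> k"
      by (simp add: wt_def distrib_right)
    ultimately show ?thesis unfolding c_def by algebra
  qed
  have "sobolev_sq 2 \<psi> = (\<Sum>k\<in>KN N. (cmod (fcoef r k))\<^sup>2)"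
    unfolding sobolev_sq_XN[OF \<psi>] by (intro sum.cong refl) (simp add: coef[symmetric] norm_mult power_mult_distrib)
  also have "\<dots> \<le> nsq r" by (rule Bessel[OF rL finite_KN KN_subset_Zd])
  also have "\<dots> \<le> 2 * nsq f + 2 * nsq (\<lambda>x. (1 - W x) * \<psi> x)" unfolding r_def by (rule nsq_add_le[OF f W1\<psi>])
  also have "nsq (\<lambda>x. (1 - W x) * \<psi> x) \<le> (1 + Wb)\<^sup>2 * nsq \<psi>"
    by (rule nsq_mult_bounded_le[OF \<psi>L _ W1]) measurable
  also have "nsq \<psi> \<le> nsq f / d\<^sup>2" using nsq\<psi> d by (simp add: pos_le_divide_eq mult.commute)
  finally have "sobolev_sq 2 \<psi> \<le> 2 * nsq f + 2 * ((1 + Wb)\<^sup>2 * (nsq f / d\<^sup>2))" by (simp add: mult_left_mono)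
  also have "\<dots> = Cd * nsq f" by (simp add: Cd_def d_def algebra_simps)
  finally show ?thesis using that[OF \<psi> eq] by blast
qed

end

lemma sobolev_sq_minus_commute: "sobolev_sq m (\<lambda>x. f x - g x) = sobolev_sq m (\<lambda>x. g x - f x)"
  using sobolev_sq_cmult[of m "-1" "\<lambda>x. f x - g x"] by simp

lemma ip_commute: "ip f g = ip g f" by (simp add: mult.commute)

lemma ip_add_scale:
  assumes "L2 f" "L2 g" "L2 h" shows "ip (\<lambda>x. f x + c * g x) h = ip f h + c * ip g h"
  using L2_mult_integrable[OF assms(1,3)] L2_mult_integrable[OF assms(2,3)]
  by (simp add: distrib_right mult.assoc)

context ground_state
begin

section \<open>The projection error of the ground state\<close>

definition eta where "eta N = (\<lambda>x. u x - proj N u x)"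

lemma eta_L2: "L2 (eta N)" unfolding eta_def by (intro L2_diff u_L2 XN_L2[OF trig_XN])

lemma eta_hreg1: "sobolev 1 (eta N)" unfolding eta_def by (intro sobolev_diff u_hreg1 sobolev_XN[OF trig_XN])

lemma fcoef_eta: "k \<in> Zd \<Longrightarrow> fcoef (eta N) k = (if k \<in> KN N then 0 else fcoef u k)"
  unfolding eta_def by (simp add: fcoef_diff L2_integrable u_L2 XN_integrable[OF trig_XN] fcoef_proj)

lemma wt_outside: "k \<in> Zd \<Longrightarrow> k \<notin> KN N \<Longrightarrow> (real N)\<^sup>2 \<le> wt k"
proof -
  assume "k \<in> Zd" "k \<notin> KN N"
  then have "real N \<le> norm k" by (simp add: KN_def)
  also have "\<dots> \<le> 2 * pi * norm k" using mult_right_mono[of 1 "2 * pi" "norm k"] pi_gt3 by simp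
  finally have "(real N)\<^sup>2 \<le> (2 * pi * norm k)\<^sup>2" by (intro power_mono) auto
  then show ?thesis unfolding wt_def kap_def by linarith
qed

lemma ip_eta_XN: "v \<in> XN N \<Longrightarrow> ip (eta N) v = 0"
proof -
  assume v: "v \<in> XN N"
  have "(\<Sum>k\<in>KN N. Re (fcoef (eta N) k * cnj (fcoef v k))) = 0"
    by (intro sum.neutral ballI) (auto simp: fcoef_eta KN_def)
  then show ?thesis using ip_trig[OF L2_integrable[OF eta_L2] v] by simp
qed

lemma dirichlet_eta_XN: "v \<in> XN N \<Longrightarrow> dirichlet (eta N) v = 0"
proof -
  assume v: "v \<in> XN N"
  have "(\<Sum>k\<in>KN N. kap k * Re (fcoef (eta N) k * cnj (fcoef v k))) = 0"
    by (intro sum.neutral ballI) (auto simp: fcoef_eta KN_def)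
  then show ?thesis using dirichlet_XN[OF v] by simp
qed

text \<open>Three powers of \<open>wt\<close> lie between H^1 and H^4, each at least N^2 on the
  frequencies of eta. Multiplying by N^6 instead of dividing also covers N = 0.\<close>

lemma sobolev_sq_eta_le: "(real N)^6 * sobolev_sq 1 (eta N) \<le> sobolev_sq 4 u"
proof (cases "N = 0")
  case False
  then have N: "0 < (real N)^6" by simp
  have "sobolev_sq 1 (eta N) \<le> sobolev_sq 4 u / (real N)^6"
  proof (rule hregI(2)[OF eta_L2])
    fix F :: "(real^'n) set" assume F: "finite F" "F \<subseteq> Zd"
    have "(\<Sum>k\<in>F. wt k ^ 1 * (cmod (fcoef (eta N) k))\<^sup>2) \<le> (\<Sum>k\<in>F. wt k ^ 4 * (cmod (fcoef u k))\<^sup>2 / (real N)^6)"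
    proof (rule sum_mono)
      fix k assume "k \<in> F"
      then have k: "k \<in> Zd" using F by auto
      show "wt k ^ 1 * (cmod (fcoef (eta N) k))\<^sup>2 \<le> wt k ^ 4 * (cmod (fcoef u k))\<^sup>2 / (real N)^6"
      proof (cases "k \<in> KN N")
        case False
        have "(real N)^6 = ((real N)\<^sup>2)^3" by (simp flip: power_mult)
        also have "\<dots> \<le> wt k ^ 3" using wt_outside[OF k False] by (intro power_mono) auto
        finally have "(real N)^6 * (wt k * (cmod (fcoef u k))\<^sup>2) \<le> wt k ^ 3 * (wt k * (cmod (fcoef u k))\<^sup>2)"
          by (intro mult_right_mono) auto
        then show ?thesis using N False
          by (simp add: fcoef_eta[OF k] pos_le_divide_eq mult_ac power3_eq_cube power4_eq_xxxx)
      qed (simp add: fcoef_eta[OF k])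
    qed
    also have "\<dots> = (\<Sum>k\<in>F. wt k ^ 4 * (cmod (fcoef u k))\<^sup>2) / (real N)^6" by (simp only: sum_divide_distrib)
    also have "\<dots> \<le> sobolev_sq 4 u / (real N)^6" using N by (intro divide_right_mono sum_le_sobolev_sq[OF u_hreg4 F]) auto
    finally show "(\<Sum>k\<in>F. wt k ^ 1 * (cmod (fcoef (eta N) k))\<^sup>2) \<le> sobolev_sq 4 u / (real N)^6" .
  qed
  then show ?thesis using N by (simp add: pos_le_divide_eq mult.commute)
qed simp

text \<open>Pairing with H^2 measures eta with weight wt^-2. Compared with its H^1 norm this gains
  wt^-3 <= N^-6 on its frequencies, and the square root leaves N^-3.\<close>

lemma ip_eta_hreg2:
  assumes f: "sobolev 2 f" and N: "0 < N"
  shows "\<bar>ip (eta N) f\<bar> \<le> sqrt (sobolev_sq 1 (eta N)) * sqrt (sobolev_sq 2 f) / (real N)^3"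
proof -
  have N6: "0 < (real N)^6" using N by simp
  have fin: "(\<Sum>k\<in>KN M. Re (fcoef (eta N) k * cnj (fcoef f k)))\<^sup>2 \<le> sobolev_sq 1 (eta N) / (real N)^6 * sobolev_sq 2 f" for M
  proof -
    have "\<bar>\<Sum>k\<in>KN M. Re (fcoef (eta N) k * cnj (fcoef f k))\<bar> \<le> (\<Sum>k\<in>KN M. (cmod (fcoef (eta N) k) / wt k) * (wt k * cmod (fcoef f k)))"
      by (rule order_trans[OF sum_abs]) (intro sum_mono, simp add: Re_mult_cnj_le del: times_complex.sel)
    then have "(\<Sum>k\<in>KN M. Re (fcoef (eta N) k * cnj (fcoef f k)))\<^sup>2 \<le> (\<Sum>k\<in>KN M. (cmod (fcoef (eta N) k) / wt k) * (wt k * cmod (fcoef f k)))\<^sup>2"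
      using power_mono[of "\<bar>\<Sum>k\<in>KN M. Re (fcoef (eta N) k * cnj (fcoef f k))\<bar>" _ 2] by (simp del: times_complex.sel)
    also have "\<dots> \<le> (\<Sum>k\<in>KN M. (cmod (fcoef (eta N) k) / wt k)\<^sup>2) * (\<Sum>k\<in>KN M. (wt k * cmod (fcoef f k))\<^sup>2)"
      by (rule Cauchy_Schwarz_ineq_sum)
    also have "\<dots> \<le> (sobolev_sq 1 (eta N) / (real N)^6) * sobolev_sq 2 f"
    proof (intro mult_mono)
      have "(\<Sum>k\<in>KN M. (cmod (fcoef (eta N) k) / wt k)\<^sup>2) \<le> (\<Sum>k\<in>KN M. wt k ^ 1 * (cmod (fcoef (eta N) k))\<^sup>2 / (real N)^6)"
      proof (rule sum_mono)
        fix k :: "real^'n" assume "k \<in> KN M"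
        then have k: "k \<in> Zd" by (simp add: KN_def)
        show "(cmod (fcoef (eta N) k) / wt k)\<^sup>2 \<le> wt k ^ 1 * (cmod (fcoef (eta N) k))\<^sup>2 / (real N)^6"
        proof (cases "k \<in> KN N")
          case False
          have "(real N)^6 = ((real N)\<^sup>2)^3" by (simp flip: power_mult)
          also have "\<dots> \<le> wt k ^ 3" using wt_outside[OF k False] by (intro power_mono) auto
          finally have "(cmod (fcoef (eta N) k))\<^sup>2 * (real N)^6 \<le> (cmod (fcoef (eta N) k))\<^sup>2 * wt k ^ 3"
            by (intro mult_left_mono) auto
          then show ?thesis using N6
            by (simp add: power_divide divide_le_eq pos_le_divide_eq mult_ac power2_eq_square power3_eq_cube)
        qed (simp add: fcoef_eta[OF k])
      qed
      also have "\<dots> = (\<Sum>k\<in>KN M. wt k ^ 1 * (cmod (fcoef (eta N) k))\<^sup>2) / (real N)^6" by (simp only: sum_divide_distrib)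
      also have "\<dots> \<le> sobolev_sq 1 (eta N) / (real N)^6"
        using N6 by (intro divide_right_mono sum_le_sobolev_sq[OF eta_hreg1 finite_KN KN_subset_Zd]) auto
      finally show "(\<Sum>k\<in>KN M. (cmod (fcoef (eta N) k) / wt k)\<^sup>2) \<le> sobolev_sq 1 (eta N) / (real N)^6" .
      show "(\<Sum>k\<in>KN M. (wt k * cmod (fcoef f k))\<^sup>2) \<le> sobolev_sq 2 f"
        using sum_le_sobolev_sq[OF f finite_KN KN_subset_Zd, of M] by (simp add: power_mult_distrib)
    qed (auto intro: sum_nonneg)
    finally show ?thesis .
  qed
  have "(ip (eta N) f)\<^sup>2 \<le> sobolev_sq 1 (eta N) / (real N)^6 * sobolev_sq 2 f"
    by (rule LIMSEQ_le_const2[OF tendsto_power[OF has_sum_KN_tendsto[OF Parseval_ip[OF eta_L2 sobolev_L2[OF f]]]]])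
       (use fin in blast)
  then have "\<bar>ip (eta N) f\<bar> \<le> sqrt (sobolev_sq 1 (eta N) / (real N)^6 * sobolev_sq 2 f)"
    by (metis real_sqrt_abs real_sqrt_le_mono)
  also have "(real N)^6 = ((real N)^3)\<^sup>2" by (simp flip: power_mult)
  also have "sqrt (sobolev_sq 1 (eta N) / ((real N)^3)\<^sup>2 * sobolev_sq 2 f) = sqrt (sobolev_sq 1 (eta N)) * sqrt (sobolev_sq 2 f) / (real N)^3"
    by (simp only: real_sqrt_mult real_sqrt_divide real_sqrt_abs abs_of_nonneg zero_le_power of_nat_0_le_iff times_divide_eq_left)
  finally show ?thesis .
qed

subsection \<open>Quasi-optimality in the energy norm\<close>

lemma usq_int: "integrable torus f \<Longrightarrow> integrable torus (\<lambda>x. (u x)\<^sup>2 * f x)"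
  by (rule integral_mult_bounded[of f _ lam]) (use u_sq_le in auto)

lemma V_int: "integrable torus f \<Longrightarrow> integrable torus (\<lambda>x. V x * f x)"
  by (rule integral_mult_bounded[OF _ V_meas V_bounded])

text \<open>u lies in the kernel of the form: the mixed term is the Euler-Lagrange equation tested
  with g, and Q(u) = 0 by the choice of \<open>lam\<close>.\<close>

lemma Q_add_u:
  assumes g: "sobolev 1 g" shows "Q (\<lambda>x. g x + t * u x) = Q g"
proof -
  have L: "L2 g" by (rule sobolev_L2[OF g])
  note i = L2_sq[OF L] L2_sq[OF u_L2] L2_mult_integrable[OF u_L2 L]
  have d: "dirichlet (\<lambda>x. g x + t * u x) (\<lambda>x. g x + t * u x) = dirichlet g g + 2 * t * dirichlet u g + t\<^sup>2 * dirichlet u u"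
    using g u_hreg1 sobolev_add[OF g sobolev_cmult[OF u_hreg1, of t]]
    by (simp add: dirichlet_add_scale dirichlet_add_scale2 dirichlet_commute[of g u] power2_eq_square algebra_simps)
  have sq: "(g x + t * u x)\<^sup>2 = (g x)\<^sup>2 + 2 * t * (u x * g x) + t\<^sup>2 * (u x)\<^sup>2" for x
    by (simp add: power2_eq_square algebra_simps)
  have n: "nsq (\<lambda>x. g x + t * u x) = nsq g + 2 * t * ip u g + t\<^sup>2 * nsq u"
    unfolding sq using i by simp
  have vv: "integral\<^sup>L torus (\<lambda>x. V x * (g x + t * u x)\<^sup>2) = integral\<^sup>L torus (\<lambda>x. V x * (g x)\<^sup>2) + 2 * t * integral\<^sup>L torus (\<lambda>x. V x * (u x * g x)) + t\<^sup>2 * integral\<^sup>L torus (\<lambda>x. V x * (u x)\<^sup>2)"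
    unfolding sq distrib_left mult.left_commute[of "V _" "2 * t"] mult.left_commute[of "V _" "t\<^sup>2"]
    using i[THEN V_int] by simp
  have uu: "integral\<^sup>L torus (\<lambda>x. (u x)\<^sup>2 * (g x + t * u x)\<^sup>2) = integral\<^sup>L torus (\<lambda>x. (u x)\<^sup>2 * (g x)\<^sup>2) + 2 * t * integral\<^sup>L torus (\<lambda>x. (u x)\<^sup>2 * (u x * g x)) + t\<^sup>2 * integral\<^sup>L torus (\<lambda>x. (u x)\<^sup>2 * (u x)\<^sup>2)"
    unfolding sq distrib_left mult.left_commute[of "(u _)\<^sup>2" "2 * t"] mult.left_commute[of "(u _)\<^sup>2" "t\<^sup>2"]
    using i[THEN usq_int] by simp
  have e1: "(u x)\<^sup>2 * (u x * g x) = (u x)^3 * g x" for x by (simp add: power2_eq_square power3_eq_cube)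
  have e2: "(u x)\<^sup>2 * (u x)\<^sup>2 = (u x)^4" for x by (simp flip: power_add)
  have "Q (\<lambda>x. g x + t * u x) = Q g + 2 * t * (dirichlet u g + integral\<^sup>L torus (\<lambda>x. V x * (u x * g x)) + integral\<^sup>L torus (\<lambda>x. (u x)^3 * g x) - lam * ip u g)
     + t\<^sup>2 * (dirichlet u u + integral\<^sup>L torus (\<lambda>x. V x * (u x)\<^sup>2) + integral\<^sup>L torus (\<lambda>x. (u x)^4) - lam * nsq u)"
    unfolding Q_def d n vv uu e1 e2 by (simp add: algebra_simps)
  then show ?thesis using EL[OF g] nsq_u lam_def by simp
qed

text \<open>Both functions have unit mass, so the terms with \<open>lam\<close> cancel, and the
  quartic terms left over complete a square. By \<open>Q_add_u\<close> the form may be taken at g or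
  at g - u.\<close>

lemma energy_identity:
  assumes g: "sobolev 1 g" and n: "nsq g = 1"
  shows "E_eig V g - E_eig V u = Q g / 2 + nsq (\<lambda>x. (g x)\<^sup>2 - (u x)\<^sup>2) / 4"
proof -
  have L: "L2 g" by (rule sobolev_L2[OF g])
  have gm: "g \<in> borel_measurable torus" by (rule L2_meas[OF L])
  note q = quartic_integrable[OF L4_embedding(1)[OF summable_weights u_hreg1] u_meas L4_embedding(1)[OF summable_weights g] gm]
    quartic_integrable[OF L4_embedding(1)[OF summable_weights g] gm L4_embedding(1)[OF summable_weights u_hreg1] u_meas]
  have "((g x)\<^sup>2 - (u x)\<^sup>2)\<^sup>2 = (g x)^4 - 2 * ((u x)\<^sup>2 * (g x)\<^sup>2) + (u x)^4" for x
    by (simp add: power2_eq_square power4_eq_xxxx algebra_simps)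
  then have "nsq (\<lambda>x. (g x)\<^sup>2 - (u x)\<^sup>2) = integral\<^sup>L torus (\<lambda>x. (g x)^4) - 2 * integral\<^sup>L torus (\<lambda>x. (u x)\<^sup>2 * (g x)\<^sup>2) + integral\<^sup>L torus (\<lambda>x. (u x)^4)"
    using q by simp
  then show ?thesis unfolding E_eig_torus Q_def n using lam_def by (simp add: field_simps)
qed

lemma integral_V_nonneg: "0 \<le> integral\<^sup>L torus (\<lambda>x. V x * (g x)\<^sup>2)"
  by (rule integral_nonneg_AE) (use V_lower Vmin in \<open>auto elim!: eventually_mono\<close>)

lemma dirichlet_le_Q: "dirichlet g g \<le> Q g + lam * nsq g"
proof -
  have "0 \<le> integral\<^sup>L torus (\<lambda>x. (u x)\<^sup>2 * (g x)\<^sup>2)" by (rule integral_nonneg_AE) auto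
  then show ?thesis using integral_V_nonneg[of g] unfolding Q_def by linarith
qed

lemma integral_bounded_le:
  fixes f b :: "real^'n \<Rightarrow> real"
  assumes "integrable torus f" "AE x in torus. 0 \<le> f x" "b \<in> borel_measurable torus" "AE x in torus. \<bar>b x\<bar> \<le> B"
  shows "integral\<^sup>L torus (\<lambda>x. b x * f x) \<le> B * integral\<^sup>L torus f"
proof -
  have "integral\<^sup>L torus (\<lambda>x. b x * f x) \<le> integral\<^sup>L torus (\<lambda>x. B * f x)"
  proof (rule integral_mono_AE)
    show "AE x in torus. b x * f x \<le> B * f x"
      using assms(2,4) by eventually_elim (auto intro: mult_right_mono)
  qed (use assms integral_mult_bounded in auto)
  then show ?thesis by simp
qed

lemma usq_bounded: "AE x in torus. \<bar>(u x)\<^sup>2\<bar> \<le> lam" using u_sq_le by simp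

lemma Q_le:
  assumes g: "sobolev 1 g" shows "Q g \<le> (1 + Vb + lam) * sobolev_sq 1 g"
proof -
  have L: "L2 g" by (rule sobolev_L2[OF g])
  have "integral\<^sup>L torus (\<lambda>x. V x * (g x)\<^sup>2) \<le> Vb * nsq g"
    by (rule integral_bounded_le[OF L2_sq[OF L] _ V_meas V_bounded]) auto
  moreover have "integral\<^sup>L torus (\<lambda>x. (u x)\<^sup>2 * (g x)\<^sup>2) \<le> lam * nsq g"
    by (rule integral_bounded_le[OF L2_sq[OF L] _ _ usq_bounded]) auto
  moreover have "dirichlet g g \<le> sobolev_sq 1 g" using sobolev_sq_1[OF g] nsq_nonneg[of g] by linarith
  moreover have "Vb * nsq g \<le> Vb * sobolev_sq 1 g" by (intro mult_left_mono nsq_le_sobolev_sq g Vb_nonneg)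
  moreover have "0 \<le> lam * nsq g" "0 \<le> lam * sobolev_sq 1 g" using lam_pos by auto
  ultimately show ?thesis unfolding Q_def by (simp add: distrib_right)
qed

definition KG where "KG = 1 + 2 * (lam + 1) * (lam / c0\<^sup>2)"

text \<open>The spectral gap controls the squared distance of w from the line through u, which is 1
  - s^2 with s = ip w u. The sign condition puts s in [0, 1], so 2 - 2 s <= 2 (1 - s^2) controls the
  distance from u itself; \<open>dirichlet_le_Q\<close> adds the gradient.\<close>

lemma minimiser_distance_le:
  assumes w: "w \<in> XN N" "nsq w = 1" and sgn: "0 \<le> ip w u"
  shows "sobolev_sq 1 (\<lambda>x. w x - u x) \<le> KG * Q w"
proof -
  have wL: "L2 w" by (rule XN_L2[OF w(1)])
  have w1: "sobolev 1 w" by (rule sobolev_XN[OF w(1)])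
  define del where "del = (\<lambda>x. w x + (-1) * u x)"
  have d1: "sobolev 1 del" unfolding del_def by (intro sobolev_add sobolev_cmult w1 u_hreg1)
  define s where "s = ip w u"
  obtain a where a: "nsq (\<lambda>x. w x - a * u x) \<le> lam / c0\<^sup>2 * Q w" using spectral_gap[OF w(1)] by blast
  have "nsq (\<lambda>x. w x + (- a) * u x) = nsq w + 2 * (- a) * ip w u + (- a)\<^sup>2 * nsq u"
    by (rule nsq_add_scale[OF wL u_L2])
  then have na: "nsq (\<lambda>x. w x - a * u x) = 1 - 2 * a * s + a\<^sup>2" using w nsq_u by (simp add: s_def)
  have nd: "nsq del = 2 - 2 * s"
    unfolding del_def nsq_add_scale[OF wL u_L2] using w nsq_u by (simp add: s_def)
  have "s\<^sup>2 \<le> 1" using ip_Cauchy_Schwarz[OF wL u_L2] w nsq_u by (simp add: s_def)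
  then have s1: "s \<le> 1" by (simp add: power2_le_iff_abs_le abs_le_iff power_le_one_iff abs_square_le_1)
  have "(1 - s) * 1 \<le> (1 - s) * (1 + s)" using s1 sgn by (intro mult_left_mono) (auto simp: s_def)
  then have "nsq del \<le> 2 * (1 - s\<^sup>2)" unfolding nd by (simp add: power2_eq_square algebra_simps)
  also have "\<dots> \<le> 2 * (lam / c0\<^sup>2 * Q w)"
  proof (rule mult_left_mono)
    have "1 - s\<^sup>2 \<le> 1 - 2 * a * s + a\<^sup>2" using zero_le_power2[of "a - s"] by (simp add: power2_eq_square algebra_simps)
    also have "\<dots> \<le> lam / c0\<^sup>2 * Q w" using a by (simp only: na)
    finally show "1 - s\<^sup>2 \<le> lam / c0\<^sup>2 * Q w" .
  qed simp
  finally have nd': "nsq del \<le> 2 * (lam / c0\<^sup>2 * Q w)" .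
  have "sobolev_sq 1 del = nsq del + dirichlet del del" by (rule sobolev_sq_1[OF d1])
  also have "\<dots> \<le> Q del + (lam + 1) * nsq del" using dirichlet_le_Q[of del] by (simp add: algebra_simps)
  also have "Q del = Q w" unfolding del_def by (rule Q_add_u[OF w1])
  also have "Q w + (lam + 1) * nsq del \<le> Q w + (lam + 1) * (2 * (lam / c0\<^sup>2 * Q w))"
    using nd' lam_pos by (intro add_left_mono mult_left_mono) auto
  also have "\<dots> = KG * Q w" by (simp add: KG_def algebra_simps add_divide_distrib)
  finally show ?thesis by (simp add: del_def)
qed

text \<open>\<open>K2\<close> compares the error of the normalised projection with eta. In
  \<open>K3\<close> the 5 lam is lam from \<open>Q_le\<close> plus 4 lam from the part of the
  quartic term that is quadratic in d.\<close>

definition K2 where "K2 = 8 * sobolev_sq 1 u + 2"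
definition K3 where "K3 = ((1 + Vb + 5 * lam) + 2 * lattice_sum TYPE('n) * (K2 * sobolev_sq 4 u)) * K2"

text \<open>The normalised projection competes with w, so E(w) - E(u) is at most its own energy
  excess, which \<open>energy_identity\<close> expands around u.\<close>

lemma energy_proj_le:
  assumes N: "0 < N" and small: "nsq (eta N) \<le> 3 / 4"
    and w: "w \<in> XN N" "nsq w = 1" and min: "\<And>v. v \<in> XN N \<Longrightarrow> nsq v = 1 \<Longrightarrow> E_eig V w \<le> E_eig V v"
  shows "Q w \<le> K3 * sobolev_sq 1 (eta N)"
proof -
  define p where "p = proj N u"
  have pX: "p \<in> XN N" unfolding p_def by (rule trig_XN)
  have pL: "L2 p" by (rule XN_L2[OF pX])
  have np: "nsq p = 1 - nsq (eta N)"
  proof -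
    have "nsq p = (\<Sum>k\<in>KN N. (cmod (fcoef u k))\<^sup>2)" using sobolev_sq_0[OF pL] sobolev_sq_proj[of 0 N u] by (simp add: p_def)
    then show ?thesis using nsq_diff_proj[OF u_L2, of N] nsq_u by (simp add: eta_def)
  qed
  \<comment> \<open>The bound 3/4 on nsq (eta N) keeps m at least 1/2.\<close>
  define m where "m = sqrt (nsq p)"
  have m2: "m\<^sup>2 = 1 - nsq (eta N)" by (simp add: m_def np[symmetric])
  have "(1/2)\<^sup>2 \<le> nsq p" using np small by (simp add: power2_eq_square)
  then have mh: "1/2 \<le> m" unfolding m_def by (rule real_le_rsqrt)
  have "m\<^sup>2 \<le> 1\<^sup>2" using m2 nsq_nonneg[of "eta N"] by simp
  then have m1: "m \<le> 1" by (rule power2_le_imp_le) simp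
  define w' where "w' = (\<lambda>x. (1 / m) * p x)"
  have w'X: "w' \<in> XN N" unfolding w'_def by (rule XN_cmult[OF pX])
  have w'1: "sobolev 1 w'" by (rule sobolev_XN[OF w'X])
  have nw': "nsq w' = 1"
  proof -
    have "0 < nsq p" using np small by simp
    then show ?thesis unfolding w'_def power_mult_distrib by (simp add: power_divide m_def)
  qed
  define d where "d = (\<lambda>x. w' x + (-1) * u x)"
  have d1: "sobolev 1 d" unfolding d_def by (intro sobolev_add sobolev_cmult w'1 u_hreg1)
  have dL: "L2 d" by (rule sobolev_L2[OF d1])
  have dm [measurable]: "d \<in> borel_measurable torus" by (rule L2_meas[OF dL])
  have hd: "sobolev_sq 1 d \<le> K2 * sobolev_sq 1 (eta N)"
  proof -
    have "d = (\<lambda>x. (1 / m - 1) * p x - eta N x)"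
      by (rule ext) (simp add: d_def w'_def eta_def p_def algebra_simps)
    then have "sobolev_sq 1 d \<le> 2 * sobolev_sq 1 (\<lambda>x. (1 / m - 1) * p x) + 2 * sobolev_sq 1 (eta N)"
      using sobolev_sq_diff_le[OF sobolev_cmult[OF sobolev_XN[OF pX]] eta_hreg1, of "1/m - 1" N] by simp
    moreover have "sobolev_sq 1 (\<lambda>x. (1 / m - 1) * p x) \<le> 4 * sobolev_sq 1 (eta N) * sobolev_sq 1 u"
    proof -
      \<comment> \<open>The normalisation error is of second order in eta: 1 - m <= 1 - m^2 = nsq
        (eta N).\<close>
      have "1 / m - 1 = (1 - m) / m" using mh by (simp add: field_simps)
      also have "\<dots> \<le> (1 - m) / (1/2)" using mh m1 by (intro divide_left_mono) auto
      also have "\<dots> \<le> 2 * (1 - m\<^sup>2)"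
      proof -
        have "m * m \<le> 1 * m" using mh m1 by (intro mult_right_mono) auto
        then show ?thesis by (simp add: power2_eq_square)
      qed
      finally have a: "1 / m - 1 \<le> 2 * nsq (eta N)" using m2 by simp
      have a0: "0 \<le> 1 / m - 1" using mh m1 by (simp add: le_divide_eq)
      have "(1 / m - 1)\<^sup>2 \<le> (2 * nsq (eta N))\<^sup>2" using a a0 by (intro power_mono)
      also have "\<dots> = 4 * nsq (eta N) * nsq (eta N)" by (simp add: power2_eq_square)
      also have "\<dots> \<le> 4 * nsq (eta N) * 1" using small by (intro mult_left_mono) auto
      also have "\<dots> \<le> 4 * sobolev_sq 1 (eta N)" using nsq_le_sobolev_sq[OF eta_hreg1, of N] by simp
      finally have "(1 / m - 1)\<^sup>2 * sobolev_sq 1 p \<le> 4 * sobolev_sq 1 (eta N) * sobolev_sq 1 u"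
        using sobolev_sq_proj_le[OF u_hreg1, of N] by (intro mult_mono) (auto simp: p_def)
      then show ?thesis by (simp add: sobolev_sq_cmult)
    qed
    ultimately show ?thesis by (simp add: K2_def algebra_simps)
  qed
  have "Q w / 2 \<le> E_eig V w - E_eig V u"
    using energy_identity[OF sobolev_XN[OF w(1)] w(2)] nsq_nonneg[of "\<lambda>x. (w x)\<^sup>2 - (u x)\<^sup>2"] by linarith
  also have "\<dots> \<le> E_eig V w' - E_eig V u" using min[OF w'X nw'] by simp
  also have "\<dots> = Q w' / 2 + nsq (\<lambda>x. (w' x)\<^sup>2 - (u x)\<^sup>2) / 4" by (rule energy_identity[OF w'1 nw'])
  also have "Q w' = Q d" unfolding d_def by (rule Q_add_u[OF w'1, symmetric])
  finally have q1: "Q w \<le> Q d + nsq (\<lambda>x. (w' x)\<^sup>2 - (u x)\<^sup>2) / 2" by linarith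
  have ud: "L2 (\<lambda>x. u x * d x)" by (rule L2_mult_bounded[OF dL u_meas u_bounded])
  have d4: "L2 (\<lambda>x. (d x)\<^sup>2)" by (rule L4_embedding(1)[OF summable_weights d1])
  have "(w' x)\<^sup>2 - (u x)\<^sup>2 = 2 * (u x * d x) + (d x)\<^sup>2" for x
    by (simp add: d_def power2_eq_square algebra_simps)
  then have "nsq (\<lambda>x. (w' x)\<^sup>2 - (u x)\<^sup>2) = nsq (\<lambda>x. 2 * (u x * d x) + (d x)\<^sup>2)" by simp
  also have "\<dots> \<le> 2 * nsq (\<lambda>x. 2 * (u x * d x)) + 2 * nsq (\<lambda>x. (d x)\<^sup>2)"
    by (rule nsq_add_le[OF L2_cmult[OF ud] d4])
  also have "nsq (\<lambda>x. 2 * (u x * d x)) = 4 * nsq (\<lambda>x. u x * d x)" by (simp add: power_mult_distrib)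
  also have "nsq (\<lambda>x. u x * d x) \<le> lam * nsq d"
    using nsq_mult_bounded_le[OF dL u_meas u_bounded] lam_pos by simp
  also have "nsq (\<lambda>x. (d x)\<^sup>2) \<le> 2 * lattice_sum TYPE('n) * (sobolev_sq 1 d)\<^sup>2" by (rule L4_embedding(2)[OF summable_weights d1])
  also have "lam * nsq d \<le> lam * sobolev_sq 1 d" using lam_pos nsq_le_sobolev_sq[OF d1] by simp
  finally have q2: "nsq (\<lambda>x. (w' x)\<^sup>2 - (u x)\<^sup>2) \<le> 8 * (lam * sobolev_sq 1 d) + 4 * lattice_sum TYPE('n) * (sobolev_sq 1 d)\<^sup>2" by simp
  \<comment> \<open>An a priori bound on the H^1 error turns the square of
    \<open>sobolev_sq 1 d\<close> into a constant multiple of \<open>sobolev_sq 1 d\<close>.\<close>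
  have N1: "1 \<le> (real N)^6" using N by (simp add: one_le_power)
  have "sobolev_sq 1 (eta N) \<le> (real N)^6 * sobolev_sq 1 (eta N)" using mult_right_mono[OF N1, of "sobolev_sq 1 (eta N)"] by simp
  also have "\<dots> \<le> sobolev_sq 4 u" by (rule sobolev_sq_eta_le)
  finally have eH: "sobolev_sq 1 (eta N) \<le> sobolev_sq 4 u" .
  have K20: "0 \<le> K2" by (simp add: K2_def)
  have "sobolev_sq 1 d \<le> K2 * sobolev_sq 4 u" using hd eH K20 by (meson mult_left_mono order_trans)
  then have "(sobolev_sq 1 d)\<^sup>2 \<le> (K2 * sobolev_sq 4 u) * sobolev_sq 1 d" unfolding power2_eq_square by (intro mult_right_mono) auto
  then have "2 * lattice_sum TYPE('n) * (sobolev_sq 1 d)\<^sup>2 \<le> 2 * lattice_sum TYPE('n) * ((K2 * sobolev_sq 4 u) * sobolev_sq 1 d)" by (intro mult_left_mono) auto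
  then have "Q w \<le> ((1 + Vb + 5 * lam) + 2 * lattice_sum TYPE('n) * (K2 * sobolev_sq 4 u)) * sobolev_sq 1 d"
    using q1 q2 Q_le[OF d1] by (simp add: algebra_simps)
  also have "\<dots> \<le> ((1 + Vb + 5 * lam) + 2 * lattice_sum TYPE('n) * (K2 * sobolev_sq 4 u)) * (K2 * sobolev_sq 1 (eta N))"
    using hd Vb_nonneg lam_pos K20 by (intro mult_left_mono add_nonneg_nonneg mult_nonneg_nonneg) auto
  finally show ?thesis by (simp add: K3_def mult.assoc)
qed

end

text \<open>On the frequencies of X_N the weight is at most a constant times N^2. This gives the H^1
  half of the final estimate from the L^2 half.\<close>

lemma inverse_inequality:
  fixes v :: "real^'n \<Rightarrow> real"
  assumes v: "v \<in> XN N" and N: "0 < N"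
  shows "sqrt (sobolev_sq 1 v) \<le> sqrt (1 + (2 * pi)\<^sup>2) * (real N * sqrt (nsq v))"
proof -
  have N1: "1 \<le> (real N)\<^sup>2" using N by (simp add: one_le_power)
  have "sobolev_sq 1 v \<le> (\<Sum>k\<in>KN N. ((1 + (2 * pi)\<^sup>2) * (real N)\<^sup>2) * (cmod (fcoef v k))\<^sup>2)"
    unfolding sobolev_sq_XN[OF v]
  proof (intro sum_mono mult_right_mono)
    fix k :: "real^'n" assume "k \<in> KN N"
    then have "(norm k)\<^sup>2 \<le> (real N)\<^sup>2" by (intro power_mono) (auto simp: KN_def)
    then have "(2 * pi)\<^sup>2 * (norm k)\<^sup>2 \<le> (2 * pi)\<^sup>2 * (real N)\<^sup>2" by (intro mult_left_mono) auto
    then have "wt k \<le> (real N)\<^sup>2 + (2 * pi)\<^sup>2 * (real N)\<^sup>2"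
      unfolding wt_def kap_def power_mult_distrib[of "2 * pi"] using N1 by linarith
    then show "wt k ^ 1 \<le> (1 + (2 * pi)\<^sup>2) * (real N)\<^sup>2" by (simp add: distrib_right)
  qed auto
  also have "\<dots> = ((1 + (2 * pi)\<^sup>2) * (real N)\<^sup>2) * nsq v"
    unfolding nsq_trig[OF v] by (simp only: sum_distrib_left)
  finally have "sqrt (sobolev_sq 1 v) \<le> sqrt (((1 + (2 * pi)\<^sup>2) * (real N)\<^sup>2) * nsq v)" by (rule real_sqrt_le_mono)
  then show ?thesis by (simp only: real_sqrt_mult real_sqrt_abs abs_of_nonneg of_nat_0_le_iff mult.assoc)
qed

context ground_state
begin

subsection \<open>The duality argument\<close>

text \<open>In \<open>BL (eta N) \<psi>\<close> with \<psi> in X_N, the Dirichlet term and the term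
  with \<open>lam\<close> vanish by orthogonality; G is what remains of the potential.\<close>

definition G where "G = (\<lambda>x. V x + 3 * (u x)\<^sup>2)"

lemma G_hreg2: "sobolev 2 G" unfolding G_def by (intro sobolev_add sobolev_cmult V_reg usq_hreg2)

text \<open>\<open>K1\<close> bounds the squared H^1 norm of d by that of eta; \<open>K4\<close>
  bounds \<open>BL w w\<close>; \<open>K5\<close> bounds the squared H^2 norm of \<psi> by nsq e;
  \<open>K6\<close> belongs to the cubic remainder; \<open>K7\<close> collects the terms quadratic
  in d; \<open>K8\<close> belongs to the integral of G eta \<psi>; \<open>K9\<close> combines
  them.\<close>

definition K1 where "K1 = KG * K3"
definition K4 where "K4 = (1 + Wb) * (2 * sobolev_sq 1 u + 2 * (K1 * sobolev_sq 4 u))"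
definition K5 where "K5 = 2 * Cd + 2 * (K4\<^sup>2 * Cd) * Cd"
definition K6 where "K6 = 3 * sqrt lam + 1 / 2 + lattice_sum TYPE('n) * (K1 * sobolev_sq 4 u)"
definition K7 where "K7 = K4 * sqrt Cd + sqrt (lattice_sum TYPE('n) * K5) * K6"
definition K8 where "K8 = sqrt (16 * lattice_sum TYPE('n) * sobolev_sq 2 G * K5)"
definition K9 where "K9 = K7 * K1 * sqrt (sobolev_sq 4 u) + K8"

lemma K1_nonneg: "0 \<le> K1"
  unfolding K1_def KG_def K3_def K2_def using lam_pos Vb_nonneg
  by (intro mult_nonneg_nonneg add_nonneg_nonneg) auto

lemma Wb_nonneg: "0 \<le> Wb" unfolding Wb_def using lam_pos Vb_nonneg by simp
lemma K4_nonneg: "0 \<le> K4" unfolding K4_def using Wb_nonneg K1_nonneg by simp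
lemma Cd_nonneg: "0 \<le> Cd" unfolding Cd_def by simp
lemma K5_nonneg: "0 \<le> K5" unfolding K5_def using Cd_nonneg by simp
lemma K6_nonneg: "0 \<le> K6" unfolding K6_def using lam_pos K1_nonneg by simp
lemma K7_nonneg: "0 \<le> K7" unfolding K7_def using K4_nonneg Cd_nonneg K5_nonneg K6_nonneg by simp

lemma BL_add_scale_right:
  assumes "sobolev 1 f" "sobolev 1 g" "sobolev 1 h"
  shows "BL h (\<lambda>x. f x + c * g x) = BL h f + c * BL h g"
  using BL_add_scale[OF assms] by (simp only: BL_commute[of h])

lemma BL_Cauchy_Schwarz:
  assumes p: "p \<in> XN N" and q: "q \<in> XN N"
  shows "(BL p q)\<^sup>2 \<le> BL p p * BL q q"
proof (rule quadratic_nonneg_discriminant)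
  have nn: "0 \<le> BL v v" if "v \<in> XN N" for v
    using BL_coercive[OF that] nsq_nonneg[of v] c0(1) by (smt (verit) mult_nonneg_nonneg zero_le_power2)
  show "0 \<le> BL q q" by (rule nn[OF q])
  fix t :: real
  have hp: "sobolev 1 p" "sobolev 1 q" using sobolev_XN p q by auto
  have hpq: "sobolev 1 (\<lambda>x. p x + t * q x)" by (intro sobolev_add sobolev_cmult hp)
  have "0 \<le> BL (\<lambda>x. p x + t * q x) (\<lambda>x. p x + t * q x)" by (intro nn XN_add_scale p q)
  also have "\<dots> = BL p p + 2 * t * BL p q + t\<^sup>2 * BL q q"
    unfolding BL_add_scale[OF hp hpq] BL_add_scale_right[OF hp hp(1)] BL_add_scale_right[OF hp hp(2)] BL_commute[of q p]
    by (simp add: power2_eq_square algebra_simps)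
  finally show "0 \<le> BL p p + 2 * t * BL p q + t\<^sup>2 * BL q q" .
qed

lemma W_split:
  assumes "L2 f" "L2 g"
  shows "integral\<^sup>L torus (\<lambda>x. W x * (f x * g x)) = integral\<^sup>L torus (\<lambda>x. V x * (f x * g x)) + 3 * integral\<^sup>L torus (\<lambda>x. (u x)\<^sup>2 * (f x * g x)) - lam * ip f g"
proof -
  have "W x * (f x * g x) = V x * (f x * g x) + 3 * ((u x)\<^sup>2 * (f x * g x)) - lam * (f x * g x)" for x
    by (simp add: W_def algebra_simps)
  then show ?thesis
    using L2_mult_integrable[OF assms] V_int[OF L2_mult_integrable[OF assms]] usq_int[OF L2_mult_integrable[OF assms]] by simp
qed

text \<open>\<psi> is bounded by its H^2 norm, |d|^3 <= (d^2 + d^4) / 2, and the a priori bound on d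
  reduces the d^4 part to second order.\<close>

lemma cubic_term_le:
  assumes d: "sobolev 1 d" and D: "sobolev_sq 1 d \<le> K1 * sobolev_sq 4 u" and \<psi>: "\<psi> \<in> XN N"
  shows "\<bar>integral\<^sup>L torus (\<lambda>x. (3 * u x * (d x)\<^sup>2 + (d x)^3) * \<psi> x)\<bar> \<le> sqrt (lattice_sum TYPE('n) * sobolev_sq 2 \<psi>) * (K6 * sobolev_sq 1 d)"
proof -
  define s where "s = sqrt (lattice_sum TYPE('n) * sobolev_sq 2 \<psi>)"
  have s0: "0 \<le> s" by (simp add: s_def)
  have dL: "L2 d" by (rule sobolev_L2[OF d])
  have [measurable]: "d \<in> borel_measurable torus" by (rule L2_meas[OF dL])
  have [measurable]: "\<psi> \<in> borel_measurable torus" by (rule L2_meas[OF XN_L2[OF \<psi>]])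
  have d4: "L2 (\<lambda>x. (d x)\<^sup>2)" by (rule L4_embedding(1)[OF summable_weights d])
  have s: "\<bar>\<psi> x\<bar> \<le> s" for x
    unfolding s_def using sup_XN_le[OF summable_weights \<psi>, of x] by (metis real_sqrt_abs real_sqrt_le_mono)
  define R where "R = (\<lambda>x. s * ((3 * sqrt lam + 1 / 2) * (d x)\<^sup>2 + (1 / 2) * ((d x)\<^sup>2)\<^sup>2))"
  have Ri: "integrable torus R" unfolding R_def using L2_sq[OF dL] L2_sq[OF d4] by simp
  have bd: "AE x in torus. \<bar>(3 * u x * (d x)\<^sup>2 + (d x)^3) * \<psi> x\<bar> \<le> R x"
    using u_bounded
  proof eventually_elim
    case (elim x)
    have "\<bar>3 * u x * (d x)\<^sup>2\<bar> \<le> 3 * sqrt lam * (d x)\<^sup>2"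
      using elim by (simp add: abs_mult mult_right_mono)
    moreover have "\<bar>(d x)^3\<bar> \<le> 1 / 2 * (d x)\<^sup>2 + 1 / 2 * ((d x)\<^sup>2)\<^sup>2"
    proof -
      have "2 * \<bar>d x\<bar> * (d x)\<^sup>2 \<le> \<bar>d x\<bar>\<^sup>2 + ((d x)\<^sup>2)\<^sup>2" by (rule sum_squares_bound)
      then show ?thesis by (simp add: power3_eq_cube power2_eq_square abs_mult)
    qed
    ultimately have "\<bar>3 * u x * (d x)\<^sup>2 + (d x)^3\<bar> \<le> (3 * sqrt lam + 1 / 2) * (d x)\<^sup>2 + (1 / 2) * ((d x)\<^sup>2)\<^sup>2"
      by (simp add: algebra_simps)
    then have "\<bar>3 * u x * (d x)\<^sup>2 + (d x)^3\<bar> * \<bar>\<psi> x\<bar> \<le> ((3 * sqrt lam + 1 / 2) * (d x)\<^sup>2 + (1 / 2) * ((d x)\<^sup>2)\<^sup>2) * s"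
      by (intro mult_mono s) auto
    then show ?case by (simp only: R_def abs_mult mult.commute[of s])
  qed
  have int: "integrable torus (\<lambda>x. (3 * u x * (d x)\<^sup>2 + (d x)^3) * \<psi> x)"
  proof (rule Bochner_Integration.integrable_bound[OF Ri])
    show "AE x in torus. norm ((3 * u x * (d x)\<^sup>2 + (d x)^3) * \<psi> x) \<le> norm (R x)"
      using bd by eventually_elim auto
  qed measurable
  have "\<bar>integral\<^sup>L torus (\<lambda>x. (3 * u x * (d x)\<^sup>2 + (d x)^3) * \<psi> x)\<bar> \<le> integral\<^sup>L torus (\<lambda>x. \<bar>(3 * u x * (d x)\<^sup>2 + (d x)^3) * \<psi> x\<bar>)"
    by (rule integral_abs_bound)
  also have "\<dots> \<le> integral\<^sup>L torus R" by (rule integral_mono_AE[OF integrable_abs[OF int] Ri bd])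
  also have "\<dots> = s * ((3 * sqrt lam + 1 / 2) * nsq d + (1 / 2) * nsq (\<lambda>x. (d x)\<^sup>2))"
    unfolding R_def using L2_sq[OF dL] L2_sq[OF d4] by simp
  also have "\<dots> \<le> s * (K6 * sobolev_sq 1 d)"
  proof (rule mult_left_mono[OF _ s0])
    have "nsq (\<lambda>x. (d x)\<^sup>2) \<le> 2 * lattice_sum TYPE('n) * (sobolev_sq 1 d)\<^sup>2" by (rule L4_embedding(2)[OF summable_weights d])
    also have "\<dots> \<le> 2 * lattice_sum TYPE('n) * ((K1 * sobolev_sq 4 u) * sobolev_sq 1 d)"
      unfolding power2_eq_square using D by (intro mult_left_mono mult_right_mono) auto
    finally have "(1 / 2) * nsq (\<lambda>x. (d x)\<^sup>2) \<le> lattice_sum TYPE('n) * (K1 * sobolev_sq 4 u) * sobolev_sq 1 d" by simp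
    moreover have "(3 * sqrt lam + 1 / 2) * nsq d \<le> (3 * sqrt lam + 1 / 2) * sobolev_sq 1 d"
      using lam_pos by (intro mult_left_mono nsq_le_sobolev_sq d) auto
    ultimately show "(3 * sqrt lam + 1 / 2) * nsq d + (1 / 2) * nsq (\<lambda>x. (d x)\<^sup>2) \<le> K6 * sobolev_sq 1 d"
      by (simp add: K6_def distrib_right)
  qed
  finally show ?thesis by (simp add: s_def)
qed

text \<open>\<open>BL e \<psi>\<close> is evaluated twice. By the dual equations it is nsq e plus a
  correction quadratic in d; by the equations for u and w it is a Taylor remainder minus the
  integral of G eta \<psi>.\<close>

lemma superconvergence:
  assumes N: "0 < N" and small: "nsq (eta N) \<le> 3 / 4"
    and min: "is_minimiser_on V (XN N) w" and sgn: "0 \<le> ip w u"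
  shows "sqrt (nsq (\<lambda>x. proj N u x - w x)) \<le> K9 * sqrt (sobolev_sq 1 (eta N)) / (real N)^3"
proof -
  have w: "w \<in> XN N" "nsq w = 1" and wmin: "\<And>v. v \<in> XN N \<Longrightarrow> nsq v = 1 \<Longrightarrow> E_eig V w \<le> E_eig V v"
    using min by (auto simp: is_minimiser_on_def L2_norm_nsq)
  define p where "p = proj N u"
  have pX: "p \<in> XN N" unfolding p_def by (rule trig_XN)
  define e where "e = (\<lambda>x. p x + (-1) * w x)"
  have eX: "e \<in> XN N" unfolding e_def by (rule XN_add_scale[OF pX w(1)])
  define d where "d = (\<lambda>x. w x - u x)"
  have wL: "L2 w" and eL: "L2 e" and pL: "L2 p" using XN_L2 w eX pX by auto
  have w1: "sobolev 1 w" and e1: "sobolev 1 e" using sobolev_XN w eX by auto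
  have d1: "sobolev 1 d" unfolding d_def by (rule sobolev_diff[OF w1 u_hreg1])
  have dL: "L2 d" by (rule sobolev_L2[OF d1])
  define x where "x = sqrt (nsq e)"
  have x0: "0 \<le> x" and x2: "x\<^sup>2 = nsq e" by (auto simp: x_def)
  define h where "h = sqrt (sobolev_sq 1 (eta N))"
  have h0: "0 \<le> h" and h2: "h\<^sup>2 = sobolev_sq 1 (eta N)" by (auto simp: h_def)
  have KG0: "0 \<le> KG" unfolding KG_def using lam_pos by (intro add_nonneg_nonneg mult_nonneg_nonneg) auto
  have Dh: "sobolev_sq 1 d \<le> K1 * h\<^sup>2"
  proof -
    have "sobolev_sq 1 d \<le> KG * Q w" unfolding d_def by (rule minimiser_distance_le[OF w sgn])
    also have "\<dots> \<le> KG * (K3 * sobolev_sq 1 (eta N))"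
      by (intro mult_left_mono energy_proj_le[OF N small w wmin] KG0)
    finally show ?thesis by (simp add: K1_def h2 mult.assoc)
  qed
  have N3: "0 < (real N)^3" using N by simp
  have hN: "h * (real N)^3 \<le> sqrt (sobolev_sq 4 u)"
  proof (rule real_le_rsqrt)
    have "(h * (real N)^3)\<^sup>2 = (real N)^6 * sobolev_sq 1 (eta N)"
      by (simp add: power_mult_distrib h2 mult.commute flip: power_mult)
    then show "(h * (real N)^3)\<^sup>2 \<le> sobolev_sq 4 u" using sobolev_sq_eta_le[of N] by simp
  qed
  have hH: "h\<^sup>2 \<le> sobolev_sq 4 u"
  proof -
    have "h * 1 \<le> h * (real N)^3" using N h0 by (intro mult_left_mono one_le_power) auto
    then have "h \<le> sqrt (sobolev_sq 4 u)" using hN by simp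
    then have "h\<^sup>2 \<le> (sqrt (sobolev_sq 4 u))\<^sup>2" using h0 by (intro power_mono)
    then show ?thesis by simp
  qed
  have DH: "sobolev_sq 1 d \<le> K1 * sobolev_sq 4 u" using Dh mult_left_mono[OF hH K1_nonneg] by linarith
  have hw: "sobolev_sq 1 w \<le> 2 * sobolev_sq 1 u + 2 * (K1 * sobolev_sq 4 u)"
    using sobolev_sq_add_le[OF u_hreg1 d1] DH by (simp add: d_def)
  have BLw: "BL w w \<le> K4"
  proof -
    have "integral\<^sup>L torus (\<lambda>x. W x * (w x * w x)) \<le> Wb * integral\<^sup>L torus (\<lambda>x. w x * w x)"
      by (rule integral_bounded_le[OF L2_mult_integrable[OF wL wL] _ W_meas W_bounded]) auto
    also have "integral\<^sup>L torus (\<lambda>x. w x * w x) \<le> sobolev_sq 1 w" using nsq_le_sobolev_sq[OF w1] by (simp add: power2_eq_square)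
    finally have "integral\<^sup>L torus (\<lambda>x. W x * (w x * w x)) \<le> Wb * sobolev_sq 1 w" using Wb_nonneg by (simp add: mult_left_mono)
    moreover have "dirichlet w w \<le> sobolev_sq 1 w" using sobolev_sq_1[OF w1] nsq_nonneg[of w] by linarith
    ultimately have "BL w w \<le> (1 + Wb) * sobolev_sq 1 w" unfolding BL_def by (simp add: distrib_right)
    also have "\<dots> \<le> K4" unfolding K4_def using hw Wb_nonneg by (intro mult_left_mono) auto
    finally show ?thesis .
  qed
  \<comment> \<open>\<psi>1 is dual to the error e; \<psi>2, dual to w, serves to correct \<psi>1 to
    be orthogonal to w.\<close>
  obtain \<psi>1 where \<psi>1: "\<psi>1 \<in> XN N" "\<And>v. v \<in> XN N \<Longrightarrow> BL \<psi>1 v = ip e v" "sobolev_sq 2 \<psi>1 \<le> Cd * nsq e"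
    using dual_solution[OF eL] by blast
  obtain \<psi>2 where \<psi>2: "\<psi>2 \<in> XN N" "\<And>v. v \<in> XN N \<Longrightarrow> BL \<psi>2 v = ip w v" "sobolev_sq 2 \<psi>2 \<le> Cd * nsq w"
    using dual_solution[OF wL] by blast
  have L1: "L2 \<psi>1" "sobolev 1 \<psi>1" and L2': "L2 \<psi>2" "sobolev 1 \<psi>2" using XN_L2 sobolev_XN \<psi>1 \<psi>2 by auto
  define b where "b = ip w \<psi>2"
  have b: "b = BL \<psi>2 \<psi>2" unfolding b_def by (rule \<psi>2(2)[OF \<psi>2(1), symmetric])
  have b0: "0 \<le> b" unfolding b using BL_coercive[OF \<psi>2(1)] nsq_nonneg[of \<psi>2] by (smt (verit) mult_nonneg_nonneg zero_le_power2)
  \<comment> \<open>b cannot be small: Cauchy-Schwarz for \<open>BL\<close> gives 1 = (ip w w)^2 <=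
    b * BL w w, and \<open>BL w w\<close> is bounded uniformly in N.\<close>
  have "(BL \<psi>2 w)\<^sup>2 \<le> BL \<psi>2 \<psi>2 * BL w w" by (rule BL_Cauchy_Schwarz[OF \<psi>2(1) w(1)])
  also have "BL \<psi>2 w = 1" using \<psi>2(2)[OF w(1)] w(2) by (simp add: power2_eq_square)
  finally have "1 \<le> b * BL w w" by (simp add: b)
  also have "\<dots> \<le> b * K4" by (rule mult_left_mono[OF BLw b0])
  finally have bK: "1 \<le> b * K4" .
  then have bpos: "0 < b" using b0 K4_nonneg by (cases "b = 0") auto
  \<comment> \<open>The value for which ip w \<psi> = 0.\<close>
  define \<tau> where "\<tau> = - (ip w \<psi>1) / b"
  have \<tau>2: "\<tau>\<^sup>2 \<le> K4\<^sup>2 * Cd * nsq e"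
  proof -
    have "1 / b \<le> K4" using bK bpos by (simp add: divide_le_eq mult.commute)
    then have "(1 / b)\<^sup>2 \<le> K4\<^sup>2" using bpos by (intro power_mono) auto
    moreover have "(ip w \<psi>1)\<^sup>2 \<le> Cd * nsq e"
      using ip_Cauchy_Schwarz[OF wL L1(1)] w(2) nsq_le_sobolev_sq[OF sobolev_XN[OF \<psi>1(1)], of 2] \<psi>1(3) by simp
    ultimately have "(1 / b)\<^sup>2 * (ip w \<psi>1)\<^sup>2 \<le> K4\<^sup>2 * (Cd * nsq e)" by (intro mult_mono) auto
    then show ?thesis by (simp add: \<tau>_def power_divide mult.assoc)
  qed
  define \<psi> where "\<psi> = (\<lambda>x. \<psi>1 x + \<tau> * \<psi>2 x)"
  have \<psi>X: "\<psi> \<in> XN N" unfolding \<psi>_def by (rule XN_add_scale[OF \<psi>1(1) \<psi>2(1)])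
  have \<psi>L: "L2 \<psi>" and \<psi>h: "sobolev 1 \<psi>" using XN_L2 sobolev_XN \<psi>X by auto
  have h\<psi>: "sobolev_sq 2 \<psi> \<le> K5 * x\<^sup>2"
  proof -
    have "sobolev_sq 2 \<psi> \<le> 2 * sobolev_sq 2 \<psi>1 + 2 * sobolev_sq 2 (\<lambda>x. \<tau> * \<psi>2 x)"
      unfolding \<psi>_def by (intro sobolev_sq_add_le sobolev_cmult sobolev_XN[OF \<psi>1(1)] sobolev_XN[OF \<psi>2(1)])
    also have "sobolev_sq 2 (\<lambda>x. \<tau> * \<psi>2 x) = \<tau>\<^sup>2 * sobolev_sq 2 \<psi>2" by (rule sobolev_sq_cmult)
    also have "\<tau>\<^sup>2 * sobolev_sq 2 \<psi>2 \<le> (K4\<^sup>2 * Cd * nsq e) * Cd"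
      using \<psi>2(3) w(2) Cd_nonneg by (intro mult_mono \<tau>2) auto
    finally have "sobolev_sq 2 \<psi> \<le> 2 * (Cd * nsq e) + 2 * ((K4\<^sup>2 * Cd * nsq e) * Cd)" using \<psi>1(3) by linarith
    then show ?thesis by (simp add: K5_def x2 algebra_simps)
  qed
  have w\<psi>: "ip w \<psi> = 0"
  proof -
    have "ip \<psi> w = ip \<psi>1 w + \<tau> * ip \<psi>2 w" unfolding \<psi>_def by (rule ip_add_scale[OF L1(1) L2'(1) wL])
    then have "ip w \<psi> = ip w \<psi>1 + \<tau> * b" unfolding b_def by (simp only: ip_commute[of _ w])
    then show ?thesis using bpos by (simp add: \<tau>_def)
  qed
  have "BL \<psi> e = BL \<psi>1 e + \<tau> * BL \<psi>2 e" unfolding \<psi>_def by (rule BL_add_scale[OF L1(2) L2'(2) e1])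
  then have BL\<psi>e: "BL \<psi> e = nsq e + \<tau> * ip w e"
    using \<psi>1(2)[OF eX] \<psi>2(2)[OF eX] by (simp add: nsq_ip)
  \<comment> \<open>p and u have the same product with w, and both w and u are normalised; so the
    correction by \<psi>2 enters only at second order in d.\<close>
  have we: "ip w e = - (nsq d) / 2"
  proof -
    have "ip (eta N) w = 0" by (rule ip_eta_XN[OF w(1)])
    moreover have "ip (\<lambda>x. u x + (-1) * p x) w = ip u w + (-1) * ip p w" by (rule ip_add_scale[OF u_L2 pL wL])
    ultimately have pw: "ip p w = ip w u" by (simp add: eta_def p_def mult.commute)
    have "ip e w = ip p w + (-1) * ip w w" unfolding e_def by (rule ip_add_scale[OF pL wL wL])
    then have "ip w e = ip w u - 1" using pw w(2) ip_commute[of e w] by (simp add: nsq_ip)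
    moreover have "nsq d = 2 - 2 * ip w u"
      using nsq_add_scale[OF wL u_L2, of "-1"] w(2) nsq_u by (simp add: d_def)
    ultimately show ?thesis by simp
  qed
  have u\<psi>: "integrable torus (\<lambda>x. u x * \<psi> x)" and ww\<psi>: "integrable torus (\<lambda>x. w x * \<psi> x)"
    by (intro L2_mult_integrable u_L2 wL \<psi>L)+
  have [measurable]: "w \<in> borel_measurable torus" "\<psi> \<in> borel_measurable torus" using wL \<psi>L L2_meas by auto
  have u3: "integrable torus (\<lambda>x. (u x)^3 * \<psi> x)" and w3: "integrable torus (\<lambda>x. (w x)^3 * \<psi> x)"
    by (intro quartic_integrable(2) L4_embedding(1)[OF summable_weights] u_hreg1 w1 \<psi>h; measurable)+
  have u2w: "integrable torus (\<lambda>x. (u x)\<^sup>2 * (w x * \<psi> x))" by (rule usq_int[OF ww\<psi>])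
  \<comment> \<open>Orthogonality of \<psi> and w removes the discrete multiplier, so its distance
    from \<open>lam\<close> never has to be estimated.\<close>
  have ELw: "dirichlet w \<psi> + integral\<^sup>L torus (\<lambda>x. V x * (w x * \<psi> x)) + integral\<^sup>L torus (\<lambda>x. (w x)^3 * \<psi> x) = 0"
    using Euler_Lagrange[OF summable_weights V_meas V_bounded min _ _ _ \<psi>X] w\<psi>
    by (auto intro: sobolev_XN XN_add_scale XN_cmult)
  have BLu: "BL u \<psi> = 2 * integral\<^sup>L torus (\<lambda>x. (u x)^3 * \<psi> x)"
  proof -
    have e3: "(u x)\<^sup>2 * (u x * \<psi> x) = (u x)^3 * \<psi> x" for x by (simp add: power2_eq_square power3_eq_cube)
    show ?thesis unfolding BL_def W_split[OF u_L2 \<psi>L] e3 using EL[OF \<psi>h] by linarith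
  qed
  have BLw\<psi>: "BL w \<psi> = 3 * integral\<^sup>L torus (\<lambda>x. (u x)\<^sup>2 * (w x * \<psi> x)) - integral\<^sup>L torus (\<lambda>x. (w x)^3 * \<psi> x)"
    unfolding BL_def W_split[OF wL \<psi>L] w\<psi> using ELw by simp
  have BLeta: "BL (eta N) \<psi> = ip (eta N) (\<lambda>x. G x * \<psi> x)"
  proof -
    have i: "integrable torus (\<lambda>x. eta N x * \<psi> x)" by (rule L2_mult_integrable[OF eta_L2 \<psi>L])
    have "eta N x * (G x * \<psi> x) = V x * (eta N x * \<psi> x) + 3 * ((u x)\<^sup>2 * (eta N x * \<psi> x))" for x
      by (simp add: G_def algebra_simps)
    then show ?thesis
      unfolding BL_def W_split[OF eta_L2 \<psi>L] ip_eta_XN[OF \<psi>X] dirichlet_eta_XN[OF \<psi>X]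
      using V_int[OF i] usq_int[OF i] by simp
  qed
  \<comment> \<open>With w = u + d, 2 u^3 - 3 u^2 w + w^3 = 3 u d^2 + d^3: the terms linear in d
    cancel because \<open>BL\<close> is the linearisation at u.\<close>
  define T where "T = integral\<^sup>L torus (\<lambda>x. (3 * u x * (d x)\<^sup>2 + (d x)^3) * \<psi> x)"
  have BLe: "BL e \<psi> = T - ip (eta N) (\<lambda>x. G x * \<psi> x)"
  proof -
    have "e = (\<lambda>x. (u x + (-1) * eta N x) + (-1) * w x)"
      by (rule ext) (simp add: e_def eta_def p_def)
    then have "BL e \<psi> = BL u \<psi> + (-1) * BL (eta N) \<psi> + (-1) * BL w \<psi>"
      using BL_add_scale[OF sobolev_add[OF u_hreg1 sobolev_cmult[OF eta_hreg1]] w1 \<psi>h, of "-1" N "-1"]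
        BL_add_scale[OF u_hreg1 eta_hreg1 \<psi>h, of "-1" N] by simp
    also have "\<dots> = 2 * integral\<^sup>L torus (\<lambda>x. (u x)^3 * \<psi> x) - 3 * integral\<^sup>L torus (\<lambda>x. (u x)\<^sup>2 * (w x * \<psi> x)) + integral\<^sup>L torus (\<lambda>x. (w x)^3 * \<psi> x) - ip (eta N) (\<lambda>x. G x * \<psi> x)"
      unfolding BLu BLw\<psi> BLeta by simp
    also have "2 * integral\<^sup>L torus (\<lambda>x. (u x)^3 * \<psi> x) - 3 * integral\<^sup>L torus (\<lambda>x. (u x)\<^sup>2 * (w x * \<psi> x)) + integral\<^sup>L torus (\<lambda>x. (w x)^3 * \<psi> x)
       = integral\<^sup>L torus (\<lambda>x. 2 * ((u x)^3 * \<psi> x) - 3 * ((u x)\<^sup>2 * (w x * \<psi> x)) + (w x)^3 * \<psi> x)"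
      using u3 u2w w3 by simp
    also have "\<dots> = T" unfolding T_def
      by (intro Bochner_Integration.integral_cong refl)
         (simp add: d_def power2_eq_square power3_eq_cube algebra_simps)
    finally show ?thesis .
  qed
  have T: "\<bar>T\<bar> \<le> (sqrt (lattice_sum TYPE('n) * K5) * K6 * sobolev_sq 1 d) * x"
  proof -
    have "\<bar>T\<bar> \<le> sqrt (lattice_sum TYPE('n) * sobolev_sq 2 \<psi>) * (K6 * sobolev_sq 1 d)" unfolding T_def by (rule cubic_term_le[OF d1 DH \<psi>X])
    also have "\<dots> \<le> (sqrt (lattice_sum TYPE('n) * K5) * x) * (K6 * sobolev_sq 1 d)"
    proof (rule mult_right_mono)
      have "sqrt (lattice_sum TYPE('n) * sobolev_sq 2 \<psi>) \<le> sqrt (lattice_sum TYPE('n) * (K5 * x\<^sup>2))"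
        by (intro real_sqrt_le_mono mult_left_mono h\<psi>) simp
      also have "\<dots> = sqrt (lattice_sum TYPE('n) * K5) * x" using x0 by (simp add: real_sqrt_mult mult.assoc)
      finally show "sqrt (lattice_sum TYPE('n) * sobolev_sq 2 \<psi>) \<le> sqrt (lattice_sum TYPE('n) * K5) * x" .
    qed (use K6_nonneg in simp)
    finally show ?thesis by (simp only: mult_ac)
  qed
  have et: "\<bar>ip (eta N) (\<lambda>x. G x * \<psi> x)\<bar> \<le> (K8 * h / (real N)^3) * x"
  proof -
    have G\<psi>: "sobolev 2 (\<lambda>x. G x * \<psi> x)" by (rule sobolev_mult[OF summable_weights G_hreg2 sobolev_XN[OF \<psi>X]])
    have "sobolev_sq 2 (\<lambda>x. G x * \<psi> x) \<le> 16 * lattice_sum TYPE('n) * (sobolev_sq 2 G * sobolev_sq 2 \<psi>)" by (rule sobolev_sq_mult_le[OF summable_weights G_hreg2 sobolev_XN[OF \<psi>X]])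
    also have "\<dots> \<le> 16 * lattice_sum TYPE('n) * (sobolev_sq 2 G * (K5 * x\<^sup>2))" by (intro mult_left_mono h\<psi>) auto
    also have "\<dots> = (16 * lattice_sum TYPE('n) * sobolev_sq 2 G * K5) * x\<^sup>2" by simp
    finally have "sqrt (sobolev_sq 2 (\<lambda>x. G x * \<psi> x)) \<le> sqrt ((16 * lattice_sum TYPE('n) * sobolev_sq 2 G * K5) * x\<^sup>2)" by (rule real_sqrt_le_mono)
    also have "\<dots> = K8 * x" using x0 by (simp only: K8_def real_sqrt_mult real_sqrt_abs abs_of_nonneg)
    finally have sq: "sqrt (sobolev_sq 2 (\<lambda>x. G x * \<psi> x)) \<le> K8 * x" .
    have "\<bar>ip (eta N) (\<lambda>x. G x * \<psi> x)\<bar> \<le> h * sqrt (sobolev_sq 2 (\<lambda>x. G x * \<psi> x)) / (real N)^3"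
      unfolding h_def by (rule ip_eta_hreg2[OF G\<psi> N])
    also have "\<dots> \<le> h * (K8 * x) / (real N)^3"
      using N3 h0 sq by (intro divide_right_mono mult_left_mono) auto
    finally show ?thesis by (simp add: mult_ac)
  qed
  have tw: "\<bar>\<tau> * ip w e\<bar> \<le> (K4 * sqrt Cd * sobolev_sq 1 d) * x"
  proof -
    have "\<bar>\<tau>\<bar> \<le> sqrt (K4\<^sup>2 * Cd * nsq e)" using \<tau>2 by (metis real_sqrt_abs real_sqrt_le_mono)
    also have "\<dots> = K4 * sqrt Cd * x"
      using K4_nonneg by (simp only: real_sqrt_mult real_sqrt_abs abs_of_nonneg x_def)
    finally have t: "\<bar>\<tau>\<bar> \<le> K4 * sqrt Cd * x" .
    have "\<bar>ip w e\<bar> \<le> sobolev_sq 1 d" unfolding we using nsq_le_sobolev_sq[OF d1] nsq_nonneg[of d] by linarith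
    then have "\<bar>\<tau>\<bar> * \<bar>ip w e\<bar> \<le> (K4 * sqrt Cd * x) * sobolev_sq 1 d"
      using t K4_nonneg Cd_nonneg x0 by (intro mult_mono) auto
    then show ?thesis by (simp only: abs_mult mult_ac)
  qed
  have "x * x = BL \<psi> e - \<tau> * ip w e" using BL\<psi>e x2 by (simp add: power2_eq_square)
  also have "\<dots> = T - ip (eta N) (\<lambda>x. G x * \<psi> x) - \<tau> * ip w e" using BLe BL_commute[of \<psi> e] by simp
  also have "\<dots> \<le> \<bar>T\<bar> + \<bar>ip (eta N) (\<lambda>x. G x * \<psi> x)\<bar> + \<bar>\<tau> * ip w e\<bar>" by linarith
  also have "\<dots> \<le> (sqrt (lattice_sum TYPE('n) * K5) * K6 * sobolev_sq 1 d) * x + (K8 * h / (real N)^3) * x + (K4 * sqrt Cd * sobolev_sq 1 d) * x"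
    by (intro add_mono T et tw)
  also have "\<dots> = (K7 * sobolev_sq 1 d + K8 * h / (real N)^3) * x" by (simp add: K7_def algebra_simps)
  finally have xx: "x * x \<le> (K7 * sobolev_sq 1 d + K8 * h / (real N)^3) * x" .
  have K80: "0 \<le> K8" unfolding K8_def using K5_nonneg by simp
  have rhs0: "0 \<le> K7 * sobolev_sq 1 d + K8 * h / (real N)^3" using K7_nonneg K80 h0 by simp
  \<comment> \<open>x is the L^2 norm of e; one factor x is cancelled.\<close>
  have "x \<le> K7 * sobolev_sq 1 d + K8 * h / (real N)^3"
    using xx x0 rhs0 by (cases "x = 0") auto
  also have "\<dots> \<le> K7 * (K1 * h\<^sup>2) + K8 * h / (real N)^3"
    by (intro add_right_mono mult_left_mono Dh K7_nonneg)
  \<comment> \<open>One of the two factors h is traded for a multiple of N^-3 by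
    \<open>hN\<close>.\<close>
  also have "h\<^sup>2 \<le> h * (sqrt (sobolev_sq 4 u) / (real N)^3)"
    unfolding power2_eq_square using hN N3 h0 by (intro mult_left_mono) (auto simp: pos_le_divide_eq)
  finally have "x \<le> K7 * (K1 * (h * (sqrt (sobolev_sq 4 u) / (real N)^3))) + K8 * h / (real N)^3"
    using K7_nonneg K1_nonneg by (simp add: mult_left_mono)
  also have "\<dots> = K9 * h / (real N)^3" by (simp add: K9_def add_divide_distrib algebra_simps)
  finally show ?thesis by (simp add: x_def e_def p_def h_def)
qed

lemma eta_small: "\<exists>N0. \<forall>N\<ge>N0. nsq (eta N) \<le> 3 / 4"
proof -
  have "(\<lambda>N. nsq (eta N)) \<longlonglongrightarrow> 0" unfolding eta_def by (rule proj_tendsto[OF u_L2])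
  then have "eventually (\<lambda>N. nsq (eta N) < 3 / 4) sequentially" by (rule order_tendstoD) simp
  then show ?thesis unfolding eventually_sequentially by (meson less_imp_le)
qed

end

section \<open>Assembly of the L^2 and H^1 estimates\<close>

theorem theorem6p2:
  fixes V u_star :: "real^'n \<Rightarrow> real"
    and uN :: "nat \<Rightarrow> real^'n \<Rightarrow> real"
    and rv Vmin :: real
  assumes dim: "CARD('n) \<le> 3"
    and rv: "rv \<ge> 2" and V_reg: "in_Hs rv V"
    and Vmin: "Vmin > 0" and V_lower: "AE x in lborel. x \<in> Omega \<longrightarrow> V x \<ge> Vmin"
    and u_min: "is_minimiser_on V Xsp u_star"
    and u_pos: "AE x in lborel. x \<in> Omega \<longrightarrow> u_star x > 0"
    and uN_min: "\<And>N. is_minimiser_on V (XN N) (uN N)"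
    and uN_sign: "\<And>N. L2_inner (uN N) u_star \<ge> 0"
  shows "\<exists>C N0. \<forall>N\<ge>N0.
           L2_norm (\<lambda>x. PiN N u_star x - uN N x)
             + (1 / real N) * H1_norm (\<lambda>x. PiN N u_star x - uN N x)
           \<le> C * real N powr (-3) * H1_norm (\<lambda>x. PiN N u_star x - u_star x)"
proof -
  interpret ground_state V u_star Vmin
    by standard (use assms in_Hs_sobolev[OF V_reg, of 2] in \<open>auto simp: AE_torus\<close>)
  obtain N0 where N0: "\<And>N. N \<ge> N0 \<Longrightarrow> nsq (eta N) \<le> 3 / 4" using eta_small by blast
  define C where "C = (1 + sqrt (1 + (2 * pi)\<^sup>2)) * K9"
  \<comment> \<open>The threshold is at least 1 because the estimate divides by N, and at least
    \<open>N0\<close> so that the projection keeps a definite part of the mass.\<close>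
  have "L2_norm (\<lambda>x. PiN N u_star x - uN N x) + (1 / real N) * H1_norm (\<lambda>x. PiN N u_star x - uN N x)
      \<le> C * real N powr (-3) * H1_norm (\<lambda>x. PiN N u_star x - u_star x)" if N: "N \<ge> max 1 N0" for N
  proof -
    have N1: "0 < N" and small: "nsq (eta N) \<le> 3 / 4" using N N0[of N] by auto
    define e where "e = (\<lambda>x. proj N u_star x - uN N x)"
    have eX: "e \<in> XN N"
      unfolding e_def using uN_min[of N] by (intro XN_diff trig_XN) (simp add: is_minimiser_on_def)
    have sgn: "0 \<le> ip (uN N) u_star" using uN_sign[of N] by (simp add: L2_inner_ip)
    have eq: "H1_norm (\<lambda>x. PiN N u_star x - u_star x) = sqrt (sobolev_sq 1 (eta N))"
      unfolding PiN_eq_proj[OF u_L2] H1_norm_sobolev_sq eta_def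
      by (simp only: sobolev_sq_minus_commute[of 1 "proj N u_star"])
    have x: "sqrt (nsq e) \<le> K9 * sqrt (sobolev_sq 1 (eta N)) / (real N)^3"
      unfolding e_def by (rule superconvergence[OF N1 small uN_min sgn])
    \<comment> \<open>The inverse inequality costs one factor N, which the weight 1 / N pays
      for.\<close>
    have "(1 / real N) * sqrt (sobolev_sq 1 e) \<le> (1 / real N) * (sqrt (1 + (2 * pi)\<^sup>2) * (real N * sqrt (nsq e)))"
      by (intro mult_left_mono inverse_inequality[OF eX N1]) simp
    also have "\<dots> = sqrt (1 + (2 * pi)\<^sup>2) * sqrt (nsq e)" using N1 by simp
    finally have "sqrt (nsq e) + (1 / real N) * sqrt (sobolev_sq 1 e) \<le> (1 + sqrt (1 + (2 * pi)\<^sup>2)) * sqrt (nsq e)"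
      by (simp add: distrib_right)
    also have "\<dots> \<le> (1 + sqrt (1 + (2 * pi)\<^sup>2)) * (K9 * sqrt (sobolev_sq 1 (eta N)) / (real N)^3)"
      by (intro mult_left_mono x) simp
    also have "\<dots> = C * real N powr (-3) * sqrt (sobolev_sq 1 (eta N))"
    proof -
      have "real N powr (-3) = 1 / (real N)^3" using N1 by (simp add: powr_minus_divide)
      then show ?thesis by (simp add: C_def)
    qed
    finally show ?thesis
      unfolding eq by (simp only: PiN_eq_proj[OF u_L2] L2_norm_nsq H1_norm_sobolev_sq e_def)
  qed
  then show ?thesis by blast
qed

end
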